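(* Let $M$ be a member of $\mathcal{K}^{\ast}(4)$ (i.e. a neighborly triangulated $4$-manifold all of whose vertex links are stacked $3$-spheres) with $f_0(M)=15$ vertices, and suppose that the automorphism group of $M$ contains a subgroup isomorphic to $\mathbb{Z}_3$. Then $M\cong\partial N_i$ for some $i\in\{1,2,\ldots,12\}$, where $N_1,\ldots,N_{12}$ are the explicit $15$-vertex simplicial complexes listed in the context.
   Context: All simplicial complexes are finite and abstract; facets are maximal faces; a complex is pure if all facets have the same dimension; $f_0(X)$ is the number of vertices of $X$. A complex is neighborly if its edge graph ($1$-skeleton) is a complete graph on its vertex set. The link of a vertex $x$ in $X$ is $\{\alpha\in X:\ x\notin\alpha,\ \alpha\cup\{x\}\in X\}$. A standard $d$-ball is the pure $d$-dimensional complex with one facet. A stacked $d$-ball is a complex obtained from a standard $d$-ball by successively pasting $d$-simplices along $(d-1)$-faces (at each step, a new facet $\sigma\cup\{v\}$ is added with $\sigma$ a $(d-1)$-face in the boundary of the current complex and $v$ a new vertex). A stacked $d$-sphere is the boundary of a stacked $(d+1)$-ball. For a pure $d$-dimensional complex $X$ in which each $(d-1)$-face lies in at most two facets, $\partial X$ is the pure $(d-1)$-dimensional complex whose facets are the $(d-1)$-faces of $X$ lying in exactly one facet of $X$. $\mathcal{K}(d)$ (Walkup's class) is the class of simplicial complexes all of whose vertex links are stacked $(d-1)$-spheres (such complexes are triangulated $d$-manifolds), and $\mathcal{K}^{\ast}(d)$ is the class of its neighborly members. $\cong$ denotes simplicial isomorphism, and an automorphism is an isomorphism of a complex with itself. Definition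 of $N_1,\ldots,N_{12}$. Let $V=\bigcup_{i=1}^5\{a_i,b_i,c_i\}$ be a $15$-element set and let $\varphi=(a_1,b_1,c_1)(a_2,b_2,c_2)(a_3,b_3,c_3)(a_4,b_4,c_4)(a_5,b_5,c_5)$ (so $a_i\mapsto b_i\mapsto c_i\mapsto a_i$). A set of vertices is written as the concatenation of its elements. $N_i$ is the simplicial complex on $V$ whose facets are $z=a_1b_1c_1a_2b_2c_2$ together with $u_{i,k},\ \varphi(u_{i,k}),\ \varphi^2(u_{i,k})$ for $1\le k\le 8$, where $u_{i,1},\ldots,u_{i,8}$ are, in order: $i=1$: $a_1b_1c_1a_2b_2a_3$, $a_1b_1a_2b_2a_3a_4$, $a_1a_2b_2a_3a_4a_5$, $a_1a_2a_3a_4b_4a_5$, $a_1a_3a_4b_4a_5b_5$, $a_3b_3a_4b_4a_5b_5$, $c_2a_3b_3b_4a_5b_5$, $b_1c_2b_3b_4a_5b_5$. $i=2$: $a_1b_1c_1a_2b_2a_3$, $a_1b_1a_2b_2a_3a_4$, $a_1a_2b_2a_3a_4a_5$, $a_1a_2a_3a_4b_4a_5$, $a_1a_2a_3b_4a_5b_5$, $a_2a_3b_3b_4a_5b_5$, $a_3b_3b_4c_4a_5b_5$, $b_1b_3b_4c_4a_5b_5$. $i=3$: $a_1b_1c_1a_2b_2a_3$, $a_1b_1a_2b_2a_3a_4$, $a_1b_1a_2a_3a_4a_5$, $a_1a_2a_3a_4b_4a_5$, $a_1a_2a_3b_4a_5b_5$, $a_2a_3b_3b_4a_5b_5$, $a_3b_3b_4c_4a_5b_5$,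 $b_2b_3b_4c_4a_5b_5$. $i=4$: $a_1b_1c_1a_2b_2a_3$, $a_1b_1a_2b_2a_3a_4$, $a_1b_1a_2a_3a_4a_5$, $b_1a_2a_3a_4a_5c_5$, $a_2a_3b_3a_4a_5c_5$, $a_2a_3b_3a_4b_4a_5$, $a_2b_3a_4b_4a_5b_5$, $c_1b_3a_4b_4a_5b_5$. $i=5$: $a_1b_1c_1a_2b_2a_3$, $a_1b_1c_1a_2a_3a_4$, $a_1b_1a_2a_3a_4a_5$, $a_1a_2a_3a_4a_5b_5$, $a_2a_3a_4b_4a_5b_5$, $a_2a_3b_3b_4a_5b_5$, $a_2a_3b_3b_4c_4b_5$, $a_2b_3b_4c_4b_5c_5$. $i=6$: $a_1b_1c_1a_2b_2a_3$, $a_1b_1c_1a_2a_3a_4$, $a_1b_1a_2a_3a_4a_5$, $a_1a_2a_3a_4a_5b_5$, $a_2a_3a_4b_4a_5b_5$, $a_2a_3b_3a_4b_4b_5$, $a_2a_3b_3b_4b_5c_5$, $a_2b_3b_4c_4b_5c_5$. $i=7$: $a_1b_1c_1a_2b_2a_3$, $a_1b_1c_1a_2a_3a_4$, $a_1b_1a_2a_3a_4a_5$, $b_1a_2a_3a_4a_5c_5$, $a_2a_3a_4b_4a_5c_5$, $a_2a_3b_3b_4a_5c_5$, $a_2a_3b_3b_4c_4a_5$, $a_2b_3b_4c_4a_5b_5$. $i=8$: $a_1b_1c_1a_2b_2a_3$, $a_1b_1c_1a_2a_3a_4$, $a_1b_1a_2a_3a_4a_5$, $b_1a_2a_3a_4a_5c_5$,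 $a_2a_3a_4b_4a_5c_5$, $a_2a_3b_3a_4b_4a_5$, $a_2a_3b_3b_4a_5b_5$, $a_2b_3b_4c_4a_5b_5$. $i=9$: $a_1b_1c_1a_2b_2a_3$, $a_1b_1c_1a_2a_3a_4$, $a_1b_1a_2a_3a_4a_5$, $a_1a_2a_3a_4a_5b_5$, $a_2a_3a_4c_4a_5b_5$, $a_2a_3b_3a_4c_4b_5$, $a_2a_3b_3a_4b_5c_5$, $a_2b_3a_4b_4b_5c_5$. $i=10$: $a_1b_1c_1a_2b_2a_3$, $a_1b_1c_1a_2a_3a_4$, $a_1b_1a_2a_3a_4a_5$, $b_1a_2a_3a_4a_5c_5$, $a_2a_3a_4c_4a_5c_5$, $a_2a_3b_3a_4c_4a_5$, $a_2a_3b_3a_4a_5b_5$, $a_2b_3a_4b_4a_5b_5$. $i=11$: $a_1b_1c_1a_2b_2a_3$, $a_1b_1c_1a_2a_3a_4$, $a_1b_1a_2a_3a_4a_5$, $a_1a_2a_3a_4a_5b_5$, $a_2a_3b_3a_4a_5b_5$, $a_2b_3a_4b_4a_5b_5$, $b_2b_3a_4b_4a_5b_5$, $b_2b_3c_3a_4b_4b_5$. $i=12$: $a_1b_1c_1a_2b_2a_3$, $a_1b_1c_1a_2a_3a_4$, $a_1b_1a_2a_3a_4a_5$, $b_1a_2a_3a_4a_5c_5$, $a_2a_3b_3a_4a_5c_5$, $a_2b_3a_4b_4a_5c_5$, $b_2b_3a_4b_4a_5c_5$, $b_2b_3c_3a_4b_4a_5$. *)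

theory Defs
  imports "HOL-Algebra.Bij" "HOL-Algebra.Elementary_Groups"
begin

section \<open>Finite abstract simplicial complexes\<close>

text \<open>A complex is the set of all its faces. The empty set counts as a face (of dimension \<open>-1\<close>),
  and a face of dimension \<open>k\<close> is one of cardinality \<open>k + 1\<close>.\<close>

definition vertex_set :: "'a set set \<Rightarrow> 'a set" where
  "vertex_set X = \<Union>X"

definition abstract_complex :: "'a set set \<Rightarrow> bool" where
  "abstract_complex X \<longleftrightarrow>
     finite (vertex_set X) \<and> (\<forall>\<alpha>\<in>X. \<forall>\<beta>. \<beta> \<subseteq> \<alpha> \<longrightarrow> \<beta> \<in> X)"

definition facets :: "'a set set \<Rightarrow> 'a set set" where
  "facets X = {\<alpha> \<in> X. \<forall>\<beta>\<in>X. \<alpha> \<subseteq> \<beta> \<longrightarrow> \<beta> = \<alpha>}"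

definition neighborly :: "'a set set \<Rightarrow> bool" where
  "neighborly X \<longleftrightarrow>
     (\<forall>x\<in>vertex_set X. \<forall>y\<in>vertex_set X. x \<noteq> y \<longrightarrow> {x, y} \<in> X)"

definition link :: "'a \<Rightarrow> 'a set set \<Rightarrow> 'a set set" where
  "link x X = {\<alpha> \<in> X. x \<notin> \<alpha> \<and> \<alpha> \<union> {x} \<in> X}"

text \<open>The boundary of a pure \<open>d\<close>-dimensional complex: the complex generated by the
  \<open>(d - 1)\<close>-faces (which have \<open>d\<close> vertices) lying in exactly one facet.
  The dimension \<open>d\<close> is passed explicitly.\<close>

definition boundary_complex :: "nat \<Rightarrow> 'a set set \<Rightarrow> 'a set set" where
  "boundary_complex d X =
     {\<alpha>. \<exists>\<beta>\<in>X. card \<beta> = d \<and> card {\<sigma> \<in> facets X. \<beta> \<subseteq> \<sigma>} = 1 \<and> \<alpha> \<subseteq> \<beta>}"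


section \<open>Stacked balls, stacked spheres and Walkup's class\<close>

inductive stacked_ball :: "nat \<Rightarrow> 'a set set \<Rightarrow> bool" for d :: nat where
  standard: "finite \<sigma> \<Longrightarrow> card \<sigma> = d + 1 \<Longrightarrow> stacked_ball d (Pow \<sigma>)"
| paste: "stacked_ball d X \<Longrightarrow> \<sigma> \<in> boundary_complex d X \<Longrightarrow> card \<sigma> = d \<Longrightarrow> v \<notin> vertex_set X
    \<Longrightarrow> stacked_ball d (X \<union> Pow (\<sigma> \<union> {v}))"

text \<open>It does no harm that the ball is taken over the vertex type of the sphere: a stacked
  \<open>(d + 1)\<close>-ball with \<open>d \<ge> 1\<close> has no vertices besides those of its boundary, and for \<open>d = 0\<close>
  every stacked sphere bounds a single edge.\<close>

definition stacked_sphere :: "nat \<Rightarrow> 'a set set \<Rightarrow> bool" where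
  "stacked_sphere d S \<longleftrightarrow> (\<exists>B. stacked_ball (d + 1) B \<and> S = boundary_complex (d + 1) B)"

text \<open>Meaningful for \<open>d \<ge> 1\<close> only, because of the truncated subtraction.\<close>

definition walkup_class :: "nat \<Rightarrow> 'a set set set" where
  "walkup_class d =
     {X. abstract_complex X \<and> (\<forall>x\<in>vertex_set X. stacked_sphere (d - 1) (link x X))}"

definition neighborly_walkup_class :: "nat \<Rightarrow> 'a set set set" where
  "neighborly_walkup_class d = {X \<in> walkup_class d. neighborly X}"


section \<open>Isomorphisms and automorphisms\<close>

definition simplicial_iso :: "('a \<Rightarrow> 'b) \<Rightarrow> 'a set set \<Rightarrow> 'b set set \<Rightarrow> bool" where
  "simplicial_iso f X Y \<longleftrightarrow>
     bij_betw f (vertex_set X) (vertex_set Y) \<and>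
     (\<forall>\<alpha>. \<alpha> \<subseteq> vertex_set X \<longrightarrow> (\<alpha> \<in> X \<longleftrightarrow> f ` \<alpha> \<in> Y))"

definition isomorphic_complexes :: "'a set set \<Rightarrow> 'b set set \<Rightarrow> bool"  (infix "\<cong>\<^sub>s" 50) where
  "X \<cong>\<^sub>s Y \<longleftrightarrow> (\<exists>f. simplicial_iso f X Y)"

text \<open>Automorphisms are normalised to be \<open>undefined\<close> outside the vertex set, as in \<^const>\<open>BijGroup\<close>,
  so that two of them are equal as soon as they agree on the vertices.\<close>

definition aut_group :: "'a set set \<Rightarrow> ('a \<Rightarrow> 'a) monoid" where
  "aut_group X =
     (BijGroup (vertex_set X)) \<lparr>carrier := {f \<in> Bij (vertex_set X). simplicial_iso f X X}\<rparr>"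

lemma subgroup_aut:
  "subgroup {f \<in> Bij (vertex_set X). simplicial_iso f X X} (BijGroup (vertex_set X))"
proof -
  let ?V = "vertex_set X"
  let ?A = "{f \<in> Bij ?V. simplicial_iso f X X}"
  have mult: "compose ?V f g \<in> ?A" if "f \<in> ?A" "g \<in> ?A" for f g
  proof -
    have B: "compose ?V f g \<in> Bij ?V" using that by (auto intro: compose_Bij)
    have "\<alpha> \<in> X \<longleftrightarrow> compose ?V f g ` \<alpha> \<in> X" if "\<alpha> \<subseteq> ?V" for \<alpha>
    proof -
      have "g ` \<alpha> \<subseteq> ?V"
        using \<open>g \<in> ?A\<close> that by (auto simp: Bij_def dest!: bij_betwE)
      moreover have "compose ?V f g ` \<alpha> = f ` g ` \<alpha>"
        using that by (force simp: compose_def image_iff subset_iff)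
      ultimately show ?thesis
        using \<open>f \<in> ?A\<close> \<open>g \<in> ?A\<close> that by (auto simp: simplicial_iso_def)
    qed
    with B show ?thesis by (auto simp: simplicial_iso_def Bij_def)
  qed
  have inv: "inv\<^bsub>BijGroup ?V\<^esub> f \<in> ?A" if f: "f \<in> ?A" for f
  proof -
    have bij: "bij_betw f ?V ?V" using f by (auto simp: Bij_def)
    let ?g = "\<lambda>x\<in>?V. (inv_into ?V f) x"
    have g: "?g \<in> Bij ?V" using f by (auto intro: restrict_inv_into_Bij)
    have "\<alpha> \<in> X \<longleftrightarrow> ?g ` \<alpha> \<in> X" if a: "\<alpha> \<subseteq> ?V" for \<alpha>
    proof -
      have "?g ` \<alpha> \<subseteq> ?V" using g a by (auto simp: Bij_def dest!: bij_betwE)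
      moreover have "f ` ?g ` \<alpha> = \<alpha>"
        using a bij by (force simp: image_iff subset_iff bij_betw_inv_into_right)
      ultimately show ?thesis using f unfolding simplicial_iso_def by auto
    qed
    with g have "?g \<in> ?A" by (auto simp: simplicial_iso_def Bij_def)
    then show ?thesis using f by (simp add: inv_BijGroup)
  qed
  have "compose ?V (\<lambda>x\<in>?V. x) (\<lambda>x\<in>?V. x) = (\<lambda>x\<in>?V. x)"
    by (auto simp: compose_def)
  moreover have "(\<lambda>x\<in>?V. x) \<in> ?A"
  proof -
    have "(\<lambda>x\<in>?V. x) ` \<alpha> = \<alpha>" if "\<alpha> \<subseteq> ?V" for \<alpha> using that by force
    then show ?thesis using id_Bij by (auto simp: simplicial_iso_def Bij_def)
  qed
  ultimately show ?thesis
    using mult inv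
    by (intro group.subgroupI group_BijGroup) (auto simp: BijGroup_def)
qed

lemma group_aut_group: "group (aut_group X)"
  unfolding aut_group_def
  by (rule group.subgroup_imp_group[OF group_BijGroup subgroup_aut])


section \<open>The complexes \<open>N\<^sub>1, \<dots>, N\<^sub>1\<^sub>2\<close>\<close>

datatype vertex = a1 | a2 | a3 | a4 | a5 | b1 | b2 | b3 | b4 | b5 | c1 | c2 | c3 | c4 | c5

fun \<phi> :: "vertex \<Rightarrow> vertex" where
  "\<phi> a1 = b1" | "\<phi> b1 = c1" | "\<phi> c1 = a1"
| "\<phi> a2 = b2" | "\<phi> b2 = c2" | "\<phi> c2 = a2"
| "\<phi> a3 = b3" | "\<phi> b3 = c3" | "\<phi> c3 = a3"
| "\<phi> a4 = b4" | "\<phi> b4 = c4" | "\<phi> c4 = a4"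
| "\<phi> a5 = b5" | "\<phi> b5 = c5" | "\<phi> c5 = a5"

definition z_facet :: "vertex set" where
  "z_facet = {a1, b1, c1, a2, b2, c2}"

text \<open>The \<open>k\<close>-th entry of the \<open>i\<close>-th list (counting from 1) is the facet \<open>u\<^sub>i\<^sub>,\<^sub>k\<close>.\<close>

definition u_table :: "vertex set list list" where
  "u_table =
    [[{a1, b1, c1, a2, b2, a3},
      {a1, b1, a2, b2, a3, a4},
      {a1, a2, b2, a3, a4, a5},
      {a1, a2, a3, a4, b4, a5},
      {a1, a3, a4, b4, a5, b5},
      {a3, b3, a4, b4, a5, b5},
      {c2, a3, b3, b4, a5, b5},
      {b1, c2, b3, b4, a5, b5}],
     [{a1, b1, c1, a2, b2, a3},
      {a1, b1, a2, b2, a3, a4},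
      {a1, a2, b2, a3, a4, a5},
      {a1, a2, a3, a4, b4, a5},
      {a1, a2, a3, b4, a5, b5},
      {a2, a3, b3, b4, a5, b5},
      {a3, b3, b4, c4, a5, b5},
      {b1, b3, b4, c4, a5, b5}],
     [{a1, b1, c1, a2, b2, a3},
      {a1, b1, a2, b2, a3, a4},
      {a1, b1, a2, a3, a4, a5},
      {a1, a2, a3, a4, b4, a5},
      {a1, a2, a3, b4, a5, b5},
      {a2, a3, b3, b4, a5, b5},
      {a3, b3, b4, c4, a5, b5},
      {b2, b3, b4, c4, a5, b5}],
     [{a1, b1, c1, a2, b2, a3},
      {a1, b1, a2, b2, a3, a4},
      {a1, b1, a2, a3, a4, a5},
      {b1, a2, a3, a4, a5, c5},
      {a2, a3, b3, a4, a5, c5},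
      {a2, a3, b3, a4, b4, a5},
      {a2, b3, a4, b4, a5, b5},
      {c1, b3, a4, b4, a5, b5}],
     [{a1, b1, c1, a2, b2, a3},
      {a1, b1, c1, a2, a3, a4},
      {a1, b1, a2, a3, a4, a5},
      {a1, a2, a3, a4, a5, b5},
      {a2, a3, a4, b4, a5, b5},
      {a2, a3, b3, b4, a5, b5},
      {a2, a3, b3, b4, c4, b5},
      {a2, b3, b4, c4, b5, c5}],
     [{a1, b1, c1, a2, b2, a3},
      {a1, b1, c1, a2, a3, a4},
      {a1, b1, a2, a3, a4, a5},
      {a1, a2, a3, a4, a5, b5},
      {a2, a3, a4, b4, a5, b5},
      {a2, a3, b3, a4, b4, b5},
      {a2, a3, b3, b4, b5, c5},
      {a2, b3, b4, c4, b5, c5}],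
     [{a1, b1, c1, a2, b2, a3},
      {a1, b1, c1, a2, a3, a4},
      {a1, b1, a2, a3, a4, a5},
      {b1, a2, a3, a4, a5, c5},
      {a2, a3, a4, b4, a5, c5},
      {a2, a3, b3, b4, a5, c5},
      {a2, a3, b3, b4, c4, a5},
      {a2, b3, b4, c4, a5, b5}],
     [{a1, b1, c1, a2, b2, a3},
      {a1, b1, c1, a2, a3, a4},
      {a1, b1, a2, a3, a4, a5},
      {b1, a2, a3, a4, a5, c5},
      {a2, a3, a4, b4, a5, c5},
      {a2, a3, b3, a4, b4, a5},
      {a2, a3, b3, b4, a5, b5},
      {a2, b3, b4, c4, a5, b5}],
     [{a1, b1, c1, a2, b2, a3},
      {a1, b1, c1, a2, a3, a4},
      {a1, b1, a2, a3, a4, a5},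
      {a1, a2, a3, a4, a5, b5},
      {a2, a3, a4, c4, a5, b5},
      {a2, a3, b3, a4, c4, b5},
      {a2, a3, b3, a4, b5, c5},
      {a2, b3, a4, b4, b5, c5}],
     [{a1, b1, c1, a2, b2, a3},
      {a1, b1, c1, a2, a3, a4},
      {a1, b1, a2, a3, a4, a5},
      {b1, a2, a3, a4, a5, c5},
      {a2, a3, a4, c4, a5, c5},
      {a2, a3, b3, a4, c4, a5},
      {a2, a3, b3, a4, a5, b5},
      {a2, b3, a4, b4, a5, b5}],
     [{a1, b1, c1, a2, b2, a3},
      {a1, b1, c1, a2, a3, a4},
      {a1, b1, a2, a3, a4, a5},
      {a1, a2, a3, a4, a5, b5},
      {a2, a3, b3, a4, a5, b5},
      {a2, b3, a4, b4, a5, b5},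
      {b2, b3, a4, b4, a5, b5},
      {b2, b3, c3, a4, b4, b5}],
     [{a1, b1, c1, a2, b2, a3},
      {a1, b1, c1, a2, a3, a4},
      {a1, b1, a2, a3, a4, a5},
      {b1, a2, a3, a4, a5, c5},
      {a2, a3, b3, a4, a5, c5},
      {a2, b3, a4, b4, a5, c5},
      {b2, b3, a4, b4, a5, c5},
      {b2, b3, c3, a4, b4, a5}]]"

definition N_facets :: "nat \<Rightarrow> vertex set set" where
  "N_facets i =
     {z_facet} \<union> (\<Union>u \<in> set (u_table ! (i - 1)). {u, \<phi> ` u, \<phi> ` \<phi> ` u})"

definition N :: "nat \<Rightarrow> vertex set set" where
  "N i = {\<alpha>. \<exists>\<sigma>\<in>N_facets i. \<alpha> \<subseteq> \<sigma>}"

end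

theory Submission
  imports Defs
begin

text \<open>Every vertex link of \<open>M\<close> bounds a unique stacked 4-ball, namely the clique complex of its graph. Hence the
  6-sets all of whose triples are faces of \<open>M\<close> form a family \<open>F\<close> of facets with boundary \<open>M\<close>, in which the facets
  through any vertex form a stacked ball on all 15 vertices. Double counting shows that \<open>F\<close> has 25 facets
  and that its dual graph has 27 edges; moreover the dual graph is connected and has no leaves.

  A symmetry \<open>f\<close> of order three acts on the dual graph without fixed edges and fixes a facet \<open>z\<close>. A set of facets
  that is invariant, nonempty and spans more edges than it has elements must be all of \<open>F\<close>, by
  counting degrees outside of it. This yields a path \<open>z, u\<^sub>1, \<dots>, u\<^sub>8\<close> of adjacent facets that meets every orbit once.
  If \<open>f\<close> has fixed vertices, there are exactly three of them and they lie in \<open>z\<close>.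

  Each \<open>u\<^sub>k\<^sub>+\<^sub>1\<close> arises from \<open>u\<^sub>k\<close> by exchanging one vertex, so all such paths are found by a
  search that names new orbits in order of appearance. It is pruned by one condition: \<open>n > 0\<close> facets with a common
  vertex cover at least \<open>n + 5\<close> vertices. If \<open>f\<close> has fixed vertices, the search fails; otherwise
  each path that it finds either violates a necessary condition or is recognised as one of the \<open>N\<^sub>i\<close>.\<close>

section \<open>Stacked families of six-element sets\<close>

text \<open>The numbers 25 and 27 shape the argument: a connected graph with 25 nodes and 27 edges
  has cyclomatic number 3, exactly the order of the symmetry. New edges come in orbits of three, so
  an invariant set that grows along a path and meets itself gains the whole surplus of three edges
  at once. This is why a path of orbit representatives, rather than a tree, can be grown greedily up
  to 1 + 8 entries.

  The obstacle is the size of the enumeration, which is carried out by rewriting. It stays small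
  because a fresh vertex is unique up to a permutation that normalises the symmetry, because the
  vertex inserted last is never exchanged at once, and because one counter per orbit of vertices
  suffices. After labelling only two symmetries remain: five rotated triples, or three fixed
  vertices and four rotated triples.\<close>

inductive stacked_family :: "'a set set \<Rightarrow> bool" where
  single: "stacked_family {\<sigma>}"
| attach: "stacked_family S \<Longrightarrow> \<sigma> \<in> S \<Longrightarrow> x \<in> \<sigma> \<Longrightarrow> y \<notin> \<Union>S \<Longrightarrow> (\<forall>\<rho>\<in>S. \<sigma> - {x} \<subseteq> \<rho> \<longrightarrow> \<rho> = \<sigma>)
    \<Longrightarrow> stacked_family (insert (insert y (\<sigma> - {x})) S)"

text \<open>Kept apart from \<open>stacked_family\<close>, which fixes no dimension: the same notion
  serves the 5-element facets of a 4-ball and, with the cone vertex added, the 6-element facets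
  through a vertex.\<close>

definition six_sets :: "'a set set \<Rightarrow> bool" where
  "six_sets S \<longleftrightarrow> (\<forall>\<sigma>\<in>S. card \<sigma> = 6)"

definition adjacent :: "'a set \<Rightarrow> 'a set \<Rightarrow> bool" where
  "adjacent \<sigma> \<rho> \<longleftrightarrow> card (\<sigma> \<inter> \<rho>) = 5"

definition edges :: "'a set set \<Rightarrow> 'a set set set" where
  "edges S = {{\<sigma>, \<rho>} | \<sigma> \<rho>. \<sigma> \<in> S \<and> \<rho> \<in> S \<and> adjacent \<sigma> \<rho>}"

lemma adjacent_sym: "adjacent \<sigma> \<rho> \<longleftrightarrow> adjacent \<rho> \<sigma>"
  by (simp add: adjacent_def Int_commute)

lemma adjacent_neq: "card \<sigma> = 6 \<Longrightarrow> adjacent \<sigma> \<rho> \<Longrightarrow> \<sigma> \<noteq> \<rho>"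
  by (auto simp: adjacent_def)

lemma card6_finite: "card \<sigma> = 6 \<Longrightarrow> finite \<sigma>"
  by (rule card_ge_0_finite) simp

lemma six_setsD: "six_sets S \<Longrightarrow> \<sigma> \<in> S \<Longrightarrow> card \<sigma> = 6 \<and> finite \<sigma>"
  by (auto simp: six_sets_def card6_finite)

lemma six_sets_insert: "six_sets (insert \<sigma> S) \<longleftrightarrow> card \<sigma> = 6 \<and> six_sets S"
  by (auto simp: six_sets_def)

lemma six_sets_subset: "six_sets S \<Longrightarrow> S' \<subseteq> S \<Longrightarrow> six_sets S'"
  by (auto simp: six_sets_def)

lemma adjacent_exchange:
  assumes "card \<sigma> = 6" "card \<rho> = 6" "adjacent \<sigma> \<rho>"
  obtains x y where "x \<in> \<sigma>" "y \<notin> \<sigma>" "x \<notin> \<rho>" "\<rho> = insert y (\<sigma> - {x})"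
proof -
  have f: "finite \<sigma>" "finite \<rho>" using assms card6_finite by auto
  have "card (\<sigma> - \<rho>) = 1" using assms f
    by (simp add: card_Diff_subset_Int adjacent_def)
  then obtain x where x: "\<sigma> - \<rho> = {x}" by (auto simp: card_1_singleton_iff)
  have "card (\<rho> - \<sigma>) = 1" using assms f
    by (simp add: card_Diff_subset_Int adjacent_def Int_commute)
  then obtain y where y: "\<rho> - \<sigma> = {y}" by (auto simp: card_1_singleton_iff)
  show ?thesis by (rule that[of x y]) (use x y in auto)
qed

lemma exchange_adjacent:
  assumes "card \<sigma> = 6" "x \<in> \<sigma>" "y \<notin> \<sigma>"
  shows "adjacent (insert y (\<sigma> - {x})) \<sigma>" "adjacent \<sigma> (insert y (\<sigma> - {x}))"
    "card (insert y (\<sigma> - {x})) = 6"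
proof -
  have "insert y (\<sigma> - {x}) \<inter> \<sigma> = \<sigma> - {x}" using assms by auto
  then show "adjacent (insert y (\<sigma> - {x})) \<sigma>"
    using assms card6_finite[of \<sigma>] by (simp add: adjacent_def)
  then show "adjacent \<sigma> (insert y (\<sigma> - {x}))" by (simp add: adjacent_sym)
  show "card (insert y (\<sigma> - {x})) = 6"
    using assms card6_finite[of \<sigma>] by simp
qed

lemma finite_edges: "finite S \<Longrightarrow> finite (edges S)"
  by (rule finite_subset[of _ "Pow S"]) (auto simp: edges_def)

lemma edges_mono: "S \<subseteq> S' \<Longrightarrow> edges S \<subseteq> edges S'"
  by (auto simp: edges_def)

lemma edges_subset: "e \<in> edges S \<Longrightarrow> e \<subseteq> S"
  by (auto simp: edges_def)

lemma edgesI: "\<sigma> \<in> S \<Longrightarrow> \<rho> \<in> S \<Longrightarrow> adjacent \<sigma> \<rho> \<Longrightarrow> {\<sigma>, \<rho>} \<in> edges S"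
  by (auto simp: edges_def)

lemma stacked_family_finite: "stacked_family S \<Longrightarrow> finite S \<and> S \<noteq> {}"
  by (induction rule: stacked_family.induct) auto

lemma stacked_family_card_Union:
  "stacked_family S \<Longrightarrow> six_sets S \<Longrightarrow> card (\<Union>S) = card S + 5 \<and> finite (\<Union>S)"
proof (induction rule: stacked_family.induct)
  case (single \<sigma>)
  then show ?case by (simp add: six_sets_def card6_finite)
next
  case (attach S \<sigma> x y)
  let ?n = "insert y (\<sigma> - {x})"
  have "six_sets S" using attach.prems by (simp add: six_sets_insert)
  then have IH: "card (\<Union>S) = card S + 5" "finite (\<Union>S)" using attach.IH by auto
  have "\<Union>(insert ?n S) = insert y (\<Union>S)" using attach.hyps by auto
  moreover have "?n \<notin> S" using attach.hyps by auto
  ultimately show ?case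
    using IH attach.hyps stacked_family_finite[OF attach.hyps(1)] by simp
qed

text \<open>The pruning inequality of the search. If the last attached facet belongs to
  \<open>W\<close>, no other member contains its vertex \<open>y\<close>, so removing that facet
  loses at least one vertex.\<close>

lemma stacked_family_subset_card:
  "stacked_family S \<Longrightarrow> six_sets S \<Longrightarrow> W \<subseteq> S \<Longrightarrow> W \<noteq> {} \<Longrightarrow> card W + 5 \<le> card (\<Union>W)"
proof (induction arbitrary: W rule: stacked_family.induct)
  case (single \<sigma>)
  then have "W = {\<sigma>}" by auto
  then show ?case using single by (simp add: six_sets_def)
next
  case (attach S \<sigma> x y)
  let ?n = "insert y (\<sigma> - {x})"
  have S: "six_sets S" "card ?n = 6" using attach.prems by (simp_all only: six_sets_insert)
  show ?case
  proof (cases "?n \<in> W")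
    case False
    then show ?thesis using attach.IH[OF S(1)] attach.prems by auto
  next
    case True
    define W' where "W' = W - {?n}"
    have W': "W' \<subseteq> S" "W = insert ?n W'" "?n \<notin> W'" using True attach.prems by (auto simp: W'_def)
    have fin: "finite W'" using W'(1) stacked_family_finite[OF attach.hyps(1)] finite_subset by auto
    show ?thesis
    proof (cases "W' = {}")
      case True
      then show ?thesis using W' S by simp
    next
      case False
      have "card W' + 5 \<le> card (\<Union>W')" using attach.IH[OF S(1) W'(1) False] .
      moreover have fU: "finite (\<Union>W')" using fin W'(1) six_setsD[OF S(1)] by auto
      moreover have "insert y (\<Union>W') \<subseteq> \<Union>W" using W' by auto
      moreover have "finite (\<Union>W)" unfolding W'(2) Union_insert by (rule finite_UnI[OF card6_finite[OF S(2)] fU])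
      moreover have "y \<notin> \<Union>W'" using W' attach.hyps by auto
      ultimately have "card (\<Union>W') + 1 \<le> card (\<Union>W)"
        using card_mono[of "\<Union>W" "insert y (\<Union>W')"] by simp
      then show ?thesis using \<open>card W' + 5 \<le> _\<close> W' fin by simp
    qed
  qed
qed

text \<open>A 5-subset of the new facet that lies in an old one avoids \<open>y\<close>, hence
  equals \<open>\<sigma> - {x}\<close>, which only \<open>\<sigma>\<close> contained before.\<close>

lemma stacked_family_ridge:
  "stacked_family S \<Longrightarrow> six_sets S \<Longrightarrow> card \<tau> = 5 \<Longrightarrow> card {\<sigma>\<in>S. \<tau> \<subseteq> \<sigma>} \<le> 2"
proof (induction rule: stacked_family.induct)
  case (single \<sigma>)
  have "card {\<rho> \<in> {\<sigma>}. \<tau> \<subseteq> \<rho>} \<le> card {\<sigma>}" by (rule card_mono) auto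
  then show ?case by simp
next
  case (attach S \<sigma> x y)
  let ?n = "insert y (\<sigma> - {x})"
  have S: "six_sets S" "card ?n = 6" using attach.prems by (simp_all only: six_sets_insert)
  have fS: "finite S" using stacked_family_finite[OF attach.hyps(1)] by auto
  have c6: "card \<sigma> = 6" "finite \<sigma>" using S attach.hyps six_setsD by auto
  show ?case
  proof (cases "\<tau> \<subseteq> ?n")
    case False
    then have "{\<rho> \<in> insert ?n S. \<tau> \<subseteq> \<rho>} = {\<rho>\<in>S. \<tau> \<subseteq> \<rho>}" by auto
    then show ?thesis using attach.IH S attach.prems by simp
  next
    case True
    have "{\<rho>\<in>S. \<tau> \<subseteq> \<rho>} \<subseteq> {\<sigma>}"
    proof
      fix \<rho> assume r: "\<rho> \<in> {\<rho>\<in>S. \<tau> \<subseteq> \<rho>}"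
      then have "y \<notin> \<tau>" using attach.hyps by auto
      then have "\<tau> \<subseteq> \<sigma> - {x}" using True by auto
      then have "\<tau> = \<sigma> - {x}" using c6 attach.hyps attach.prems
        by (intro card_subset_eq) auto
      then show "\<rho> \<in> {\<sigma>}" using r attach.hyps by auto
    qed
    then have "{\<rho> \<in> insert ?n S. \<tau> \<subseteq> \<rho>} \<subseteq> {?n, \<sigma>}" by auto
    then have "card {\<rho> \<in> insert ?n S. \<tau> \<subseteq> \<rho>} \<le> card {?n, \<sigma>}" by (intro card_mono) auto
    also have "\<dots> \<le> 2" by (simp add: card_insert_if)
    finally show ?thesis .
  qed
qed

text \<open>In the dual graph the new facet is a leaf hanging from \<open>\<sigma>\<close>: five
  vertices shared with an old facet avoid \<open>y\<close> and so form the free ridge. The dual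
  graph of a stacked family is thus a tree.\<close>

lemma attach_adjacent_iff:
  assumes "six_sets S" "\<sigma> \<in> S" "x \<in> \<sigma>" "y \<notin> \<Union>S" "\<forall>\<rho>\<in>S. \<sigma> - {x} \<subseteq> \<rho> \<longrightarrow> \<rho> = \<sigma>" "\<rho> \<in> S"
  shows "adjacent (insert y (\<sigma> - {x})) \<rho> \<longleftrightarrow> \<rho> = \<sigma>"
proof
  assume a: "adjacent (insert y (\<sigma> - {x})) \<rho>"
  have f: "finite \<sigma>" "card \<sigma> = 6" using assms six_setsD by auto
  have "insert y (\<sigma> - {x}) \<inter> \<rho> = (\<sigma> - {x}) \<inter> \<rho>" using assms by auto
  then have "card ((\<sigma> - {x}) \<inter> \<rho>) = 5" using a by (simp add: adjacent_def)
  moreover have "card (\<sigma> - {x}) = 5" using f assms by simp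
  ultimately have "(\<sigma> - {x}) \<inter> \<rho> = \<sigma> - {x}" using f by (intro card_subset_eq) auto
  then show "\<rho> = \<sigma>" using assms by auto
next
  assume "\<rho> = \<sigma>"
  then show "adjacent (insert y (\<sigma> - {x})) \<rho>"
    using exchange_adjacent(1)[of \<sigma> x y] assms six_setsD by auto
qed

lemma stacked_family_edges:
  "stacked_family S \<Longrightarrow> six_sets S \<Longrightarrow> card (edges S) + 1 = card S"
proof (induction rule: stacked_family.induct)
  case (single \<sigma>)
  then have "edges {\<sigma>} = {}" by (auto simp: edges_def adjacent_def six_sets_def)
  then show ?case by simp
next
  case (attach S \<sigma> x y)
  let ?n = "insert y (\<sigma> - {x})"
  have S: "six_sets S" "card ?n = 6" using attach.prems by (simp_all only: six_sets_insert)
  have fS: "finite S" using stacked_family_finite[OF attach.hyps(1)] by auto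
  have nS: "?n \<notin> S" using attach.hyps by auto
  note iff = attach_adjacent_iff[OF S(1) attach.hyps(2-5)]
  have self: "\<not> adjacent ?n ?n" using S adjacent_neq by blast
  have "edges (insert ?n S) \<subseteq> insert {?n, \<sigma>} (edges S)"
  proof
    fix e assume "e \<in> edges (insert ?n S)"
    then obtain \<alpha> \<beta> where e: "e = {\<alpha>, \<beta>}" "\<alpha> \<in> insert ?n S" "\<beta> \<in> insert ?n S" "adjacent \<alpha> \<beta>"
      unfolding edges_def by blast
    show "e \<in> insert {?n, \<sigma>} (edges S)"
    proof (cases "\<alpha> \<in> S")
      case True
      show ?thesis
      proof (cases "\<beta> \<in> S")
        case True
        then show ?thesis using e(1,4) edgesI[OF \<open>\<alpha> \<in> S\<close> True] by simp
      next
        case False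
        then have "\<beta> = ?n" using e(3) by (metis insertE)
        moreover have "\<alpha> = \<sigma>" using iff[OF \<open>\<alpha> \<in> S\<close>] e(4) adjacent_sym[of \<alpha> \<beta>] \<open>\<beta> = ?n\<close> by simp
        ultimately show ?thesis using e(1) by (simp add: insert_commute)
      qed
    next
      case False
      then have a: "\<alpha> = ?n" using e(2) by (metis insertE)
      then have "\<beta> \<noteq> ?n" using self e(4) by metis
      then have "\<beta> \<in> S" using e(3) by (metis insertE)
      then have "\<beta> = \<sigma>" using iff e(4) a by metis
      then show ?thesis using e(1) a by simp
    qed
  qed
  moreover have "insert {?n, \<sigma>} (edges S) \<subseteq> edges (insert ?n S)"
  proof -
    have "adjacent ?n \<sigma>" using iff[OF attach.hyps(2)] by blast
    then have "{?n, \<sigma>} \<in> edges (insert ?n S)" 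
      by (rule edgesI[OF insertI1 insertI2[OF attach.hyps(2)]])
    moreover have "edges S \<subseteq> edges (insert ?n S)" by (rule edges_mono) blast
    ultimately show ?thesis by blast
  qed
  ultimately have "edges (insert ?n S) = insert {?n, \<sigma>} (edges S)" by blast
  moreover have "{?n, \<sigma>} \<notin> edges S" 
    using edges_subset[of "{?n, \<sigma>}" S] nS by (metis insert_subset)
  ultimately show ?case using attach.IH[OF S(1)] nS fS finite_edges[OF fS] by simp
qed

lemma stacked_family_connected:
  "stacked_family S \<Longrightarrow> six_sets S \<Longrightarrow> A \<subseteq> S \<Longrightarrow> A \<noteq> {} \<Longrightarrow> A \<noteq> S \<Longrightarrow> \<exists>\<sigma>\<in>A. \<exists>\<rho>\<in>S - A. adjacent \<sigma> \<rho>"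
proof (induction arbitrary: A rule: stacked_family.induct)
  case (single \<sigma>)
  then show ?case by auto
next
  case (attach S \<sigma> x y)
  let ?n = "insert y (\<sigma> - {x})"
  have S: "six_sets S" "card ?n = 6" using attach.prems by (simp_all only: six_sets_insert)
  have nS: "?n \<notin> S" using attach.hyps by auto
  have adj: "adjacent ?n \<sigma>" "adjacent \<sigma> ?n"
    using attach_adjacent_iff[OF S(1) attach.hyps(2-5)] attach.hyps(2) adjacent_sym by blast+
  consider "A \<inter> S = {}" | "A \<inter> S = S" | "A \<inter> S \<noteq> {}" "A \<inter> S \<noteq> S" by auto
  then show ?case
  proof cases
    case 1
    then have "A = {?n}" using attach.prems by auto
    then show ?thesis using adj attach.hyps(2) nS by auto
  next
    case 2
    then have "A = S" using attach.prems by auto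
    then show ?thesis using adj attach.hyps(2) nS by auto
  next
    case 3
    then obtain \<alpha> \<beta> where "\<alpha> \<in> A \<inter> S" "\<beta> \<in> S - A \<inter> S" "adjacent \<alpha> \<beta>"
      using attach.IH[OF S(1), of "A \<inter> S"] by auto
    then show ?thesis by auto
  qed
qed

section \<open>Images and cones of stacked families\<close>

lemma stacked_family_image:
  "stacked_family S \<Longrightarrow> inj_on g (\<Union>S) \<Longrightarrow> stacked_family ((`) g ` S)"
proof (induction rule: stacked_family.induct)
  case (single \<sigma>)
  then show ?case by (simp add: stacked_family.single)
next
  case (attach S \<sigma> x y)
  let ?n = "insert y (\<sigma> - {x})"
  have eqU: "\<Union>(insert ?n S) = insert y (\<Union>S)" using attach.hyps by auto
  have inj: "inj_on g (insert y (\<Union>S))" using attach.prems unfolding eqU .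
  then have injS: "inj_on g (\<Union>S)" by (rule inj_on_subset) auto
  have sub: "\<sigma> \<subseteq> \<Union>S" using attach.hyps by auto
  have im: "g ` (\<sigma> - {x}) = g ` \<sigma> - {g x}"
    using injS sub attach.hyps by (subst inj_on_image_set_diff[of g "\<Union>S"]) auto
  have "stacked_family (insert (insert (g y) (g ` \<sigma> - {g x})) ((`) g ` S))"
  proof (rule stacked_family.attach)
    show "stacked_family ((`) g ` S)" using attach.IH injS .
    show "g y \<notin> \<Union> ((`) g ` S)"
    proof
      assume "g y \<in> \<Union> ((`) g ` S)"
      then obtain w where "w \<in> \<Union>S" "g y = g w" by auto
      then show False using inj attach.hyps(4) by (auto simp: inj_on_def)
    qed
    show "\<forall>\<rho>\<in>(`) g ` S. g ` \<sigma> - {g x} \<subseteq> \<rho> \<longrightarrow> \<rho> = g ` \<sigma>"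
    proof clarsimp
      fix \<rho> assume r: "\<rho> \<in> S" "g ` \<sigma> - {g x} \<subseteq> g ` \<rho>"
      then have "g ` (\<sigma> - {x}) \<subseteq> g ` \<rho>" using im by simp
      moreover have "\<sigma> - {x} \<subseteq> \<Union>S" "\<rho> \<subseteq> \<Union>S" using sub r(1) by auto
      ultimately have "\<sigma> - {x} \<subseteq> \<rho>"
        using injS by (force simp: image_subset_iff image_iff subset_iff dest: inj_onD)
      then show "g ` \<rho> = g ` \<sigma>" using r attach.hyps by auto
    qed
  qed (use attach.hyps in auto)
  then show ?case using im by simp
qed

text \<open>The cone with apex \<open>v\<close>: it turns the 4-ball of a vertex link into the
  family of facets through that vertex.\<close>

lemma stacked_family_insert:
  "stacked_family S \<Longrightarrow> v \<notin> \<Union>S \<Longrightarrow> stacked_family (insert v ` S)"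
proof (induction rule: stacked_family.induct)
  case (single \<sigma>)
  then show ?case by (simp add: stacked_family.single)
next
  case (attach S \<sigma> x y)
  have v: "v \<notin> \<Union>S" "v \<noteq> y" "v \<noteq> x" using attach.prems attach.hyps by auto
  have "stacked_family (insert (insert y (insert v \<sigma> - {x})) (insert v ` S))"
  proof (rule stacked_family.attach)
    show "stacked_family (insert v ` S)" using attach.IH v by blast
    show "\<forall>\<rho>\<in>insert v ` S. insert v \<sigma> - {x} \<subseteq> \<rho> \<longrightarrow> \<rho> = insert v \<sigma>"
      using attach.hyps v by auto
  qed (use attach.hyps v in auto)
  moreover have "insert v (insert y (\<sigma> - {x})) = insert y (insert v \<sigma> - {x})" using v by auto
  ultimately show ?case by simp
qed

section \<open>Maps of order three\<close>

text \<open>Points that \<open>g\<close> moves fall into orbits of exactly three; the induction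
  strips off one such orbit.\<close>

lemma card_fixed_points_mod_3:
  assumes "finite X" "\<And>x. x \<in> X \<Longrightarrow> g x \<in> X" "\<And>x. x \<in> X \<Longrightarrow> g (g (g x)) = x"
  shows "card X mod 3 = card {x\<in>X. g x = x} mod 3"
  using assms
proof (induction "card X" arbitrary: X rule: less_induct)
  case less
  show ?case
  proof (cases "\<forall>x\<in>X. g x = x")
    case True
    then have "{x\<in>X. g x = x} = X" by auto
    then show ?thesis by simp
  next
    case False
    then obtain x where x: "x \<in> X" "g x \<noteq> x" by auto
    let ?O = "{x, g x, g (g x)}"
    have O: "?O \<subseteq> X" using x less.prems by auto
    have d: "g (g x) \<noteq> x" "g (g x) \<noteq> g x"
      using x less.prems(3)[OF x(1)] by metis+
    then have c3: "card ?O = 3" using x by auto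
    have cX: "card X = card (X - ?O) + 3" using O c3 less.prems(1)
      by (metis card_Diff_subset card_mono finite_subset le_add_diff_inverse2)
    have cl: "g y \<in> X - ?O" if "y \<in> X - ?O" for y
    proof -
      have "g y \<in> X" "g (g (g y)) = y" using that less.prems by auto
      then show ?thesis using that less.prems(3)[OF x(1)] by auto
    qed
    have "card (X - ?O) mod 3 = card {y\<in>X - ?O. g y = y} mod 3"
      by (rule less.hyps) (use cX less.prems cl in auto)
    moreover have "{y\<in>X - ?O. g y = y} = {y\<in>X. g y = y}"
      using x d less.prems(3)[OF x(1)] by auto
    ultimately show ?thesis using cX by simp
  qed
qed

section \<open>Tight families\<close>

text \<open>The stacked 4-ball bounded by the link of \<open>v\<close> is represented by the facets through \<open>v\<close>, with \<open>v\<close> left in: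
  this is why stacked families of 6-sets are considered.\<close>

definition tight :: "'a set \<Rightarrow> 'a set set \<Rightarrow> bool" where
  "tight V F \<longleftrightarrow> card V = 15 \<and> (\<forall>\<sigma>\<in>F. \<sigma> \<subseteq> V \<and> card \<sigma> = 6) \<and>
     (\<forall>v\<in>V. stacked_family {\<sigma>\<in>F. v \<in> \<sigma>} \<and> \<Union>{\<sigma>\<in>F. v \<in> \<sigma>} = V)"

locale tight_family =
  fixes V :: "'a set" and F :: "'a set set"
  assumes tight: "tight V F"
begin

abbreviation star :: "'a \<Rightarrow> 'a set set" where
  "star v \<equiv> {\<sigma>\<in>F. v \<in> \<sigma>}"

lemma finite_V: "finite V" and card_V: "card V = 15"
  using tight by (auto simp: tight_def intro: card_ge_0_finite)

lemma six_F: "six_sets F" and F_V: "\<sigma> \<in> F \<Longrightarrow> \<sigma> \<subseteq> V"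
  using tight by (auto simp: tight_def six_sets_def)

lemma card_F_mem: "\<sigma> \<in> F \<Longrightarrow> card \<sigma> = 6" and fin_mem: "\<sigma> \<in> F \<Longrightarrow> finite \<sigma>"
  using six_setsD[OF six_F] by auto

lemma finite_F: "finite F"
  by (rule finite_subset[of _ "Pow V"]) (use F_V finite_V in auto)

lemma six_star: "six_sets (star v)"
  using six_F by (rule six_sets_subset) auto

lemma star_stacked: "v \<in> V \<Longrightarrow> stacked_family (star v)" and Union_star: "v \<in> V \<Longrightarrow> \<Union>(star v) = V"
  using tight by (auto simp: tight_def)

lemma card_star: "v \<in> V \<Longrightarrow> card (star v) = 10"
  using stacked_family_card_Union[OF star_stacked six_star] Union_star card_V by fastforce

lemma subset_cover:
  assumes "W \<subseteq> star v" "W \<noteq> {}"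
  shows "card W + 5 \<le> card (\<Union>W)"
proof -
  have "v \<in> V" using assms F_V by blast
  then show ?thesis using stacked_family_subset_card[OF star_stacked six_star] assms by blast
qed

text \<open>Incidences of vertices and facets: 15 * 10 = 6 * 25, where a star has 10 = 15 - 5
  members.\<close>

lemma card_F: "card F = 25"
proof -
  have "(\<Sum>v\<in>V. card (star v)) = (\<Sum>v\<in>V. \<Sum>\<sigma>\<in>F. if v \<in> \<sigma> then 1 else 0)"
    by (rule sum.cong[OF refl]) (simp add: finite_F sum.If_cases Int_def)
  also have "\<dots> = (\<Sum>\<sigma>\<in>F. \<Sum>v\<in>V. if v \<in> \<sigma> then 1 else 0)" by (rule sum.swap)
  also have "\<dots> = (\<Sum>\<sigma>\<in>F. 6)"
  proof (rule sum.cong[OF refl])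
    fix \<sigma> assume s: "\<sigma> \<in> F"
    have "(\<Sum>v\<in>V. if v \<in> \<sigma> then 1 else 0) = card (V \<inter> \<sigma>)"
      by (simp add: finite_V sum.If_cases)
    also have "V \<inter> \<sigma> = \<sigma>" using F_V[OF s] by auto
    finally show "(\<Sum>v\<in>V. if v \<in> \<sigma> then 1 else 0) = (6::nat)" using card_F_mem[OF s] by simp
  qed
  finally have "(\<Sum>v\<in>V. card (star v)) = 6 * card F" by simp
  moreover have "(\<Sum>v\<in>V. card (star v)) = 150" using card_star card_V by simp
  ultimately show ?thesis by simp
qed

lemma edge_obtain:
  assumes "e \<in> edges S" "S \<subseteq> F"
  obtains \<sigma> \<rho> where "e = {\<sigma>, \<rho>}" "\<sigma> \<in> S" "\<rho> \<in> S" "adjacent \<sigma> \<rho>" "\<sigma> \<noteq> \<rho>"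
proof -
  from assms(1) obtain \<sigma> \<rho> where e: "e = {\<sigma>, \<rho>}" "\<sigma> \<in> S" "\<rho> \<in> S" "adjacent \<sigma> \<rho>"
    unfolding edges_def by blast
  moreover have "\<sigma> \<noteq> \<rho>" using e assms(2) card_F_mem adjacent_neq by blast
  ultimately show ?thesis using that by blast
qed

lemma edge_star: "edges (star v) = {e \<in> edges F. v \<in> \<Inter>e}"
proof
  show "edges (star v) \<subseteq> {e \<in> edges F. v \<in> \<Inter>e}"
  proof
    fix e assume e: "e \<in> edges (star v)"
    then have "e \<in> edges F" using edges_mono[of "star v" F] by auto
    moreover have "e \<subseteq> star v" using edges_subset e by auto
    ultimately show "e \<in> {e \<in> edges F. v \<in> \<Inter>e}" by auto
  qed
  show "{e \<in> edges F. v \<in> \<Inter>e} \<subseteq> edges (star v)"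
  proof
    fix e assume "e \<in> {e \<in> edges F. v \<in> \<Inter>e}"
    then have e: "e \<in> edges F" "v \<in> \<Inter>e" by auto
    from e(1) obtain \<sigma> \<rho> where "e = {\<sigma>, \<rho>}" "\<sigma> \<in> F" "\<rho> \<in> F" "adjacent \<sigma> \<rho>" by (rule edge_obtain) auto
    then show "e \<in> edges (star v)" using e(2) by (auto intro: edgesI)
  qed
qed

text \<open>The dual graph of a star is a tree on 10 nodes, so it has 9 edges, and an edge belongs
  to the stars of its 5 common vertices: 15 * 9 = 5 * 27.\<close>

lemma card_edges: "card (edges F) = 27"
proof -
  have fE: "finite (edges F)" using finite_edges finite_F by auto
  have "(\<Sum>v\<in>V. card (edges (star v))) = (\<Sum>v\<in>V. \<Sum>e\<in>edges F. if v \<in> \<Inter>e then 1 else 0)"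
    unfolding edge_star by (rule sum.cong[OF refl]) (simp add: fE sum.If_cases Int_def)
  also have "\<dots> = (\<Sum>e\<in>edges F. \<Sum>v\<in>V. if v \<in> \<Inter>e then 1 else 0)" by (rule sum.swap)
  also have "\<dots> = (\<Sum>e\<in>edges F. 5)"
  proof (rule sum.cong[OF refl])
    fix e assume "e \<in> edges F"
    then obtain \<sigma> \<rho> where e: "e = {\<sigma>, \<rho>}" "\<sigma> \<in> F" "\<rho> \<in> F" "adjacent \<sigma> \<rho>" by (rule edge_obtain) auto
    have "V \<inter> {v. v \<in> \<Inter>e} = \<sigma> \<inter> \<rho>" using F_V e by auto
    then show "(\<Sum>v\<in>V. if v \<in> \<Inter>e then 1 else 0) = (5::nat)"
      using e by (simp add: finite_V sum.If_cases adjacent_def)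
  qed
  finally have "(\<Sum>v\<in>V. card (edges (star v))) = 5 * card (edges F)" by simp
  moreover have "card (edges (star v)) = 9" if "v \<in> V" for v
    using stacked_family_edges[OF star_stacked[OF that] six_star] card_star[OF that] by simp
  then have "(\<Sum>v\<in>V. card (edges (star v))) = 135" using card_V by simp
  ultimately show ?thesis by simp
qed

lemma ridge_le_2:
  assumes "card \<tau> = 5"
  shows "card {\<sigma>\<in>F. \<tau> \<subseteq> \<sigma>} \<le> 2"
proof -
  obtain v where v: "v \<in> \<tau>" using assms by fastforce
  show ?thesis
  proof (cases "v \<in> V")
    case True
    have "{\<sigma>\<in>F. \<tau> \<subseteq> \<sigma>} = {\<sigma>\<in>star v. \<tau> \<subseteq> \<sigma>}" using v by auto
    then show ?thesis using stacked_family_ridge[OF star_stacked[OF True] six_star assms] by simp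
  next
    case False
    then have "{\<sigma>\<in>F. \<tau> \<subseteq> \<sigma>} = {}" using v F_V by auto
    then show ?thesis by (metis card.empty zero_le)
  qed
qed

lemma ridge_third:
  assumes "card \<tau> = 5" "\<sigma> \<in> F" "\<rho> \<in> F" "\<mu> \<in> F" "\<tau> \<subseteq> \<sigma>" "\<tau> \<subseteq> \<rho>" "\<tau> \<subseteq> \<mu>" "\<sigma> \<noteq> \<rho>"
  shows "\<mu> = \<sigma> \<or> \<mu> = \<rho>"
proof (rule ccontr)
  assume "\<not> (\<mu> = \<sigma> \<or> \<mu> = \<rho>)"
  then have "\<mu> \<noteq> \<sigma>" "\<mu> \<noteq> \<rho>" by blast+
  then have "card {\<sigma>, \<rho>, \<mu>} = 3" using assms(8) by (metis card_3_iff)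
  moreover have "card {\<sigma>, \<rho>, \<mu>} \<le> card {\<sigma>\<in>F. \<tau> \<subseteq> \<sigma>}"
    by (rule card_mono) (use assms finite_F in auto)
  ultimately show False using ridge_le_2[OF assms(1)] by simp
qed

lemma neighbour_in_star:
  assumes "\<sigma> \<in> F" "v \<in> \<sigma>"
  obtains \<rho> where "\<rho> \<in> F" "v \<in> \<rho>" "adjacent \<sigma> \<rho>"
proof -
  have v: "v \<in> V" using assms F_V by auto
  have "{\<sigma>} \<noteq> star v" using card_star[OF v] by (metis card.empty card_insert_disjoint empty_iff finite.emptyI One_nat_def numeral_eq_one_iff semiring_norm(83))
  then have "\<exists>\<alpha>\<in>{\<sigma>}. \<exists>\<rho>\<in>star v - {\<sigma>}. adjacent \<alpha> \<rho>"
    using assms by (intro stacked_family_connected[OF star_stacked[OF v] six_star]) auto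
  then show ?thesis using that by auto
qed

text \<open>A first neighbour omits some vertex \<open>x\<close> of \<open>\<sigma>\<close>. The
  star of \<open>x\<close> is connected and supplies a neighbour that contains \<open>x\<close>,
  hence another one.\<close>

lemma two_neighbours:
  assumes "\<sigma> \<in> F"
  obtains \<rho> \<mu> where "\<rho> \<in> F" "\<mu> \<in> F" "adjacent \<sigma> \<rho>" "adjacent \<sigma> \<mu>" "\<rho> \<noteq> \<mu>"
proof -
  obtain v where v: "v \<in> \<sigma>" using card_F_mem[OF assms] by fastforce
  obtain \<rho> where r: "\<rho> \<in> F" "adjacent \<sigma> \<rho>" using neighbour_in_star[OF assms v] by metis
  obtain x where x: "x \<in> \<sigma>" "x \<notin> \<rho>" using adjacent_exchange[of \<sigma> \<rho>] r assms card_F_mem by metis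
  obtain \<mu> where "\<mu> \<in> F" "x \<in> \<mu>" "adjacent \<sigma> \<mu>" using neighbour_in_star[OF assms x(1)] by metis
  then show ?thesis using that r x by metis
qed

text \<open>Stars cover all vertices, so a facet inside \<open>A\<close> and one outside are linked
  by a facet \<open>\<mu>\<close> that shares a vertex with each. One of the two stars involved has
  members on both sides, and stars are connected.\<close>

lemma connected:
  assumes "A \<subseteq> F" "A \<noteq> {}" "A \<noteq> F"
  obtains \<sigma> \<rho> where "\<sigma> \<in> A" "\<rho> \<in> F - A" "adjacent \<sigma> \<rho>"
proof -
  note found = that
  have *: thesis if v: "v \<in> V" "star v \<inter> A \<noteq> {}" "star v - A \<noteq> {}" for v
  proof -
    have "\<exists>\<sigma>\<in>star v \<inter> A. \<exists>\<rho>\<in>star v - star v \<inter> A. adjacent \<sigma> \<rho>"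
      by (rule stacked_family_connected[OF star_stacked[OF v(1)] six_star]) (use v in auto)
    then show thesis using found by blast
  qed
  obtain \<sigma> \<rho> where s: "\<sigma> \<in> A" and r: "\<rho> \<in> F - A" using assms by blast
  obtain x where x: "x \<in> \<sigma>" using card_F_mem[of \<sigma>] s assms by fastforce
  obtain y where y: "y \<in> \<rho>" using card_F_mem[of \<rho>] r by fastforce
  have xy: "x \<in> V" "y \<in> V" using x y s r assms F_V by blast+
  then have "y \<in> \<Union>(star x)" using Union_star by blast
  then obtain \<mu> where m: "\<mu> \<in> F" "x \<in> \<mu>" "y \<in> \<mu>" by auto
  show ?thesis
  proof (cases "\<mu> \<in> A")
    case True
    then show ?thesis using *[OF xy(2)] m r y by blast
  next
    case False
    then show ?thesis using *[OF xy(1)] m s x assms by blast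
  qed
qed

end

lemma tight_image:
  assumes t: "tight V F" and g: "bij_betw g V W"
  shows "tight W ((`) g ` F)"
proof -
  interpret tight_family V F using t by unfold_locales
  have inj: "inj_on g V" and im: "g ` V = W" using g by (auto simp: bij_betw_def)
  have "card W = 15" using card_V card_image[OF inj] im by simp
  moreover have "\<sigma> \<subseteq> W \<and> card \<sigma> = 6" if "\<sigma> \<in> (`) g ` F" for \<sigma>
  proof -
    obtain \<rho> where r: "\<rho> \<in> F" "\<sigma> = g ` \<rho>" using \<open>\<sigma> \<in> (`) g ` F\<close> by auto
    have "inj_on g \<rho>" by (rule inj_on_subset[OF inj F_V[OF r(1)]])
    then show ?thesis using r card_F_mem[OF r(1)] im F_V[OF r(1)] by (auto simp: card_image)
  qed
  moreover have "stacked_family {\<sigma>\<in>(`) g ` F. w \<in> \<sigma>} \<and> \<Union>{\<sigma>\<in>(`) g ` F. w \<in> \<sigma>} = W" if "w \<in> W" for w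
  proof -
    obtain v where v: "v \<in> V" "w = g v" using \<open>w \<in> W\<close> im by auto
    have eq: "{\<sigma>\<in>(`) g ` F. w \<in> \<sigma>} = (`) g ` star v"
    proof -
      have "g v \<in> g ` \<sigma> \<longleftrightarrow> v \<in> \<sigma>" if "\<sigma> \<in> F" for \<sigma>
        using inj F_V[OF that] v(1) by (simp add: inj_on_image_mem_iff)
      then show ?thesis using v by auto
    qed
    have "stacked_family ((`) g ` star v)"
      by (rule stacked_family_image[OF star_stacked[OF v(1)]]) (use Union_star[OF v(1)] inj in simp)
    moreover have "\<Union>((`) g ` star v) = g ` \<Union>(star v)" by auto
    ultimately show ?thesis using eq Union_star[OF v(1)] im by simp
  qed
  ultimately show ?thesis by (simp add: tight_def)
qed

section \<open>A symmetry of order three\<close>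

definition orbit :: "('a \<Rightarrow> 'a) \<Rightarrow> 'a set \<Rightarrow> 'a set set" where
  "orbit f \<sigma> = {\<sigma>, f ` \<sigma>, f ` f ` \<sigma>}"

definition spread :: "('a \<Rightarrow> 'a) \<Rightarrow> 'a set list \<Rightarrow> 'a set set" where
  "spread f ws = \<Union>(orbit f ` set ws)"

text \<open>The latest facet comes first. Consecutive entries are adjacent as they stand, not merely
  up to a power of \<open>f\<close>; the initial facet, last in the list, is the only entry that
  \<open>f\<close> fixes.\<close>

inductive quotient_path :: "'a set set \<Rightarrow> ('a \<Rightarrow> 'a) \<Rightarrow> 'a set list \<Rightarrow> bool" for F f where
  start: "z \<in> F \<Longrightarrow> f ` z = z \<Longrightarrow> quotient_path F f [z]"
| step: "quotient_path F f (u # ws) \<Longrightarrow> w \<in> F \<Longrightarrow> w \<notin> spread f (u # ws) \<Longrightarrow> f ` w \<noteq> w \<Longrightarrow> adjacent u w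
    \<Longrightarrow> quotient_path F f (w # u # ws)"

locale symmetric_family = tight_family +
  fixes f :: "'a \<Rightarrow> 'a"
  assumes f_F: "\<sigma> \<in> F \<Longrightarrow> f ` \<sigma> \<in> F"
    and f_cubed: "v \<in> V \<Longrightarrow> f (f (f v)) = v"
    and f_V: "v \<in> V \<Longrightarrow> f v \<in> V"
begin

lemma image_cubed: "\<sigma> \<subseteq> V \<Longrightarrow> f ` f ` f ` \<sigma> = \<sigma>"
proof -
  assume "\<sigma> \<subseteq> V"
  then have "(\<lambda>v. f (f (f v))) ` \<sigma> = (\<lambda>v. v) ` \<sigma>" by (intro image_cong refl f_cubed) auto
  then show ?thesis by (simp add: image_image)
qed

lemma inj_f: "inj_on f V"
  by (rule inj_onI) (metis f_cubed)

lemma f_F_cubed: "\<sigma> \<in> F \<Longrightarrow> f ` f ` f ` \<sigma> = \<sigma>"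
  by (rule image_cubed[OF F_V])

lemma inj_image: "\<sigma> \<in> F \<Longrightarrow> \<rho> \<in> F \<Longrightarrow> f ` \<sigma> = f ` \<rho> \<Longrightarrow> \<sigma> = \<rho>"
  by (metis f_F_cubed)

lemma adjacent_f: "\<sigma> \<in> F \<Longrightarrow> \<rho> \<in> F \<Longrightarrow> adjacent (f ` \<sigma>) (f ` \<rho>) \<longleftrightarrow> adjacent \<sigma> \<rho>"
proof -
  assume a: "\<sigma> \<in> F" "\<rho> \<in> F"
  have "f ` \<sigma> \<inter> f ` \<rho> = f ` (\<sigma> \<inter> \<rho>)"
    using inj_on_image_Int[OF inj_f, of \<sigma> \<rho>] F_V a by simp
  moreover have "inj_on f (\<sigma> \<inter> \<rho>)" by (rule inj_on_subset[OF inj_f]) (use F_V[OF a(1)] in auto)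
  ultimately show ?thesis by (simp add: adjacent_def card_image)
qed

abbreviation orb :: "'a set \<Rightarrow> 'a set set" where
  "orb \<equiv> orbit f"

lemma orb_self: "\<sigma> \<in> orb \<sigma>" by (simp add: orbit_def)

lemma orb_F: "\<sigma> \<in> F \<Longrightarrow> orb \<sigma> \<subseteq> F" by (auto simp: orbit_def f_F)

lemma orb_closed: "\<sigma> \<in> F \<Longrightarrow> \<rho> \<in> orb \<sigma> \<Longrightarrow> f ` \<rho> \<in> orb \<sigma>"
  unfolding orbit_def by (elim insertE emptyE) (simp_all only: f_F_cubed insert_iff refl simp_thms)

lemma orb_nonfixed:
  assumes "\<sigma> \<in> F" "f ` \<sigma> \<noteq> \<sigma>"
  shows "f ` f ` \<sigma> \<noteq> \<sigma>" "f ` f ` \<sigma> \<noteq> f ` \<sigma>" "card (orb \<sigma>) = 3"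
proof -
  show 1: "f ` f ` \<sigma> \<noteq> \<sigma>" "f ` f ` \<sigma> \<noteq> f ` \<sigma>" using assms f_F_cubed by metis+
  then show "card (orb \<sigma>) = 3" using assms(2) unfolding orbit_def by (metis card_3_iff)
qed

lemma orb_disjoint:
  assumes "\<sigma> \<in> F" "S \<subseteq> F" "\<And>\<rho>. \<rho> \<in> S \<Longrightarrow> f ` \<rho> \<in> S" "\<sigma> \<notin> S"
  shows "orb \<sigma> \<inter> S = {}"
proof -
  have "f ` \<sigma> \<notin> S" "f ` f ` \<sigma> \<notin> S" using assms f_F_cubed[of \<sigma>] by metis+
  then show ?thesis using assms by (auto simp: orbit_def)
qed

lemma exists_fixed: "\<exists>z\<in>F. f ` z = z"
proof -
  have "card F mod 3 = card {\<sigma>\<in>F. f ` \<sigma> = \<sigma>} mod 3"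
    by (rule card_fixed_points_mod_3) (use finite_F f_F f_F_cubed in auto)
  then have "card {\<sigma>\<in>F. f ` \<sigma> = \<sigma>} \<noteq> 0" using card_F by auto
  then show ?thesis by (metis (mono_tags, lifting) Collect_empty_eq card.empty)
qed

end

text \<open>The assumption is isolated so that counting edges does not depend on how
  \<open>f\<close> acts on vertices. It is supplied for every nontrivial \<open>f\<close> by the
  later analysis of fixed vertices.\<close>

locale rotation_family = symmetric_family +
  assumes no_fixed_edge: "\<sigma> \<in> F \<Longrightarrow> \<rho> \<in> F \<Longrightarrow> f ` \<sigma> = \<sigma> \<Longrightarrow> f ` \<rho> = \<rho> \<Longrightarrow> \<not> adjacent \<sigma> \<rho>"
begin

text \<open>A fixed edge would have fixed ends, because a map of order three cannot swap two
  facets.\<close>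

lemma edge_map:
  assumes "e \<in> edges S" "S \<subseteq> F" "\<And>\<sigma>. \<sigma> \<in> S \<Longrightarrow> f ` \<sigma> \<in> S"
  shows "(`) f ` e \<in> edges S" "(`) f ` (`) f ` (`) f ` e = e" "(`) f ` e \<noteq> e"
proof -
  obtain \<sigma> \<rho> where e: "e = {\<sigma>, \<rho>}" "\<sigma> \<in> S" "\<rho> \<in> S" "adjacent \<sigma> \<rho>" "\<sigma> \<noteq> \<rho>"
    using edge_obtain[OF assms(1,2)] by metis
  have F: "\<sigma> \<in> F" "\<rho> \<in> F" using e assms by auto
  have i: "(`) f ` e = {f ` \<sigma>, f ` \<rho>}" using e by simp
  show "(`) f ` e \<in> edges S"
    unfolding i using assms(3) e adjacent_f[OF F] by (intro edgesI) auto
  show "(`) f ` (`) f ` (`) f ` e = e" using e f_F_cubed[OF F(1)] f_F_cubed[OF F(2)] by simp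
  show "(`) f ` e \<noteq> e"
  proof
    assume "(`) f ` e = e"
    then have "{f ` \<sigma>, f ` \<rho>} = {\<sigma>, \<rho>}" using i e by simp
    then consider "f ` \<sigma> = \<sigma>" "f ` \<rho> = \<rho>" | "f ` \<sigma> = \<rho>" "f ` \<rho> = \<sigma>" by (auto simp: doubleton_eq_iff)
    then show False
    proof cases
      case 1
      then show ?thesis using no_fixed_edge F e by blast
    next
      case 2
      then have "\<sigma> = \<rho>" using f_F_cubed[OF F(1)] by metis
      then show ?thesis using e by blast
    qed
  qed
qed

lemma invariant_edges_dvd:
  assumes "X \<subseteq> edges F" "\<And>e. e \<in> X \<Longrightarrow> (`) f ` e \<in> X"
  shows "3 dvd card X"
proof -
  have "card X mod 3 = card {e\<in>X. (`) f ` e = e} mod 3"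
  proof (rule card_fixed_points_mod_3)
    show "finite X" using assms(1) finite_edges[OF finite_F] finite_subset by blast
    show "(`) f ` (`) f ` (`) f ` e = e" if "e \<in> X" for e
      by (rule edge_map(2)[of _ F]) (use that assms f_F in auto)
  qed (rule assms)
  also have "{e\<in>X. (`) f ` e = e} = {}" using edge_map(3)[of _ F] assms f_F by blast
  finally show ?thesis by (simp add: dvd_eq_mod_eq_0)
qed

lemma edges_growth:
  assumes "S \<subseteq> S'" "S' \<subseteq> F" "\<And>\<sigma>. \<sigma> \<in> S \<Longrightarrow> f ` \<sigma> \<in> S" "\<And>\<sigma>. \<sigma> \<in> S' \<Longrightarrow> f ` \<sigma> \<in> S'"
  shows "3 dvd card (edges S' - edges S)" "card (edges S') = card (edges S) + card (edges S' - edges S)"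
    "e \<in> edges S' - edges S \<Longrightarrow> (`) f ` e \<in> edges S' - edges S"
proof -
  have SF: "S \<subseteq> F" using assms by auto
  have cl: "(`) f ` e \<in> edges S' - edges S" if e: "e \<in> edges S' - edges S" for e
  proof -
    have 1: "(`) f ` e \<in> edges S'" using edge_map(1)[OF _ assms(2,4)] e by blast
    have 2: "(`) f ` e \<notin> edges S"
    proof
      assume "(`) f ` e \<in> edges S"
      then have "(`) f ` (`) f ` (`) f ` e \<in> edges S" using edge_map(1)[OF _ SF assms(3)] by blast
      then show False using edge_map(2)[OF _ assms(2,4)] e by simp
    qed
    show ?thesis using 1 2 by blast
  qed
  then show "e \<in> edges S' - edges S \<Longrightarrow> (`) f ` e \<in> edges S' - edges S" .
  show "3 dvd card (edges S' - edges S)"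
    by (rule invariant_edges_dvd) (use cl edges_mono[OF assms(2)] in auto)
  have "finite (edges S')" using finite_edges finite_F finite_subset assms by metis
  then show "card (edges S') = card (edges S) + card (edges S' - edges S)"
    using edges_mono[OF assms(1)] by (metis card_Diff_subset card_mono finite_subset le_add_diff_inverse)
qed

text \<open>By the hypothesis \<open>B\<close> has at most \<open>card R + 1\<close> edges. Degrees
  of at least 2 in \<open>R\<close> give \<open>2 * card R \<le> 2 * card B - card C\<close>, since
  an edge of \<open>C\<close> has an end in \<open>S\<close>. So \<open>card C\<close> is at most 2,
  but it is a multiple of 3: no edge leaves \<open>S\<close>, against connectivity.\<close>

lemma full_if_many_edges:
  assumes "S \<subseteq> F" "\<And>\<sigma>. \<sigma> \<in> S \<Longrightarrow> f ` \<sigma> \<in> S" "S \<noteq> {}" "card S + 1 \<le> card (edges S)"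
  shows "S = F"
proof (rule ccontr)
  assume ne: "S \<noteq> F"
  define R where "R = F - S"
  define B where "B = edges F - edges S"
  define C where "C = {e\<in>B. e \<inter> S \<noteq> {}}"
  have fin: "finite (edges F)" "finite B" "finite R" using finite_edges finite_F by (auto simp: B_def R_def)
  have cR: "card R + card S = 25"
    using card_F assms(1) finite_F unfolding R_def
    by (metis card_Diff_subset card_mono finite_subset le_add_diff_inverse2)
  have "card (edges F) = card (edges S) + card B" using edges_growth(2)[OF assms(1) subset_refl assms(2) f_F] by (simp add: B_def)
  then have cB: "card B \<le> card R + 1" using card_edges cR assms(4) by linarith
  have deg: "2 \<le> card {e\<in>B. \<sigma> \<in> e}" if s: "\<sigma> \<in> R" for \<sigma>
  proof -
    have sF: "\<sigma> \<in> F" "\<sigma> \<notin> S" using s by (auto simp: R_def)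
    obtain \<rho> \<mu> where r: "\<rho> \<in> F" "\<mu> \<in> F" "adjacent \<sigma> \<rho>" "adjacent \<sigma> \<mu>" "\<rho> \<noteq> \<mu>"
      using two_neighbours[OF sF(1)] by metis
    have "{\<sigma>, \<rho>} \<in> edges F" "{\<sigma>, \<mu>} \<in> edges F" using r sF by (auto intro: edgesI)
    moreover have "{\<sigma>, \<rho>} \<notin> edges S" "{\<sigma>, \<mu>} \<notin> edges S" using edges_subset sF by blast+
    ultimately have "{{\<sigma>, \<rho>}, {\<sigma>, \<mu>}} \<subseteq> {e\<in>B. \<sigma> \<in> e}" by (simp add: B_def)
    then have "card {{\<sigma>, \<rho>}, {\<sigma>, \<mu>}} \<le> card {e\<in>B. \<sigma> \<in> e}" using fin by (intro card_mono) auto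
    moreover have "{\<sigma>, \<rho>} \<noteq> {\<sigma>, \<mu>}" using r by (metis doubleton_eq_iff)
    ultimately show ?thesis by (metis card_2_iff)
  qed
  have "2 * card R \<le> (\<Sum>\<sigma>\<in>R. card {e\<in>B. \<sigma> \<in> e})"
    using sum_mono[of R "\<lambda>_. 2" "\<lambda>\<sigma>. card {e\<in>B. \<sigma> \<in> e}"] deg by simp
  also have "\<dots> = (\<Sum>\<sigma>\<in>R. \<Sum>e\<in>B. if \<sigma> \<in> e then 1 else 0)"
    by (rule sum.cong[OF refl]) (simp add: fin sum.If_cases Int_def)
  also have "\<dots> = (\<Sum>e\<in>B. \<Sum>\<sigma>\<in>R. if \<sigma> \<in> e then 1 else 0)" by (rule sum.swap)
  also have "\<dots> = (\<Sum>e\<in>B. card (R \<inter> e))"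
    by (rule sum.cong[OF refl]) (simp add: fin sum.If_cases)
  finally have 1: "2 * card R \<le> (\<Sum>e\<in>B. card (R \<inter> e))" .
  have "(\<Sum>e\<in>B. card (R \<inter> e)) + card C = (\<Sum>e\<in>B. card (R \<inter> e) + (if e \<inter> S \<noteq> {} then 1 else 0))"
    unfolding C_def by (simp only: sum.distrib) (simp add: fin sum.If_cases Int_def)
  also have "\<dots> \<le> (\<Sum>e\<in>B. 2)"
  proof (rule sum_mono)
    fix e assume "e \<in> B"
    then obtain \<sigma> \<rho> where e: "e = {\<sigma>, \<rho>}" by (auto simp: B_def edges_def)
    have fe: "finite (R \<inter> e)" using fin by simp
    have "card e \<le> 2" using e by (simp add: card_insert_if)
    have "card (R \<inter> e) + card (S \<inter> e) = card ((R \<inter> e) \<union> (S \<inter> e))"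
      using e by (intro card_Un_disjoint[symmetric]) (auto simp: R_def)
    also have "\<dots> \<le> card e" using e by (intro card_mono) auto
    finally have "card (R \<inter> e) + card (S \<inter> e) \<le> 2" using \<open>card e \<le> 2\<close> by simp
    moreover have "1 \<le> card (S \<inter> e)" if "e \<inter> S \<noteq> {}"
      using that e by (metis Int_commute One_nat_def Suc_leI card_gt_0_iff finite.emptyI finite.insertI finite_Int)
    ultimately show "card (R \<inter> e) + (if e \<inter> S \<noteq> {} then 1 else 0) \<le> 2"
      by (cases "e \<inter> S = {}") simp_all
  qed
  finally have "card C \<le> 2" using 1 cB by simp
  moreover have "3 dvd card C"
  proof (rule invariant_edges_dvd)
    show "C \<subseteq> edges F" by (auto simp: C_def B_def)
    fix e assume e: "e \<in> C"
    then have "(`) f ` e \<in> B" using edges_growth(3)[OF assms(1) subset_refl assms(2) f_F] by (simp add: C_def B_def)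
    moreover obtain \<sigma> where "\<sigma> \<in> e" "\<sigma> \<in> S" using e by (auto simp: C_def)
    then have "f ` \<sigma> \<in> (`) f ` e \<inter> S" using assms(2) by auto
    ultimately show "(`) f ` e \<in> C" by (auto simp: C_def)
  qed
  ultimately have "card C = 0" by (auto dest: dvd_imp_le)
  then have "C = {}" using fin by (simp add: C_def)
  moreover obtain \<sigma> \<rho> where "\<sigma> \<in> S" "\<rho> \<in> F - S" "adjacent \<sigma> \<rho>" using connected[OF assms(1,3) ne] by metis
  then have "{\<sigma>, \<rho>} \<in> C"
    using edgesI[of \<sigma> F \<rho>] edges_subset[of "{\<sigma>, \<rho>}" S] assms(1) by (auto simp: C_def B_def)
  ultimately show False by blast
qed

section \<open>Growing a path of orbit representatives\<close>

lemma spread_Cons: "spread f (w # ws) = orb w \<union> spread f ws"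
  by (simp add: spread_def)

lemma spread_F: "set ws \<subseteq> F \<Longrightarrow> spread f ws \<subseteq> F"
  using orb_F by (auto simp: spread_def)

lemma spread_closed: "set ws \<subseteq> F \<Longrightarrow> \<sigma> \<in> spread f ws \<Longrightarrow> f ` \<sigma> \<in> spread f ws"
  using orb_closed by (auto simp: spread_def)

lemma quotient_path_F: "quotient_path F f ws \<Longrightarrow> set ws \<subseteq> F \<and> ws \<noteq> []"
  by (induction rule: quotient_path.induct) auto

text \<open>One orbit of size 1 and all others of size 3.\<close>

lemma quotient_path_card: "quotient_path F f ws \<Longrightarrow> card (spread f ws) + 2 = 3 * length ws"
proof (induction rule: quotient_path.induct)
  case (start z)
  then show ?case by (simp add: spread_def orbit_def)
next
  case (step u ws w)
  have F: "set (u # ws) \<subseteq> F" using quotient_path_F step.hyps by blast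
  have d: "orb w \<inter> spread f (u # ws) = {}"
    by (rule orb_disjoint) (use step.hyps spread_F[OF F] spread_closed[OF F] in auto)
  have "card (spread f (w # u # ws)) = card (orb w) + card (spread f (u # ws))"
    unfolding spread_Cons[of w] by (rule card_Un_disjoint[OF _ _ d])
      (use finite_subset[OF spread_F[OF F] finite_F] in \<open>auto simp: orbit_def\<close>)
  then show ?case using step.IH orb_nonfixed(3)[OF step.hyps(2,4)] by simp
qed

text \<open>Every step adds the edge from \<open>u\<close> to \<open>w\<close> and, with it, an
  orbit of three edges.\<close>

lemma quotient_path_edges: "quotient_path F f ws \<Longrightarrow> 3 * length ws \<le> card (edges (spread f ws)) + 3"
proof (induction rule: quotient_path.induct)
  case (start z)
  then show ?case by simp
next
  case (step u ws w)
  have F: "set (u # ws) \<subseteq> F" "set (w # u # ws) \<subseteq> F" using quotient_path_F[OF step.hyps(1)] step.hyps(2) by simp_all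
  let ?S = "spread f (u # ws)" and ?S' = "spread f (w # u # ws)"
  have sub: "?S \<subseteq> ?S'" by (simp add: spread_def)
  note g = edges_growth[OF sub spread_F[OF F(2)] spread_closed[OF F(1)] spread_closed[OF F(2)]]
  have "{u, w} \<in> edges ?S'"
    by (rule edgesI) (use step.hyps orb_self in \<open>auto simp: spread_def\<close>)
  moreover have "{u, w} \<notin> edges ?S" using edges_subset step.hyps by blast
  ultimately have "card (edges ?S' - edges ?S) \<noteq> 0"
    using finite_edges[OF finite_subset[OF spread_F[OF F(2)] finite_F]] by auto
  then have "3 \<le> card (edges ?S' - edges ?S)" using g(1) by (auto dest: dvd_imp_le)
  then show ?case using g(2) step.IH by simp
qed

text \<open>Besides its predecessor \<open>v\<close>, the end \<open>u\<close> has a second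
  neighbour \<open>\<rho>\<close>. A moved facet outside of the orbits visited prolongs the path. In
  the two other cases the surplus of edges makes the set reached all of \<open>F\<close>, and the
  number 25 decides.\<close>

lemma quotient_path_extend:
  assumes q: "quotient_path F f (u # ws)" and len: "length (u # ws) < 9"
  shows "\<exists>w. quotient_path F f (w # u # ws)"
proof (cases ws)
  case Nil
  then have u: "u \<in> F" "f ` u = u" using q by (auto elim: quotient_path.cases)
  then obtain w where w: "w \<in> F" "adjacent u w" using two_neighbours by metis
  have "f ` w \<noteq> w" using no_fixed_edge u w by blast
  moreover have "w \<notin> spread f [u]" using adjacent_neq[OF card_F_mem[OF u(1)] w(2)] u
    by (simp add: spread_def orbit_def)
  ultimately show ?thesis using quotient_path.step[OF q[unfolded Nil]] w Nil by blast
next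
  case (Cons v ws')
  have uw: "quotient_path F f (v # ws')" "u \<in> F" "u \<notin> spread f (v # ws')" "f ` u \<noteq> u" "adjacent v u"
    using q unfolding Cons by (auto elim: quotient_path.cases)
  let ?S = "spread f (u # ws)" and ?P = "spread f (v # ws')"
  have F: "set (u # ws) \<subseteq> F" "set (v # ws') \<subseteq> F"
    using quotient_path_F[OF q] quotient_path_F[OF uw(1)] by blast+
  have vF: "v \<in> F" "v \<in> ?P" using F orb_self by (auto simp: spread_def)
  have finS: "finite ?S" using finite_subset[OF spread_F[OF F(1)] finite_F] .
  have cS: "card ?S + 2 = 3 * length (u # ws)" using quotient_path_card[OF q] .
  obtain \<rho> where r: "\<rho> \<in> F" "adjacent u \<rho>" "\<rho> \<noteq> v" using two_neighbours[OF uw(2)] by metis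
  have uS: "u \<in> ?S" using orb_self by (auto simp: spread_def)
  have ru: "\<rho> \<noteq> u" using adjacent_neq[OF card_F_mem[OF uw(2)] r(2)] by blast
  show ?thesis
  proof (cases "\<rho> \<in> ?S")
    case False
    show ?thesis
    proof (cases "f ` \<rho> = \<rho>")
      case False
      then show ?thesis using quotient_path.step[OF q r(1) \<open>\<rho> \<notin> ?S\<close> False r(2)] by blast
    next
      case True
      \<comment> \<open>One node and at least three edges are added: for a path of length n there
        are at least 3n edges on 3n - 1 nodes. The set would be \<open>F\<close>, but 3n - 1 = 25
        has no solution.\<close>
      let ?S' = "insert \<rho> ?S"
      have cl: "f ` \<sigma> \<in> ?S'" if "\<sigma> \<in> ?S'" for \<sigma>
        using that True spread_closed[OF F(1)] by auto
      have S'F: "?S' \<subseteq> F" using r spread_F[OF F(1)] by auto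
      note g = edges_growth[OF subset_insertI S'F spread_closed[OF F(1)] cl]
      have "{u, \<rho>} \<in> edges ?S'" by (rule edgesI) (use uS r in auto)
      moreover have "{u, \<rho>} \<notin> edges ?S" using edges_subset \<open>\<rho> \<notin> ?S\<close> by blast
      ultimately have "card (edges ?S' - edges ?S) \<noteq> 0"
        using finite_edges[of ?S'] finS by auto
      then have "3 \<le> card (edges ?S' - edges ?S)" using g(1) by (auto dest: dvd_imp_le)
      then have "card ?S' + 1 \<le> card (edges ?S')"
        using g(2) quotient_path_edges[OF q] cS finS \<open>\<rho> \<notin> ?S\<close> by simp
      then have "?S' = F" by (intro full_if_many_edges S'F cl) auto
      then have "card ?S' = 25" using card_F by simp
      then have "3 * length (u # ws) = 26" using cS finS \<open>\<rho> \<notin> ?S\<close> by simp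
      then show ?thesis by presburger
    qed
  next
    case True
    have sub: "?P \<subseteq> ?S" by (auto simp: Cons spread_def)
    note g = edges_growth[OF sub spread_F[OF F(1)] spread_closed[OF F(2)] spread_closed[OF F(1)]]
    \<comment> \<open>The orbit of \<open>{u, v}\<close> gives three new edges. Among them only
      \<open>e\<close> contains \<open>u\<close>, so \<open>{u, \<rho>}\<close> is a fourth, and by
      divisibility there are at least six.\<close>
    define e where "e = {u, v}"
    define e1 where "e1 = (`) f ` e"
    define e2 where "e2 = (`) f ` e1"
    have v': "v \<in> ?S" using sub vF by blast
    have av: "adjacent u v" using uw(5) adjacent_sym by blast
    have X: "e \<in> edges ?S - edges ?P" "{u, \<rho>} \<in> edges ?S - edges ?P"
      using edgesI[OF uS v' av] edgesI[OF uS True r(2)] edges_subset uw(3) by (auto simp: e_def)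
    have X1: "e1 \<in> edges ?S - edges ?P" unfolding e1_def by (rule g(3)[OF _ _ X(1)])
    have X2: "e2 \<in> edges ?S - edges ?P" unfolding e2_def by (rule g(3)[OF _ _ X1])
    have ed: "e \<in> edges F" "e1 \<in> edges F" "e2 \<in> edges F" using X X1 X2 edges_mono[OF spread_F[OF F(1)]] by auto
    note em = edge_map[OF _ subset_refl f_F]
    have "e1 \<noteq> e" "e2 \<noteq> e1" using em(3) ed by (auto simp: e1_def e2_def)
    moreover have "e2 \<noteq> e"
    proof
      assume "e2 = e"
      then have "(`) f ` e2 = e1" by (simp add: e1_def)
      then have "e = e1" using em(2)[OF ed(1)] by (simp add: e1_def e2_def)
      then show False using em(3)[OF ed(1)] by (simp add: e1_def)
    qed
    moreover have fu: "f ` v \<in> ?P" "f ` f ` v \<in> ?P" using spread_closed[OF F(2)] vF by auto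
    have "u \<notin> e1" using fu uw unfolding e1_def e_def by auto
    moreover have "u \<notin> e2"
      using fu uw(3,4) orb_nonfixed(1)[OF uw(2,4)] unfolding e2_def e1_def e_def by auto
    moreover have "{u, \<rho>} \<noteq> e" using r(3) by (auto simp: e_def doubleton_eq_iff)
    ultimately have "card {e, e1, e2, {u, \<rho>}} = 4" by (auto simp: card_insert_if)
    moreover have "card {e, e1, e2, {u, \<rho>}} \<le> card (edges ?S - edges ?P)"
      by (rule card_mono) (use X X1 X2 finite_edges[OF finS] in auto)
    ultimately have "4 \<le> card (edges ?S - edges ?P)" by simp
    moreover obtain k where "card (edges ?S - edges ?P) = 3 * k" using g(1) by (auto elim!: dvdE)
    ultimately have "6 \<le> card (edges ?S - edges ?P)" by presburger
    then have "card ?S + 1 \<le> card (edges ?S)"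
      using g(2) quotient_path_edges[OF uw(1)] cS by (simp add: Cons)
    then have "?S = F" by (intro full_if_many_edges spread_F[OF F(1)] spread_closed[OF F(1)]) (use uS in auto)
    then show ?thesis using card_F cS len by simp
  qed
qed

end

section \<open>Fixed points of the symmetry\<close>

lemma stacked_family_leaf_exists:
  assumes "stacked_family S" "six_sets S"
  obtains \<kappa> where "\<kappa> \<in> S" "\<And>\<rho> \<mu>. \<rho> \<in> S \<Longrightarrow> \<mu> \<in> S \<Longrightarrow> adjacent \<kappa> \<rho> \<Longrightarrow> adjacent \<kappa> \<mu> \<Longrightarrow> \<rho> = \<mu>"
  using assms(1)
proof cases
  case (single \<sigma>)
  then show ?thesis using that[of \<sigma>] by blast
next
  case (attach S' \<sigma> x y)
  let ?n = "insert y (\<sigma> - {x})"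
  have S: "six_sets S'" "card ?n = 6" using assms(2) unfolding attach(1) by (simp_all only: six_sets_insert)
  note iff = attach_adjacent_iff[OF S(1) attach(3-6)]
  have "\<not> adjacent ?n ?n" using S adjacent_neq by blast
  then have "\<rho> = \<sigma>" if "\<rho> \<in> S" "adjacent ?n \<rho>" for \<rho>
    using iff that unfolding attach(1) by blast
  then show ?thesis using that[of ?n] attach(1) by blast
qed

text \<open>The side conditions of the rule \<open>attach\<close> as a predicate: a leaf that has
  been removed can be put back.\<close>

definition attachable :: "'a set set \<Rightarrow> 'a set \<Rightarrow> bool" where
  "attachable S \<nu> \<longleftrightarrow> (\<exists>\<sigma> x y. \<sigma> \<in> S \<and> x \<in> \<sigma> \<and> y \<notin> \<Union>S \<and> (\<forall>\<rho>\<in>S. \<sigma> - {x} \<subseteq> \<rho> \<longrightarrow> \<rho> = \<sigma>)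
     \<and> \<nu> = insert y (\<sigma> - {x}))"

lemma attachableI:
  "\<sigma> \<in> S \<Longrightarrow> x \<in> \<sigma> \<Longrightarrow> y \<notin> \<Union>S \<Longrightarrow> \<forall>\<rho>\<in>S. \<sigma> - {x} \<subseteq> \<rho> \<longrightarrow> \<rho> = \<sigma> \<Longrightarrow> \<nu> = insert y (\<sigma> - {x}) \<Longrightarrow> attachable S \<nu>"
  unfolding attachable_def by blast

lemma attachableE:
  assumes "attachable S \<nu>"
  obtains \<sigma> x y where "\<sigma> \<in> S" "x \<in> \<sigma>" "y \<notin> \<Union>S" "\<forall>\<rho>\<in>S. \<sigma> - {x} \<subseteq> \<rho> \<longrightarrow> \<rho> = \<sigma>" "\<nu> = insert y (\<sigma> - {x})"
  using assms unfolding attachable_def by (elim exE conjE)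

text \<open>This frees the construction from its order: any leaf may be taken as the one attached
  last. The removal of \<open>\<kappa>\<close> is commuted past the last attachment, which only
  interferes if \<open>\<kappa>\<close> carries the last facet.\<close>

lemma stacked_family_leaf_removal:
  assumes "stacked_family S" "six_sets S" "\<kappa> \<in> S" "S \<noteq> {\<kappa>}"
    "\<And>\<rho> \<mu>. \<rho> \<in> S \<Longrightarrow> \<mu> \<in> S \<Longrightarrow> adjacent \<kappa> \<rho> \<Longrightarrow> adjacent \<kappa> \<mu> \<Longrightarrow> \<rho> = \<mu>"
  shows "stacked_family (S - {\<kappa>}) \<and> attachable (S - {\<kappa>}) \<kappa>"
  using assms
proof (induction rule: stacked_family.induct)
  case (single \<sigma>)
  then show ?case by blast
next
  case (attach S \<sigma> x y)
  let ?n = "insert y (\<sigma> - {x})"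
  have S: "six_sets S" "card ?n = 6" using attach.prems(1) by (simp_all only: six_sets_insert)
  have nS: "?n \<notin> S" using attach.hyps by blast
  note iff = attach_adjacent_iff[OF S(1) attach.hyps(2-5)]
  have n\<sigma>: "adjacent ?n \<sigma>" "adjacent \<sigma> ?n" using iff[OF attach.hyps(2)] adjacent_sym by blast+
  show ?case
  proof (cases "\<kappa> = ?n")
    case True
    then have rem: "insert ?n S - {\<kappa>} = S" using nS by blast
    show ?thesis unfolding rem using attach.hyps(1) attachableI[OF attach.hyps(2-5) True] by (rule conjI)
  next
    case False
    then have l: "\<kappa> \<in> S" using attach.prems(2) by blast
    show ?thesis
    proof (cases "S = {\<kappa>}")
      case True
      \<comment> \<open>Two facets only: each can be seen as attached to the other, with
        \<open>x\<close> and \<open>y\<close> exchanged.\<close>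
      then have \<sigma>: "\<sigma> = \<kappa>" using attach.hyps by blast
      have rem: "insert ?n S - {\<kappa>} = {?n}" using True False by blast
      have "x \<notin> ?n" using attach.hyps by blast
      moreover have "\<kappa> = insert x (?n - {y})" using \<sigma> attach.hyps by blast
      ultimately have "attachable {?n} \<kappa>" by (intro attachableI[of ?n "{?n}" y x]) blast+
      then show ?thesis unfolding rem using stacked_family.single by (intro conjI)
    next
      case False
      \<comment> \<open>Otherwise \<open>\<kappa>\<close> would be adjacent both to the last facet
        and to a facet of the connected rest, hence no leaf.\<close>
      have l\<sigma>: "\<kappa> \<noteq> \<sigma>"
      proof
        assume "\<kappa> = \<sigma>"
        have "\<exists>\<alpha>\<in>{\<sigma>}. \<exists>\<rho>\<in>S - {\<sigma>}. adjacent \<alpha> \<rho>"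
          by (rule stacked_family_connected[OF attach.hyps(1) S(1)])
            (use attach.hyps(2) False \<open>\<kappa> = \<sigma>\<close> in blast)+
        then obtain \<rho> where "\<rho> \<in> S" "adjacent \<kappa> \<rho>" using \<open>\<kappa> = \<sigma>\<close> by blast
        then have "\<rho> = ?n" using attach.prems(4)[of \<rho> ?n] n\<sigma> \<open>\<kappa> = \<sigma>\<close> by blast
        then show False using \<open>\<rho> \<in> S\<close> nS by blast
      qed
      have IH: "stacked_family (S - {\<kappa>})" "attachable (S - {\<kappa>}) \<kappa>"
        using attach.IH[OF S(1) l False] attach.prems(4) by blast+
      from IH(2) obtain \<sigma>' x' y' where p: "\<sigma>' \<in> S - {\<kappa>}" "x' \<in> \<sigma>'" "y' \<notin> \<Union>(S - {\<kappa>})"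
        "\<forall>\<rho>\<in>S - {\<kappa>}. \<sigma>' - {x'} \<subseteq> \<rho> \<longrightarrow> \<rho> = \<sigma>'" "\<kappa> = insert y' (\<sigma>' - {x'})"
        by (rule attachableE)
      have rem: "insert ?n S - {\<kappa>} = insert ?n (S - {\<kappa>})" using \<open>\<kappa> \<noteq> ?n\<close> by blast
      have st: "stacked_family (insert ?n (S - {\<kappa>}))"
        by (rule stacked_family.attach) (use IH attach.hyps l\<sigma> in blast)+
      have "y' \<notin> \<Union>(insert ?n (S - {\<kappa>}))"
      proof -
        have "y' \<in> \<Union>S" using p(5) l by blast
        then have "y' \<noteq> y" using attach.hyps by blast
        then show ?thesis using p(3) l\<sigma> attach.hyps by blast
      qed
      moreover have "\<rho> = \<sigma>'" if "\<rho> \<in> insert ?n (S - {\<kappa>})" "\<sigma>' - {x'} \<subseteq> \<rho>" for \<rho>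
      proof (cases "\<rho> = ?n")
        case False
        then show ?thesis using that p(4) by blast
      next
        case True
        have c: "card \<sigma>' = 6" "finite \<sigma>'" using p(1) six_setsD[OF S(1)] by blast+
        \<comment> \<open>The last facet does not obstruct: if it contained the ridge, then
          \<open>\<sigma>' = \<sigma>\<close> and \<open>x' = x\<close>, and \<open>\<kappa>\<close>
          would contain the free ridge of \<open>\<sigma>\<close>.\<close>
        have "\<sigma>' - {x'} \<subseteq> \<sigma>" using that(2) True p(1) attach.hyps(4) by blast
        then have "\<sigma> = \<sigma>'" using p(4) l\<sigma> attach.hyps(2) by blast
        moreover have "x' = x" using that(2) True \<open>\<sigma> = \<sigma>'\<close> attach.hyps(2-4) by blast
        ultimately have "\<sigma> - {x} \<subseteq> \<kappa>" using p(5) by blast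
        then have "\<kappa> = \<sigma>" using attach.hyps(5) l by blast
        then show ?thesis using l\<sigma> by blast
      qed
      ultimately have "attachable (insert ?n (S - {\<kappa>})) \<kappa>"
        by (intro attachableI[of \<sigma>' _ x' y', OF insertI2[OF p(1)] p(2) _ _ p(5)]) blast+
      then show ?thesis unfolding rem using st by blast
    qed
  qed
qed

text \<open>Replaying the construction without the facets that omit \<open>w\<close> stays
  legitimate: a facet through \<open>w\<close> is attached to another one through \<open>w\<close>,
  unless \<open>w\<close> is its new vertex. Applied to a star, this treats the facets through a
  pair.\<close>

lemma stacked_family_star:
  "stacked_family S \<Longrightarrow> w \<in> \<Union>S \<Longrightarrow> stacked_family {\<sigma>\<in>S. w \<in> \<sigma>}"
proof (induction rule: stacked_family.induct)
  case (single \<sigma>)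
  then have "{\<rho>\<in>{\<sigma>}. w \<in> \<rho>} = {\<sigma>}" by blast
  then show ?case using stacked_family.single by metis
next
  case (attach S \<sigma> x y)
  let ?n = "insert y (\<sigma> - {x})"
  show ?case
  proof (cases "w = y")
    case True
    then have "{\<rho>\<in>insert ?n S. w \<in> \<rho>} = {?n}" using attach.hyps by blast
    then show ?thesis using stacked_family.single by metis
  next
    case False
    then have w: "w \<in> \<Union>S" using attach.prems attach.hyps by blast
    note IH = attach.IH[OF w]
    show ?thesis
    proof (cases "w \<in> ?n")
      case True
      then have "w \<in> \<sigma>" using False by blast
      then have "stacked_family (insert ?n {\<rho>\<in>S. w \<in> \<rho>})"
        by (intro stacked_family.attach[OF IH]) (use attach.hyps in blast)+
      moreover have "{\<rho>\<in>insert ?n S. w \<in> \<rho>} = insert ?n {\<rho>\<in>S. w \<in> \<rho>}" using True by blast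
      ultimately show ?thesis by metis
    next
      case False
      then have "{\<rho>\<in>insert ?n S. w \<in> \<rho>} = {\<rho>\<in>S. w \<in> \<rho>}" by blast
      then show ?thesis using IH by metis
    qed
  qed
qed

context symmetric_family
begin

text \<open>The analogue of the fixed subtree of a tree with a symmetry. A leaf that
  \<open>f\<close> fixes hangs from a fixed neighbour; a leaf that \<open>f\<close> moves is removed
  together with its two images, and none of the three contributes.\<close>

lemma fixed_stacked:
  "stacked_family S \<Longrightarrow> S \<subseteq> F \<Longrightarrow> (\<And>\<sigma>. \<sigma> \<in> S \<Longrightarrow> f ` \<sigma> \<in> S) \<Longrightarrow> stacked_family {\<sigma>\<in>S. f ` \<sigma> = \<sigma>}"
proof (induction "card S" arbitrary: S rule: less_induct)
  case less
  have six: "six_sets S" using six_sets_subset[OF six_F less.prems(2)] .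
  have fin: "finite S" using stacked_family_finite[OF less.prems(1)] by blast
  obtain \<kappa> where l: "\<kappa> \<in> S" and un: "\<And>\<rho> \<mu>. \<rho> \<in> S \<Longrightarrow> \<mu> \<in> S \<Longrightarrow> adjacent \<kappa> \<rho> \<Longrightarrow> adjacent \<kappa> \<mu> \<Longrightarrow> \<rho> = \<mu>"
    using stacked_family_leaf_exists[OF less.prems(1) six] by metis
  have lF: "\<kappa> \<in> F" using l less.prems by blast
  show ?case
  proof (cases "S = {\<kappa>}")
    case True
    then have "{\<sigma>\<in>S. f ` \<sigma> = \<sigma>} = {\<kappa>}" using less.prems(3)[OF l] by blast
    then show ?thesis using stacked_family.single by metis
  next
    case ne: False
    note rl = stacked_family_leaf_removal[OF less.prems(1) six l ne un]
    show ?thesis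
    proof (cases "f ` \<kappa> = \<kappa>")
      case True
      obtain \<sigma> x y where p: "\<sigma> \<in> S - {\<kappa>}" "x \<in> \<sigma>" "y \<notin> \<Union>(S - {\<kappa>})"
        "\<forall>\<rho>\<in>S - {\<kappa>}. \<sigma> - {x} \<subseteq> \<rho> \<longrightarrow> \<rho> = \<sigma>" "\<kappa> = insert y (\<sigma> - {x})"
        using conjunct2[OF rl] by (rule attachableE)
      have sF: "\<sigma> \<in> F" "\<sigma> \<in> S" using p(1) less.prems by blast+
      have cl: "f ` \<rho> \<in> S - {\<kappa>}" if "\<rho> \<in> S - {\<kappa>}" for \<rho>
        using that less.prems(2,3) inj_image[of \<rho> \<kappa>] True lF by (metis DiffD1 DiffD2 DiffI singletonD singletonI subsetD)
      have IH: "stacked_family {\<rho>\<in>S - {\<kappa>}. f ` \<rho> = \<rho>}"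
        using rl l fin cl less.prems(2) by (intro less.hyps psubset_card_mono) blast+
      have adj: "adjacent \<kappa> \<sigma>"
        unfolding p(5) using exchange_adjacent(1)[of \<sigma> x y] card_F_mem[OF sF(1)] p by blast
      then have "adjacent \<kappa> (f ` \<sigma>)" using adjacent_f[OF lF sF(1)] True by simp
      then have "f ` \<sigma> = \<sigma>" using un adj sF(2) less.prems(3) by blast
      then have "stacked_family (insert \<kappa> {\<rho>\<in>S - {\<kappa>}. f ` \<rho> = \<rho>})"
        unfolding p(5) by (intro stacked_family.attach[OF IH[unfolded p(5)]]) (use p in blast)+
      moreover have "{\<rho>\<in>S. f ` \<rho> = \<rho>} = insert \<kappa> {\<rho>\<in>S - {\<kappa>}. f ` \<rho> = \<rho>}" using True l by blast
      ultimately show ?thesis by metis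
    next
      case nf: False
      let ?l1 = "f ` \<kappa>" and ?l2 = "f ` f ` \<kappa>"
      note d = orb_nonfixed(1,2)[OF lF nf]
      have lS: "?l1 \<in> S" "?l2 \<in> S" using less.prems(3) l by blast+
      have lF': "?l1 \<in> F" "?l2 \<in> F" using lF f_F by blast+
      have c: "f ` ?l2 = \<kappa>" using f_F_cubed[OF lF] .
      have un1: "\<rho> = \<mu>" if "\<rho> \<in> S" "\<mu> \<in> S" "adjacent ?l1 \<rho>" "adjacent ?l1 \<mu>" for \<rho> \<mu>
      proof -
        have F: "\<rho> \<in> F" "\<mu> \<in> F" using that less.prems by blast+
        have "adjacent \<kappa> (f ` f ` \<rho>)" "adjacent \<kappa> (f ` f ` \<mu>)"
          using that(3) adjacent_f[OF lF'(1) F(1)] adjacent_f[OF lF'(2) f_F[OF F(1)]]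
            that(4) adjacent_f[OF lF'(1) F(2)] adjacent_f[OF lF'(2) f_F[OF F(2)]] c by simp_all
        then have "f ` f ` \<rho> = f ` f ` \<mu>"
          by (rule un[OF less.prems(3)[OF less.prems(3)[OF that(1)]] less.prems(3)[OF less.prems(3)[OF that(2)]]])
        then show ?thesis using inj_image F f_F by metis
      qed
      have un2: "\<rho> = \<mu>" if "\<rho> \<in> S" "\<mu> \<in> S" "adjacent ?l2 \<rho>" "adjacent ?l2 \<mu>" for \<rho> \<mu>
      proof -
        have F: "\<rho> \<in> F" "\<mu> \<in> F" using that less.prems by blast+
        have "adjacent \<kappa> (f ` \<rho>)" "adjacent \<kappa> (f ` \<mu>)"
          using that(3) adjacent_f[OF lF'(2) F(1)] that(4) adjacent_f[OF lF'(2) F(2)] c by simp_all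
        then have "f ` \<rho> = f ` \<mu>" by (rule un[OF less.prems(3)[OF that(1)] less.prems(3)[OF that(2)]])
        then show ?thesis using inj_image F by metis
      qed
      let ?S1 = "S - {\<kappa>}" let ?S2 = "?S1 - {?l1}" let ?S3 = "?S2 - {?l2}"
      have s1: "stacked_family ?S1" using rl by blast
      have m1: "?l1 \<in> ?S1" using lS(1) nf by simp
      have m2: "?l2 \<in> ?S2" using lS(2) d by simp
      have "?S1 \<noteq> {?l1}"
      proof
        assume "?S1 = {?l1}"
        then show False using m2 by simp
      qed
      then have st2: "stacked_family ?S2"
        by (rule conjunct1[OF stacked_family_leaf_removal[OF s1 six_sets_subset[OF six Diff_subset] m1]])
          (rule un1; simp)
      have six2: "six_sets ?S2" by (rule six_sets_subset[OF six]) blast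
      \<comment> \<open>A single orbit of three facets is impossible: connectivity and symmetry
        would make each adjacent to both others, so that none is a leaf.\<close>
      have ne2: "?S2 \<noteq> {?l2}"
      proof
        assume S2: "?S2 = {?l2}"
        have S: "\<rho> \<in> {?l1, ?l2}" if "\<rho> \<in> S - {\<kappa>}" for \<rho>
        proof (cases "\<rho> = ?l1")
          case False
          then have "\<rho> \<in> ?S2" using that by simp
          then show ?thesis unfolding S2 by simp
        qed simp
        have "\<exists>\<alpha>\<in>{\<kappa>}. \<exists>\<rho>\<in>S - {\<kappa>}. adjacent \<alpha> \<rho>"
          by (rule stacked_family_connected[OF less.prems(1) six]) (use l ne in blast)+
        then obtain \<rho> where "\<rho> \<in> {?l1, ?l2}" "adjacent \<kappa> \<rho>" using S by blast
        then have "adjacent \<kappa> ?l1 \<and> adjacent \<kappa> ?l2"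
          using adjacent_f[OF lF'(2) lF] adjacent_f[OF lF lF'(1)] adjacent_f[OF lF lF'(2)] adjacent_f[OF lF'(1,2)]
            c adjacent_sym by (metis insertE singletonD)
        then show False using un[OF lS] d by blast
      qed
      have st3: "stacked_family ?S3"
        by (rule conjunct1[OF stacked_family_leaf_removal[OF st2 six2 m2 ne2]]) (rule un2; simp)
      have cl3: "f ` \<rho> \<in> ?S3" if "\<rho> \<in> ?S3" for \<rho>
      proof -
        have "\<rho> \<in> F" "f ` \<rho> \<in> S" using that less.prems by blast+
        moreover have "f ` \<rho> \<noteq> \<kappa>" using inj_image[OF \<open>\<rho> \<in> F\<close> lF'(2)] c that by auto
        moreover have "f ` \<rho> \<noteq> ?l1" using inj_image[OF \<open>\<rho> \<in> F\<close> lF] that by blast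
        moreover have "f ` \<rho> \<noteq> ?l2" using inj_image[OF \<open>\<rho> \<in> F\<close> lF'(1)] that by blast
        ultimately show ?thesis by simp
      qed
      have "card ?S3 < card S" using l fin by (intro psubset_card_mono) blast+
      then have "stacked_family {\<rho>\<in>?S3. f ` \<rho> = \<rho>}"
        by (rule less.hyps[OF _ st3 _ cl3]) (use less.prems(2) in blast)
      moreover have nf0: "\<rho> \<notin> {\<kappa>, ?l1, ?l2}" if "f ` \<rho> = \<rho>" for \<rho>
      proof
        assume "\<rho> \<in> {\<kappa>, ?l1, ?l2}"
        then show False using that nf d c by (elim insertE emptyE) simp_all
      qed
      have "\<rho> \<in> S \<and> f ` \<rho> = \<rho> \<longleftrightarrow> \<rho> \<in> ?S3 \<and> f ` \<rho> = \<rho>" for \<rho>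
        using nf0[of \<rho>] by (cases "f ` \<rho> = \<rho>") (simp_all only: Diff_iff insert_iff empty_iff simp_thms de_Morgan_disj)
      then have "{\<rho>\<in>S. f ` \<rho> = \<rho>} = {\<rho>\<in>?S3. f ` \<rho> = \<rho>}" by (simp only:)
      ultimately show ?thesis by metis
    qed
  qed
qed

section \<open>Fixed vertices and the invariant facets through them\<close>

definition fixed :: "'a set" where
  "fixed = {v\<in>V. f v = v}"

lemma fixed_image: "\<tau> \<subseteq> fixed \<Longrightarrow> f ` \<tau> = \<tau>"
proof -
  assume "\<tau> \<subseteq> fixed"
  then have "f ` \<tau> = (\<lambda>v. v) ` \<tau>" by (intro image_cong) (auto simp: fixed_def)
  then show ?thesis by simp
qed

text \<open>If \<open>x\<close> were moved, \<open>f x\<close> would survive the exchange, and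
  applying \<open>f\<close> twice more inside the invariant \<open>\<rho>\<close> would bring
  \<open>x\<close> back.\<close>

lemma fixed_exchange:
  assumes "\<sigma> \<in> F" "\<rho> \<in> F" "f ` \<sigma> = \<sigma>" "f ` \<rho> = \<rho>" "x \<in> \<sigma>" "x \<notin> \<rho>" "\<rho> = insert y (\<sigma> - {x})"
  shows "x \<in> fixed"
proof (rule ccontr)
  assume "x \<notin> fixed"
  have xV: "x \<in> V" using assms F_V by blast
  then have n: "f x \<noteq> x" using \<open>x \<notin> fixed\<close> by (simp add: fixed_def)
  have "f x \<in> \<sigma>" using assms(3,5) by blast
  then have "f x \<in> \<rho>" using assms(7) n by blast
  then have "f (f (f x)) \<in> \<rho>" using assms(4) by blast
  then show False using assms(6) f_cubed[OF xV] by simp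
qed

lemma fixed_adjacent:
  assumes "\<sigma> \<in> F" "\<rho> \<in> F" "f ` \<sigma> = \<sigma>" "f ` \<rho> = \<rho>" "adjacent \<sigma> \<rho>"
  shows "\<sigma> \<inter> fixed \<noteq> {}" "\<sigma> - fixed = \<rho> - fixed"
proof -
  obtain x y where p: "x \<in> \<sigma>" "y \<notin> \<sigma>" "x \<notin> \<rho>" "\<rho> = insert y (\<sigma> - {x})"
    using adjacent_exchange[of \<sigma> \<rho>] assms card_F_mem by metis
  have x: "x \<in> fixed" using fixed_exchange[OF assms(1-4) p(1,3,4)] .
  have "y \<in> \<rho>" "\<sigma> = insert x (\<rho> - {y})" using p by blast+
  then have y: "y \<in> fixed" using fixed_exchange[OF assms(2,1,4,3)] p(2) by blast
  show "\<sigma> \<inter> fixed \<noteq> {}" using x p by blast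
  show "\<sigma> - fixed = \<rho> - fixed" using x y p by blast
qed

context
  assumes nontrivial: "\<exists>v\<in>V. f v \<noteq> v"
begin

text \<open>Being pointwise fixed would spread to all of \<open>F\<close>: a neighbour
  \<open>\<rho>\<close> shares a pointwise fixed ridge, which lies in at most two facets, so
  \<open>f\<close> maps \<open>\<rho>\<close> to itself and fixes its remaining vertex too.\<close>

lemma not_subset_fixed:
  assumes "\<sigma> \<in> F"
  shows "\<not> \<sigma> \<subseteq> fixed"
proof
  assume s: "\<sigma> \<subseteq> fixed"
  define A where "A = {\<sigma>\<in>F. \<sigma> \<subseteq> fixed}"
  have "A \<noteq> F"
  proof
    assume A: "A = F"
    obtain v where v: "v \<in> V" "f v \<noteq> v" using nontrivial by blast
    then obtain \<rho> where "\<rho> \<in> F" "v \<in> \<rho>" using Union_star by blast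
    then show False using A v by (auto simp: A_def fixed_def)
  qed
  then obtain \<alpha> \<rho> where r: "\<alpha> \<in> A" "\<rho> \<in> F - A" "adjacent \<alpha> \<rho>"
    using connected[of A] s assms unfolding A_def by blast
  then have aF: "\<alpha> \<in> F" "\<rho> \<in> F" "\<alpha> \<subseteq> fixed" by (auto simp: A_def)
  obtain x y where p: "x \<in> \<alpha>" "y \<notin> \<alpha>" "x \<notin> \<rho>" "\<rho> = insert y (\<alpha> - {x})"
    using adjacent_exchange[of \<alpha> \<rho>] aF card_F_mem r(3) by metis
  have \<tau>: "f ` (\<alpha> - {x}) = \<alpha> - {x}" "f ` \<alpha> = \<alpha>" using aF(3) by (auto intro!: fixed_image)
  have "card (\<alpha> - {x}) = 5" using p(1) card_F_mem[OF aF(1)] fin_mem[OF aF(1)] by simp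
  moreover have "\<alpha> - {x} \<subseteq> f ` \<rho>" using \<tau>(1) p(4) by blast
  ultimately have "f ` \<rho> = \<alpha> \<or> f ` \<rho> = \<rho>"
    using ridge_third[of "\<alpha> - {x}" \<alpha> \<rho> "f ` \<rho>"] aF f_F p by blast
  then have "f ` \<rho> = \<rho>"
    using \<tau>(2) inj_image[OF aF(2,1)] p by metis
  then have "y \<in> fixed"
    using fixed_exchange[OF aF(2,1) _ \<tau>(2), of y x] p by blast
  then have "\<rho> \<in> A" using p(4) aF by (auto simp: A_def)
  then show False using r by blast
qed

text \<open>The number is a multiple of 3, and 0 and 6 are excluded.\<close>

lemma card_fixed_facet:
  assumes "\<sigma> \<in> F" "f ` \<sigma> = \<sigma>" "\<sigma> \<inter> fixed \<noteq> {}"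
  shows "card (\<sigma> \<inter> fixed) = 3"
proof -
  have fin: "finite \<sigma>" and c: "card \<sigma> = 6" using fin_mem card_F_mem assms by blast+
  have "card \<sigma> mod 3 = card {v\<in>\<sigma>. f v = v} mod 3"
    by (rule card_fixed_points_mod_3[OF fin]) (use assms F_V[OF assms(1)] f_cubed in blast)+
  also have "{v\<in>\<sigma>. f v = v} = \<sigma> \<inter> fixed" using F_V[OF assms(1)] by (auto simp: fixed_def)
  finally have "card (\<sigma> \<inter> fixed) mod 3 = 0" using c by simp
  moreover have "card (\<sigma> \<inter> fixed) < 6"
    using psubset_card_mono[OF fin, of "\<sigma> \<inter> fixed"] not_subset_fixed[OF assms(1)] c by auto
  moreover have "card (\<sigma> \<inter> fixed) \<noteq> 0" using assms(3) fin by simp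
  moreover have "n mod 3 = 0 \<Longrightarrow> n < 6 \<Longrightarrow> n \<noteq> 0 \<Longrightarrow> n = 3" for n :: nat by presburger
  ultimately show ?thesis by simp
qed

text \<open>The facets through \<open>v\<close> and \<open>w\<close> form an invariant stacked
  family. Its invariant members again form a stacked family, and stacked families are not
  empty.\<close>

lemma fixed_facet_through:
  assumes "v \<in> fixed" "w \<in> fixed"
  shows "\<exists>\<sigma>\<in>star v. w \<in> \<sigma> \<and> f ` \<sigma> = \<sigma>"
proof -
  have v: "v \<in> V" "f v = v" "w \<in> V" "f w = w" using assms by (auto simp: fixed_def)
  let ?S = "{\<sigma>\<in>star v. w \<in> \<sigma>}"
  have "stacked_family ?S" using stacked_family_star[OF star_stacked[OF v(1)]] Union_star[OF v(1)] v(3) by blast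
  moreover have "f ` \<sigma> \<in> ?S" if "\<sigma> \<in> ?S" for \<sigma>
    using that f_F v(2,4) by (metis (mono_tags, lifting) imageI mem_Collect_eq)
  ultimately have "stacked_family {\<sigma>\<in>?S. f ` \<sigma> = \<sigma>}" by (intro fixed_stacked) auto
  then have "{\<sigma>\<in>?S. f ` \<sigma> = \<sigma>} \<noteq> {}" using stacked_family_finite by blast
  then show ?thesis by blast
qed

text \<open>Adjacent invariant facets differ by fixed vertices only, so by connectivity all those
  through \<open>v\<close> have the same moved part \<open>Q\<close>. They cover exactly
  \<open>fixed\<close> and \<open>Q\<close>, and n stacked facets cover n + 5 vertices, whence
  \<open>n + 5 = card fixed + 3\<close>.\<close>

lemma fixed_star:
  assumes "v \<in> fixed"
  shows "\<exists>Q. (\<forall>\<sigma>\<in>{\<sigma>\<in>star v. f ` \<sigma> = \<sigma>}. \<sigma> - fixed = Q) \<and> card Q = 3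
    \<and> card {\<sigma>\<in>star v. f ` \<sigma> = \<sigma>} + 2 = card fixed"
proof -
  let ?P = "{\<sigma>\<in>star v. f ` \<sigma> = \<sigma>}"
  have v: "v \<in> V" "f v = v" using assms by (auto simp: fixed_def)
  have st: "stacked_family ?P"
    by (rule fixed_stacked[OF star_stacked[OF v(1)]]) (use f_F v(2) in \<open>auto intro: rev_image_eqI\<close>)
  have six: "six_sets ?P" by (rule six_sets_subset[OF six_F]) blast
  obtain \<sigma> where s: "\<sigma> \<in> ?P" using stacked_family_finite[OF st] by blast
  have all: "\<rho> - fixed = \<sigma> - fixed" if "\<rho> \<in> ?P" for \<rho>
  proof -
    define A where "A = {\<rho>\<in>?P. \<rho> - fixed = \<sigma> - fixed}"
    have "A = ?P"
    proof (rule ccontr)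
      assume "A \<noteq> ?P"
      moreover have "A \<subseteq> ?P" "A \<noteq> {}" using s unfolding A_def by blast+
      ultimately have "\<exists>\<alpha>\<in>A. \<exists>\<beta>\<in>?P - A. adjacent \<alpha> \<beta>"
        by (intro stacked_family_connected[OF st six])
      then obtain \<alpha> \<beta> where "\<alpha> \<in> A" "\<beta> \<in> ?P - A" "adjacent \<alpha> \<beta>" by blast
      then show False using fixed_adjacent(2)[of \<alpha> \<beta>] unfolding A_def by blast
    qed
    then have "\<rho> \<in> A" using that by simp
    then show ?thesis by (simp add: A_def)
  qed
  have sF: "\<sigma> \<in> F" "f ` \<sigma> = \<sigma>" "\<sigma> \<inter> fixed \<noteq> {}" using s assms by blast+
  have "card (\<sigma> \<inter> fixed) + card (\<sigma> - fixed) = 6"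
    using card_F_mem[OF sF(1)] fin_mem[OF sF(1)] by (metis card_Int_Diff)
  then have c3: "card (\<sigma> - fixed) = 3" using card_fixed_facet[OF sF] by simp
  have "\<Union>?P = fixed \<union> (\<sigma> - fixed)"
  proof
    show "\<Union>?P \<subseteq> fixed \<union> (\<sigma> - fixed)" using all by blast
    show "fixed \<union> (\<sigma> - fixed) \<subseteq> \<Union>?P" using fixed_facet_through[OF assms] s by blast
  qed
  moreover have "finite fixed" using finite_V by (auto simp: fixed_def)
  moreover have "finite (\<sigma> - fixed)" using fin_mem[OF sF(1)] by blast
  ultimately have "card (\<Union>?P) = card fixed + 3"
    using c3 by (metis Diff_disjoint card_Un_disjoint)
  then have "card ?P + 2 = card fixed" using stacked_family_card_Union[OF st six] by simp
  then show ?thesis using all c3 by blast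
qed

text \<open>Any two fixed vertices lie in a common invariant facet, so \<open>Q\<close> is the same
  for all of them. A vertex \<open>a\<close> of \<open>Q\<close> lies in every member of
  \<open>K\<close>, and the covering bound in the star of \<open>a\<close> leaves \<open>K\<close>
  at most \<open>card fixed - 2\<close> members. There are as many through each single fixed vertex,
  so each member contains all of \<open>fixed\<close>.\<close>

lemma fixed_points:
  assumes "fixed \<noteq> {}"
  shows "card fixed = 3" "\<exists>z\<in>F. f ` z = z \<and> fixed \<subseteq> z \<and> (\<forall>\<sigma>\<in>F. f ` \<sigma> = \<sigma> \<longrightarrow> \<sigma> \<inter> fixed \<noteq> {} \<longrightarrow> \<sigma> = z)"
proof -
  define P where "P v = {\<sigma>\<in>star v. f ` \<sigma> = \<sigma>}" for v
  define K where "K = {\<sigma>\<in>F. f ` \<sigma> = \<sigma> \<and> \<sigma> \<inter> fixed \<noteq> {}}"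
  have finfix: "finite fixed" using finite_V by (auto simp: fixed_def)
  have finK: "finite K" using finite_F by (auto simp: K_def)
  obtain v0 where v0: "v0 \<in> fixed" using assms by blast
  have star: "\<exists>Q. (\<forall>\<sigma>\<in>P v. \<sigma> - fixed = Q) \<and> card Q = 3 \<and> card (P v) + 2 = card fixed" if "v \<in> fixed" for v
    using fixed_star[OF that] unfolding P_def .
  obtain Q where "(\<forall>\<sigma>\<in>P v0. \<sigma> - fixed = Q) \<and> card Q = 3 \<and> card (P v0) + 2 = card fixed"
    using star[OF v0] by (elim exE)
  then have Q: "\<And>\<sigma>. \<sigma> \<in> P v0 \<Longrightarrow> \<sigma> - fixed = Q" "card Q = 3" by simp_all
  have KO: "\<sigma> - fixed = Q" if "\<sigma> \<in> K" for \<sigma>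
  proof -
    have "\<sigma> \<inter> fixed \<noteq> {}" using that unfolding K_def by simp
    then obtain w where w: "w \<in> fixed" "w \<in> \<sigma>" by blast
    obtain Q' where "(\<forall>\<sigma>\<in>P w. \<sigma> - fixed = Q') \<and> card Q' = 3 \<and> card (P w) + 2 = card fixed"
      using star[OF w(1)] by (elim exE)
    then have Q': "\<And>\<rho>. \<rho> \<in> P w \<Longrightarrow> \<rho> - fixed = Q'" by simp
    obtain \<rho> where "\<rho> \<in> star v0" "w \<in> \<rho>" "f ` \<rho> = \<rho>" using fixed_facet_through[OF v0 w(1)] by blast
    then have "\<rho> \<in> P v0" "\<rho> \<in> P w" by (auto simp: P_def)
    then have "Q' = Q" using Q(1) Q' by blast
    moreover have "\<sigma> \<in> P w" using that w by (auto simp: P_def K_def)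
    ultimately show ?thesis using Q' by blast
  qed
  have "Q \<noteq> {}" "finite Q" using Q(2) by (auto intro: card_ge_0_finite)
  then obtain a where a: "a \<in> Q" by blast
  have PK: "P v \<subseteq> K" if "v \<in> fixed" for v using that by (auto simp: P_def K_def)
  have cP: "card (P v) + 2 = card fixed" if "v \<in> fixed" for v using star[OF that] by (elim exE conjE)
  have Kne: "K \<noteq> {}" using fixed_facet_through[OF v0 v0] v0 by (auto simp: K_def)
  have "card K + 5 \<le> card (\<Union>K)"
    by (rule subset_cover[of _ a]) (use KO a Kne in \<open>auto simp: K_def\<close>)
  also have "\<dots> \<le> card (fixed \<union> Q)"
    by (rule card_mono) (use finfix \<open>finite Q\<close> KO in blast)+
  also have "\<dots> \<le> card fixed + 3" using card_Un_le[of fixed Q] Q(2) by simp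
  finally have cK: "card K + 2 \<le> card fixed" by simp
  have eq: "P v = K" if "v \<in> fixed" for v
    by (rule card_seteq[OF finK PK[OF that]]) (use cP[OF that] cK in simp)
  have all: "fixed \<subseteq> \<sigma>" if "\<sigma> \<in> K" for \<sigma>
  proof
    fix v assume "v \<in> fixed"
    then have "\<sigma> \<in> P v" using eq that by blast
    then show "v \<in> \<sigma>" by (simp add: P_def)
  qed
  obtain z where z: "z \<in> K" using Kne by blast
  have "z \<inter> fixed = fixed" using all[OF z] by blast
  then show c3: "card fixed = 3" using card_fixed_facet[of z] z by (simp add: K_def)
  have "\<sigma> = z" if "\<sigma> \<in> K" for \<sigma>
    using all[OF that] all[OF z] KO[OF that] KO[OF z] by blast
  then show "\<exists>z\<in>F. f ` z = z \<and> fixed \<subseteq> z \<and> (\<forall>\<sigma>\<in>F. f ` \<sigma> = \<sigma> \<longrightarrow> \<sigma> \<inter> fixed \<noteq> {} \<longrightarrow> \<sigma> = z)"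
    using z all[OF z] unfolding K_def by blast
qed

lemma fixed_not_adjacent:
  assumes "\<sigma> \<in> F" "\<rho> \<in> F" "f ` \<sigma> = \<sigma>" "f ` \<rho> = \<rho>"
  shows "\<not> adjacent \<sigma> \<rho>"
proof
  assume a: "adjacent \<sigma> \<rho>"
  then have m: "\<sigma> \<inter> fixed \<noteq> {}" "\<rho> \<inter> fixed \<noteq> {}"
    using fixed_adjacent(1) assms adjacent_sym by blast+
  then have "fixed \<noteq> {}" by blast
  then have "\<sigma> = \<rho>" using fixed_points(2) m assms by metis
  then show False using adjacent_neq[OF card_F_mem[OF assms(1)] a] by blast
qed

lemma rotation_family: "rotation_family V F f"
  by unfold_locales (use fixed_not_adjacent in blast)

end

end

section \<open>Facets as bit vectors\<close>

text \<open>One bit per vertex, in the order \<open>a1\<close>, \<open>b1\<close>,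
  \<open>c1\<close>, \<open>a2\<close> and so on: a symmetry then permutes the arguments of the
  constructor, and membership, insertion and rotation are single rewrite steps.\<close>

datatype fcode = Fc bool bool bool bool bool bool bool bool bool bool bool bool bool bool bool

fun mem :: "vertex \<Rightarrow> fcode \<Rightarrow> bool" where
  "mem a1 (Fc x0 _ _ _ _ _ _ _ _ _ _ _ _ _ _) = x0"
| "mem b1 (Fc _ x1 _ _ _ _ _ _ _ _ _ _ _ _ _) = x1"
| "mem c1 (Fc _ _ x2 _ _ _ _ _ _ _ _ _ _ _ _) = x2"
| "mem a2 (Fc _ _ _ x3 _ _ _ _ _ _ _ _ _ _ _) = x3"
| "mem b2 (Fc _ _ _ _ x4 _ _ _ _ _ _ _ _ _ _) = x4"
| "mem c2 (Fc _ _ _ _ _ x5 _ _ _ _ _ _ _ _ _) = x5"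
| "mem a3 (Fc _ _ _ _ _ _ x6 _ _ _ _ _ _ _ _) = x6"
| "mem b3 (Fc _ _ _ _ _ _ _ x7 _ _ _ _ _ _ _) = x7"
| "mem c3 (Fc _ _ _ _ _ _ _ _ x8 _ _ _ _ _ _) = x8"
| "mem a4 (Fc _ _ _ _ _ _ _ _ _ x9 _ _ _ _ _) = x9"
| "mem b4 (Fc _ _ _ _ _ _ _ _ _ _ x10 _ _ _ _) = x10"
| "mem c4 (Fc _ _ _ _ _ _ _ _ _ _ _ x11 _ _ _) = x11"
| "mem a5 (Fc _ _ _ _ _ _ _ _ _ _ _ _ x12 _ _) = x12"
| "mem b5 (Fc _ _ _ _ _ _ _ _ _ _ _ _ _ x13 _) = x13"
| "mem c5 (Fc _ _ _ _ _ _ _ _ _ _ _ _ _ _ x14) = x14"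

fun ins :: "vertex \<Rightarrow> fcode \<Rightarrow> fcode" where
  "ins a1 (Fc _ x1 x2 x3 x4 x5 x6 x7 x8 x9 x10 x11 x12 x13 x14) = Fc True x1 x2 x3 x4 x5 x6 x7 x8 x9 x10 x11 x12 x13 x14"
| "ins b1 (Fc x0 _ x2 x3 x4 x5 x6 x7 x8 x9 x10 x11 x12 x13 x14) = Fc x0 True x2 x3 x4 x5 x6 x7 x8 x9 x10 x11 x12 x13 x14"
| "ins c1 (Fc x0 x1 _ x3 x4 x5 x6 x7 x8 x9 x10 x11 x12 x13 x14) = Fc x0 x1 True x3 x4 x5 x6 x7 x8 x9 x10 x11 x12 x13 x14"
| "ins a2 (Fc x0 x1 x2 _ x4 x5 x6 x7 x8 x9 x10 x11 x12 x13 x14) = Fc x0 x1 x2 True x4 x5 x6 x7 x8 x9 x10 x11 x12 x13 x14"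
| "ins b2 (Fc x0 x1 x2 x3 _ x5 x6 x7 x8 x9 x10 x11 x12 x13 x14) = Fc x0 x1 x2 x3 True x5 x6 x7 x8 x9 x10 x11 x12 x13 x14"
| "ins c2 (Fc x0 x1 x2 x3 x4 _ x6 x7 x8 x9 x10 x11 x12 x13 x14) = Fc x0 x1 x2 x3 x4 True x6 x7 x8 x9 x10 x11 x12 x13 x14"
| "ins a3 (Fc x0 x1 x2 x3 x4 x5 _ x7 x8 x9 x10 x11 x12 x13 x14) = Fc x0 x1 x2 x3 x4 x5 True x7 x8 x9 x10 x11 x12 x13 x14"
| "ins b3 (Fc x0 x1 x2 x3 x4 x5 x6 _ x8 x9 x10 x11 x12 x13 x14) = Fc x0 x1 x2 x3 x4 x5 x6 True x8 x9 x10 x11 x12 x13 x14"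
| "ins c3 (Fc x0 x1 x2 x3 x4 x5 x6 x7 _ x9 x10 x11 x12 x13 x14) = Fc x0 x1 x2 x3 x4 x5 x6 x7 True x9 x10 x11 x12 x13 x14"
| "ins a4 (Fc x0 x1 x2 x3 x4 x5 x6 x7 x8 _ x10 x11 x12 x13 x14) = Fc x0 x1 x2 x3 x4 x5 x6 x7 x8 True x10 x11 x12 x13 x14"
| "ins b4 (Fc x0 x1 x2 x3 x4 x5 x6 x7 x8 x9 _ x11 x12 x13 x14) = Fc x0 x1 x2 x3 x4 x5 x6 x7 x8 x9 True x11 x12 x13 x14"
| "ins c4 (Fc x0 x1 x2 x3 x4 x5 x6 x7 x8 x9 x10 _ x12 x13 x14) = Fc x0 x1 x2 x3 x4 x5 x6 x7 x8 x9 x10 True x12 x13 x14"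
| "ins a5 (Fc x0 x1 x2 x3 x4 x5 x6 x7 x8 x9 x10 x11 _ x13 x14) = Fc x0 x1 x2 x3 x4 x5 x6 x7 x8 x9 x10 x11 True x13 x14"
| "ins b5 (Fc x0 x1 x2 x3 x4 x5 x6 x7 x8 x9 x10 x11 x12 _ x14) = Fc x0 x1 x2 x3 x4 x5 x6 x7 x8 x9 x10 x11 x12 True x14"
| "ins c5 (Fc x0 x1 x2 x3 x4 x5 x6 x7 x8 x9 x10 x11 x12 x13 _) = Fc x0 x1 x2 x3 x4 x5 x6 x7 x8 x9 x10 x11 x12 x13 True"

fun del :: "vertex \<Rightarrow> fcode \<Rightarrow> fcode" where
  "del a1 (Fc _ x1 x2 x3 x4 x5 x6 x7 x8 x9 x10 x11 x12 x13 x14) = Fc False x1 x2 x3 x4 x5 x6 x7 x8 x9 x10 x11 x12 x13 x14"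
| "del b1 (Fc x0 _ x2 x3 x4 x5 x6 x7 x8 x9 x10 x11 x12 x13 x14) = Fc x0 False x2 x3 x4 x5 x6 x7 x8 x9 x10 x11 x12 x13 x14"
| "del c1 (Fc x0 x1 _ x3 x4 x5 x6 x7 x8 x9 x10 x11 x12 x13 x14) = Fc x0 x1 False x3 x4 x5 x6 x7 x8 x9 x10 x11 x12 x13 x14"
| "del a2 (Fc x0 x1 x2 _ x4 x5 x6 x7 x8 x9 x10 x11 x12 x13 x14) = Fc x0 x1 x2 False x4 x5 x6 x7 x8 x9 x10 x11 x12 x13 x14"
| "del b2 (Fc x0 x1 x2 x3 _ x5 x6 x7 x8 x9 x10 x11 x12 x13 x14) = Fc x0 x1 x2 x3 False x5 x6 x7 x8 x9 x10 x11 x12 x13 x14"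
| "del c2 (Fc x0 x1 x2 x3 x4 _ x6 x7 x8 x9 x10 x11 x12 x13 x14) = Fc x0 x1 x2 x3 x4 False x6 x7 x8 x9 x10 x11 x12 x13 x14"
| "del a3 (Fc x0 x1 x2 x3 x4 x5 _ x7 x8 x9 x10 x11 x12 x13 x14) = Fc x0 x1 x2 x3 x4 x5 False x7 x8 x9 x10 x11 x12 x13 x14"
| "del b3 (Fc x0 x1 x2 x3 x4 x5 x6 _ x8 x9 x10 x11 x12 x13 x14) = Fc x0 x1 x2 x3 x4 x5 x6 False x8 x9 x10 x11 x12 x13 x14"
| "del c3 (Fc x0 x1 x2 x3 x4 x5 x6 x7 _ x9 x10 x11 x12 x13 x14) = Fc x0 x1 x2 x3 x4 x5 x6 x7 False x9 x10 x11 x12 x13 x14"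
| "del a4 (Fc x0 x1 x2 x3 x4 x5 x6 x7 x8 _ x10 x11 x12 x13 x14) = Fc x0 x1 x2 x3 x4 x5 x6 x7 x8 False x10 x11 x12 x13 x14"
| "del b4 (Fc x0 x1 x2 x3 x4 x5 x6 x7 x8 x9 _ x11 x12 x13 x14) = Fc x0 x1 x2 x3 x4 x5 x6 x7 x8 x9 False x11 x12 x13 x14"
| "del c4 (Fc x0 x1 x2 x3 x4 x5 x6 x7 x8 x9 x10 _ x12 x13 x14) = Fc x0 x1 x2 x3 x4 x5 x6 x7 x8 x9 x10 False x12 x13 x14"
| "del a5 (Fc x0 x1 x2 x3 x4 x5 x6 x7 x8 x9 x10 x11 _ x13 x14) = Fc x0 x1 x2 x3 x4 x5 x6 x7 x8 x9 x10 x11 False x13 x14"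
| "del b5 (Fc x0 x1 x2 x3 x4 x5 x6 x7 x8 x9 x10 x11 x12 _ x14) = Fc x0 x1 x2 x3 x4 x5 x6 x7 x8 x9 x10 x11 x12 False x14"
| "del c5 (Fc x0 x1 x2 x3 x4 x5 x6 x7 x8 x9 x10 x11 x12 x13 _) = Fc x0 x1 x2 x3 x4 x5 x6 x7 x8 x9 x10 x11 x12 x13 False"

fun orf :: "fcode \<Rightarrow> fcode \<Rightarrow> fcode" where
  "orf (Fc x0 x1 x2 x3 x4 x5 x6 x7 x8 x9 x10 x11 x12 x13 x14)
      (Fc y0 y1 y2 y3 y4 y5 y6 y7 y8 y9 y10 y11 y12 y13 y14) =
    Fc (x0 \<or> y0) (x1 \<or> y1) (x2 \<or> y2) (x3 \<or> y3) (x4 \<or> y4) (x5 \<or> y5) (x6 \<or> y6) (x7 \<or> y7) (x8 \<or> y8) (x9 \<or> y9) (x10 \<or> y10) (x11 \<or> y11) (x12 \<or> y12) (x13 \<or> y13) (x14 \<or> y14)"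

fun rotA :: "fcode \<Rightarrow> fcode" where
  "rotA (Fc x0 x1 x2 x3 x4 x5 x6 x7 x8 x9 x10 x11 x12 x13 x14) =
    Fc x2 x0 x1 x5 x3 x4 x8 x6 x7 x11 x9 x10 x14 x12 x13"

fun rotB :: "fcode \<Rightarrow> fcode" where
  "rotB (Fc x0 x1 x2 x3 x4 x5 x6 x7 x8 x9 x10 x11 x12 x13 x14) =
    Fc x0 x1 x2 x5 x3 x4 x8 x6 x7 x11 x9 x10 x14 x12 x13"

definition empty_code :: fcode where
  "empty_code = Fc False False False False False False False False False False False False False False False"

fun drop_unless :: "bool \<Rightarrow> nat \<Rightarrow> nat" where
  "drop_unless True k = k" | "drop_unless False 0 = 0" | "drop_unless False (Suc k) = k"

text \<open>Counts down from \<open>k\<close> with truncation: the result is 0 exactly if at least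
  \<open>k\<close> vertices are absent.\<close>

fun missing :: "fcode \<Rightarrow> nat \<Rightarrow> nat" where
  "missing (Fc x0 x1 x2 x3 x4 x5 x6 x7 x8 x9 x10 x11 x12 x13 x14) k =
    drop_unless x0 (drop_unless x1 (drop_unless x2 (drop_unless x3 (drop_unless x4 (
    drop_unless x5 (drop_unless x6 (drop_unless x7 (drop_unless x8 (drop_unless x9 (
    drop_unless x10 (drop_unless x11 (drop_unless x12 (drop_unless x13 (drop_unless x14 (k)))))))))))))))"

fun suc_if :: "bool \<Rightarrow> bool \<Rightarrow> nat \<Rightarrow> nat" where
  "suc_if True True k = Suc k" | "suc_if True False k = k" | "suc_if False b k = k"

fun common :: "fcode \<Rightarrow> fcode \<Rightarrow> nat" where
  "common (Fc x0 x1 x2 x3 x4 x5 x6 x7 x8 x9 x10 x11 x12 x13 x14)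
      (Fc y0 y1 y2 y3 y4 y5 y6 y7 y8 y9 y10 y11 y12 y13 y14) =
    suc_if x0 y0 (suc_if x1 y1 (suc_if x2 y2 (suc_if x3 y3 (suc_if x4 y4 (
    suc_if x5 y5 (suc_if x6 y6 (suc_if x7 y7 (suc_if x8 y8 (suc_if x9 y9 (
    suc_if x10 y10 (suc_if x11 y11 (suc_if x12 y12 (suc_if x13 y13 (suc_if x14 y14 (0)))))))))))))))"

text \<open>Nested conditionals let the comparison end at the first differing bit.\<close>

fun eqf :: "fcode \<Rightarrow> fcode \<Rightarrow> bool" where
  "eqf (Fc x0 x1 x2 x3 x4 x5 x6 x7 x8 x9 x10 x11 x12 x13 x14)
      (Fc y0 y1 y2 y3 y4 y5 y6 y7 y8 y9 y10 y11 y12 y13 y14) =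
    (if x0 = (\<not> y0) then False else if x1 = (\<not> y1) then False else if x2 = (\<not> y2) then False else if x3 = (\<not> y3) then False else if x4 = (\<not> y4) then False else 
     if x5 = (\<not> y5) then False else if x6 = (\<not> y6) then False else if x7 = (\<not> y7) then False else if x8 = (\<not> y8) then False else if x9 = (\<not> y9) then False else 
     if x10 = (\<not> y10) then False else if x11 = (\<not> y11) then False else if x12 = (\<not> y12) then False else if x13 = (\<not> y13) then False else if x14 = (\<not> y14) then False else True)"

fun is_zero :: "nat \<Rightarrow> bool" where
  "is_zero 0 = True" | "is_zero (Suc n) = False"

definition enc :: "vertex list \<Rightarrow> fcode" where
  "enc vs = foldr ins vs empty_code"

definition orb3 :: "(fcode \<Rightarrow> fcode) \<Rightarrow> fcode \<Rightarrow> fcode list" where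
  "orb3 rot w = [w, rot w, rot (rot w)]"

section \<open>The search\<close>

text \<open>\<open>Track v p U\<close> records that \<open>10 - p\<close> facets found so far contain \<open>v\<close>, and that they cover \<open>U\<close>.\<close>

datatype track = Track vertex nat fcode

text \<open>The facets through \<open>v\<close> number exactly 10, and any \<open>n > 0\<close> of them cover at least \<open>n + 5\<close> vertices. So
  a node of the search is discarded (\<open>None\<close>) as soon as \<open>v\<close> lies in too many facets or more than
  \<open>p\<close> vertices are still uncovered.\<close>

fun touched :: "fcode list \<Rightarrow> vertex \<Rightarrow> nat \<Rightarrow> fcode \<Rightarrow> track option" where
  "touched [] v p U = (if is_zero (missing U (Suc p)) then None else Some (Track v p U))"
| "touched (g # gs) v 0 U = (if mem v g then None else touched gs v 0 U)"
| "touched (g # gs) v (Suc p) U = (if mem v g then touched gs v p (orf U g) else touched gs v (Suc p) U)"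

text \<open>Switches to \<open>touched\<close> at the first facet through \<open>v\<close>, so
  counters that the new orbit does not meet escape the covering test. This matters for a vertex
  without facets so far: all 15 vertices are uncovered while \<open>p\<close> is 10, and the bound
  holds for a positive number of facets only.\<close>

fun update :: "fcode list \<Rightarrow> vertex \<Rightarrow> nat \<Rightarrow> fcode \<Rightarrow> track option" where
  "update [] v p U = Some (Track v p U)"
| "update (g # gs) v 0 U = (if mem v g then None else update gs v 0 U)"
| "update (g # gs) v (Suc p) U = (if mem v g then touched gs v p (orf U g) else update gs v (Suc p) U)"

text \<open>The recursive call is passed with its last argument missing, so that no rule applies to
  it before the first counter has survived.\<close>

primrec push :: "track option \<Rightarrow> (track list \<Rightarrow> track list option) \<Rightarrow> track list \<Rightarrow> track list option" where
  "push None k acc = None"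
| "push (Some t) k acc = k (t # acc)"

fun update_all :: "fcode list \<Rightarrow> track list \<Rightarrow> track list \<Rightarrow> track list option" where
  "update_all gs [] acc = Some acc"
| "update_all gs (Track v p U # ts) acc = push (update gs v p U) (update_all gs ts) acc"

fun fits1 :: "fcode list \<Rightarrow> vertex \<Rightarrow> nat \<Rightarrow> bool" where
  "fits1 [] v p = True"
| "fits1 (g # gs) v 0 = (if mem v g then False else fits1 gs v 0)"
| "fits1 (g # gs) v (Suc p) = (if mem v g then fits1 gs v p else fits1 gs v (Suc p))"

text \<open>Applied to the ridge that is left by a removal. Every insertion yields a superset of it,
  so one failure rejects them all.\<close>

fun fits :: "fcode list \<Rightarrow> track list \<Rightarrow> bool" where
  "fits gs [] = True"
| "fits gs (Track v p U # ts) = (if fits1 gs v p then fits gs ts else False)"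

text \<open>The arguments of a search are: the vertices that may be exchanged next, the vertex \<open>y\<close> brought in by the
  last exchange, the list \<open>el\<close> of the other vertices of the current facet \<open>u\<close>, the facet \<open>u\<close>, the vertices
  \<open>av\<close> whose names have been used, the orbits \<open>nw\<close> of unused names, the counters, and the path, in reverse.
  The functions are first-order and branch with \<open>if\<close> only, so that the simplifier evaluates them eagerly and
  prunes.\<close>

type_synonym search = "vertex list \<Rightarrow> vertex \<Rightarrow> vertex list \<Rightarrow> fcode \<Rightarrow> vertex list \<Rightarrow> vertex list list
  \<Rightarrow> track list \<Rightarrow> fcode list \<Rightarrow> bool"

text \<open>A search asserts that every completed path satisfies the leaf predicate, hence a pruned
  branch yields \<open>True\<close>. The first \<open>el\<close> lists the candidates for the next
  removal; \<open>y\<close>, just inserted, is not among them.\<close>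

primrec descend :: "search \<Rightarrow> track list option \<Rightarrow> vertex \<Rightarrow> vertex list \<Rightarrow> fcode \<Rightarrow> vertex list
    \<Rightarrow> vertex list list \<Rightarrow> fcode list \<Rightarrow> bool" where
  "descend k None y el w av nw path = True"
| "descend k (Some tr) y el w av nw path = k el y el w av nw tr (w # path)"

fun insert_new :: "search \<Rightarrow> (fcode \<Rightarrow> fcode) \<Rightarrow> vertex list \<Rightarrow> fcode \<Rightarrow> vertex list \<Rightarrow> vertex list list
    \<Rightarrow> track list \<Rightarrow> fcode list \<Rightarrow> bool" where
  "insert_new k rot el b av [] tr path = True"
| "insert_new k rot el b av ([] # nw) tr path = True"
| "insert_new k rot el b av ((y # ys) # nw) tr path =
    descend k (update_all (orb3 rot (ins y b)) tr []) y el (ins y b) (y # ys @ av) nw path"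

fun insert_each :: "search \<Rightarrow> (fcode \<Rightarrow> fcode) \<Rightarrow> vertex list \<Rightarrow> fcode \<Rightarrow> vertex list \<Rightarrow> fcode \<Rightarrow> vertex list
    \<Rightarrow> vertex list list \<Rightarrow> track list \<Rightarrow> fcode list \<Rightarrow> bool" where
  "insert_each k rot [] u el b av nw tr path = insert_new k rot el b av nw tr path"
| "insert_each k rot (y # ys) u el b av nw tr path =
    (if mem y u then insert_each k rot ys u el b av nw tr path
     else if descend k (update_all (orb3 rot (ins y b)) tr []) y el (ins y b) av nw path
     then insert_each k rot ys u el b av nw tr path else False)"

fun remove_vertex :: "vertex \<Rightarrow> vertex list \<Rightarrow> vertex list" where
  "remove_vertex x [] = []"
| "remove_vertex x (y # ys) = (if x = y then ys else y # remove_vertex x ys)"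

fun remove_each :: "search \<Rightarrow> (fcode \<Rightarrow> fcode) \<Rightarrow> search" where
  "remove_each k rot [] y el u av nw tr path = True"
| "remove_each k rot (x # xs) y el u av nw tr path =
     (if fits (orb3 rot (del x u)) tr
      then if insert_each k rot av u (y # remove_vertex x el) (del x u) av nw tr path
        then remove_each k rot xs y el u av nw tr path else False
      else remove_each k rot xs y el u av nw tr path)"

primrec search :: "(fcode list \<Rightarrow> bool) \<Rightarrow> (fcode \<Rightarrow> fcode) \<Rightarrow> nat \<Rightarrow> search" where
  "search leaf rot 0 xs y el u av nw tr path = leaf path"
| "search leaf rot (Suc n) xs y el u av nw tr path = remove_each (search leaf rot n) rot xs y el u av nw tr path"

section \<open>The leaves of the search\<close>

fun family :: "(fcode \<Rightarrow> fcode) \<Rightarrow> fcode list \<Rightarrow> fcode list" where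
  "family rot [] = []"
| "family rot [z] = [z]"
| "family rot (w # u # ws) = orb3 rot w @ family rot (u # ws)"

fun eq5 :: "nat \<Rightarrow> bool" where
  "eq5 (Suc (Suc (Suc (Suc (Suc n))))) = is_zero n"
| "eq5 0 = False" | "eq5 (Suc 0) = False" | "eq5 (Suc (Suc 0)) = False"
| "eq5 (Suc (Suc (Suc 0))) = False" | "eq5 (Suc (Suc (Suc (Suc 0)))) = False"

fun isolated_from :: "fcode \<Rightarrow> fcode list \<Rightarrow> bool" where
  "isolated_from c [] = True"
| "isolated_from c (d # ds) = (if eq5 (common c d) then False else isolated_from c ds)"

text \<open>The last facet must have a neighbour besides its predecessor \<open>u\<close>. The list
  holds all remaining facets, including the translates of \<open>w\<close> and of
  \<open>u\<close>.\<close>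

fun dead_end :: "(fcode \<Rightarrow> fcode) \<Rightarrow> fcode list \<Rightarrow> bool" where
  "dead_end rot (w # u # ws) = isolated_from w (rot w # rot (rot w) # rot u # rot (rot u) # family rot ws)"
| "dead_end rot ws = False"

text \<open>If n > 0 facets contain both vertices and leave m vertices uncovered, then n + m is at
  most 10; n and m are both counted down from \<open>k\<close>. With n = 0 one has m = 15, rightly
  rejected too, as any two vertices lie in a common facet.\<close>

fun sparse_pair :: "vertex \<Rightarrow> vertex \<Rightarrow> fcode list \<Rightarrow> nat \<Rightarrow> fcode \<Rightarrow> bool" where
  "sparse_pair u v [] k U = is_zero (missing U k)"
| "sparse_pair u v (g # gs) 0 U = sparse_pair u v gs 0 U"
| "sparse_pair u v (g # gs) (Suc k) U =
    (if mem u g then if mem v g then sparse_pair u v gs k (orf U g) else sparse_pair u v gs (Suc k) U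
     else sparse_pair u v gs (Suc k) U)"

fun count_adjacent :: "fcode \<Rightarrow> fcode list \<Rightarrow> nat \<Rightarrow> nat" where
  "count_adjacent c [] k = k"
| "count_adjacent c (d # ds) k = (if eq5 (common c d) then count_adjacent c ds (Suc k) else count_adjacent c ds k)"

fun count_edges :: "fcode list \<Rightarrow> nat \<Rightarrow> nat" where
  "count_edges [] k = k"
| "count_edges (c # cs) k = count_edges cs (count_adjacent c cs k)"

text \<open>Truncated subtraction; with \<open>k = 28\<close> it vanishes exactly if there are more
  than 27 edges.\<close>

fun drop_to :: "nat \<Rightarrow> nat \<Rightarrow> nat" where
  "drop_to k 0 = k" | "drop_to 0 (Suc n) = 0" | "drop_to (Suc k) (Suc n) = drop_to k n"

datatype perm = Perm vertex vertex vertex vertex vertex vertex vertex vertex vertex vertex vertex vertex vertex vertex vertex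

datatype model = Model nat "vertex list list" "perm list"

fun put :: "bool \<Rightarrow> vertex \<Rightarrow> fcode \<Rightarrow> fcode" where
  "put True v c = ins v c" | "put False v c = c"

fun map_code :: "fcode \<Rightarrow> perm \<Rightarrow> fcode" where
  "map_code (Fc x0 x1 x2 x3 x4 x5 x6 x7 x8 x9 x10 x11 x12 x13 x14)
      (Perm v0 v1 v2 v3 v4 v5 v6 v7 v8 v9 v10 v11 v12 v13 v14) =
    put x0 v0 (put x1 v1 (put x2 v2 (put x3 v3 (put x4 v4 (put x5 v5 (put x6 v6 (put x7 v7
      (put x8 v8 (put x9 v9 (put x10 v10 (put x11 v11 (put x12 v12 (put x13 v13 (put x14 v14 empty_code))))))))))))))"

fun listed :: "fcode \<Rightarrow> fcode list \<Rightarrow> bool" where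
  "listed c [] = False"
| "listed c (d # ds) = (if eqf c d then True else listed c ds)"

fun maps_into :: "fcode list \<Rightarrow> fcode list \<Rightarrow> perm \<Rightarrow> bool" where
  "maps_into [] fs p = True"
| "maps_into (c # cs) fs p = (if listed (map_code c p) fs then maps_into cs fs p else False)"

fun some_perm :: "fcode list \<Rightarrow> fcode list \<Rightarrow> perm list \<Rightarrow> bool" where
  "some_perm cs fs [] = False"
| "some_perm cs fs (p # ps) = (if maps_into cs fs p then True else some_perm cs fs ps)"

fun encs :: "vertex list list \<Rightarrow> fcode list" where
  "encs [] = []" | "encs (vs # vss) = enc vs # encs vss"

fun some_model :: "fcode list \<Rightarrow> model list \<Rightarrow> bool" where
  "some_model cs [] = False"
| "some_model cs (Model i vss ps # ms) = (if some_perm cs (family rotA (encs vss)) ps then True else some_model cs ms)"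


text \<open>The facets are listed from \<open>u\<^sub>i\<^sub>,\<^sub>8\<close> down to \<open>u\<^sub>i\<^sub>,\<^sub>1\<close> and \<open>z\<close>, because \<open>family\<close> rotates every entry but the last. The
  permutations are those that are needed to recognise \<open>N\<^sub>i\<close> at some leaf of the search.\<close>

definition models :: "model list" where
  "models =
   [Model 1
     [[b1, c2, b3, b4, a5, b5], [c2, a3, b3, b4, a5, b5], [a3, b3, a4, b4, a5, b5],
      [a1, a3, a4, b4, a5, b5], [a1, a2, a3, a4, b4, a5], [a1, a2, b2, a3, a4, a5],
      [a1, b1, a2, b2, a3, a4], [a1, b1, c1, a2, b2, a3], [a1, b1, c1, a2, b2, c2]]
     [Perm a1 b1 c1 b2 c2 a2 b3 c3 a3 b4 c4 a4 b5 c5 a5,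
      Perm a1 c1 b1 c2 b2 a2 b3 a3 c3 b4 a4 c4 b5 a5 c5],
    Model 2
     [[b1, b3, b4, c4, a5, b5], [a3, b3, b4, c4, a5, b5], [a2, a3, b3, b4, a5, b5],
      [a1, a2, a3, b4, a5, b5], [a1, a2, a3, a4, b4, a5], [a1, a2, b2, a3, a4, a5],
      [a1, b1, a2, b2, a3, a4], [a1, b1, c1, a2, b2, a3], [a1, b1, c1, a2, b2, c2]]
     [Perm a1 b1 c1 b2 c2 a2 b3 c3 a3 b4 c4 a4 b5 c5 a5,
      Perm a1 c1 b1 c2 b2 a2 b3 a3 c3 b4 a4 c4 b5 a5 c5],
    Model 3
     [[b2, b3, b4, c4, a5, b5], [a3, b3, b4, c4, a5, b5], [a2, a3, b3, b4, a5, b5],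
      [a1, a2, a3, b4, a5, b5], [a1, a2, a3, a4, b4, a5], [a1, b1, a2, a3, a4, a5],
      [a1, b1, a2, b2, a3, a4], [a1, b1, c1, a2, b2, a3], [a1, b1, c1, a2, b2, c2]]
     [Perm a1 b1 c1 b2 c2 a2 b3 c3 a3 b4 c4 a4 b5 c5 a5,
      Perm a1 c1 b1 c2 b2 a2 b3 a3 c3 b4 a4 c4 b5 a5 c5],
    Model 4
     [[c1, b3, a4, b4, a5, b5], [a2, b3, a4, b4, a5, b5], [a2, a3, b3, a4, b4, a5],
      [a2, a3, b3, a4, a5, c5], [b1, a2, a3, a4, a5, c5], [a1, b1, a2, a3, a4, a5],
      [a1, b1, a2, b2, a3, a4], [a1, b1, c1, a2, b2, a3], [a1, b1, c1, a2, b2, c2]]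
     [Perm a1 b1 c1 b2 c2 a2 b3 c3 a3 b4 c4 a4 b5 c5 a5,
      Perm a1 c1 b1 c2 b2 a2 b3 a3 c3 b4 a4 c4 b5 a5 c5],
    Model 5
     [[a2, b3, b4, c4, b5, c5], [a2, a3, b3, b4, c4, b5], [a2, a3, b3, b4, a5, b5],
      [a2, a3, a4, b4, a5, b5], [a1, a2, a3, a4, a5, b5], [a1, b1, a2, a3, a4, a5],
      [a1, b1, c1, a2, a3, a4], [a1, b1, c1, a2, b2, a3], [a1, b1, c1, a2, b2, c2]]
     [Perm a1 c1 b1 a2 c2 b2 c3 b3 a3 c4 b4 a4 c5 b5 a5,
      Perm a1 c1 b1 b2 a2 c2 a3 c3 b3 a4 c4 b4 a5 c5 b5,
      Perm a1 c1 b1 c2 b2 a2 b3 a3 c3 b4 a4 c4 b5 a5 c5],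
    Model 6
     [[a2, b3, b4, c4, b5, c5], [a2, a3, b3, b4, b5, c5], [a2, a3, b3, a4, b4, b5],
      [a2, a3, a4, b4, a5, b5], [a1, a2, a3, a4, a5, b5], [a1, b1, a2, a3, a4, a5],
      [a1, b1, c1, a2, a3, a4], [a1, b1, c1, a2, b2, a3], [a1, b1, c1, a2, b2, c2]]
     [Perm a1 c1 b1 a2 c2 b2 c3 b3 a3 c4 b4 a4 c5 b5 a5,
      Perm a1 c1 b1 b2 a2 c2 a3 c3 b3 a4 c4 b4 a5 c5 b5,
      Perm a1 c1 b1 c2 b2 a2 b3 a3 c3 b4 a4 c4 b5 a5 c5],
    Model 7
     [[a2, b3, b4, c4, a5, b5], [a2, a3, b3, b4, c4, a5], [a2, a3, b3, b4, a5, c5],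
      [a2, a3, a4, b4, a5, c5], [b1, a2, a3, a4, a5, c5], [a1, b1, a2, a3, a4, a5],
      [a1, b1, c1, a2, a3, a4], [a1, b1, c1, a2, b2, a3], [a1, b1, c1, a2, b2, c2]]
     [Perm a1 c1 b1 a2 c2 b2 c3 b3 a3 c4 b4 a4 c5 b5 a5,
      Perm a1 c1 b1 b2 a2 c2 a3 c3 b3 a4 c4 b4 a5 c5 b5,
      Perm a1 c1 b1 c2 b2 a2 b3 a3 c3 b4 a4 c4 b5 a5 c5],
    Model 8
     [[a2, b3, b4, c4, a5, b5], [a2, a3, b3, b4, a5, b5], [a2, a3, b3, a4, b4, a5],
      [a2, a3, a4, b4, a5, c5], [b1, a2, a3, a4, a5, c5], [a1, b1, a2, a3, a4, a5],
      [a1, b1, c1, a2, a3, a4], [a1, b1, c1, a2, b2, a3], [a1, b1, c1, a2, b2, c2]]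
     [Perm a1 c1 b1 a2 c2 b2 c3 b3 a3 c4 b4 a4 c5 b5 a5,
      Perm a1 c1 b1 b2 a2 c2 a3 c3 b3 a4 c4 b4 a5 c5 b5,
      Perm a1 c1 b1 c2 b2 a2 b3 a3 c3 b4 a4 c4 b5 a5 c5],
    Model 9
     [[a2, b3, a4, b4, b5, c5], [a2, a3, b3, a4, b5, c5], [a2, a3, b3, a4, c4, b5],
      [a2, a3, a4, c4, a5, b5], [a1, a2, a3, a4, a5, b5], [a1, b1, a2, a3, a4, a5],
      [a1, b1, c1, a2, a3, a4], [a1, b1, c1, a2, b2, a3], [a1, b1, c1, a2, b2, c2]]
     [Perm a1 c1 b1 a2 c2 b2 c3 b3 a3 c4 b4 a4 c5 b5 a5,
      Perm a1 c1 b1 b2 a2 c2 a3 c3 b3 a4 c4 b4 a5 c5 b5,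
      Perm a1 c1 b1 c2 b2 a2 b3 a3 c3 b4 a4 c4 b5 a5 c5],
    Model 10
     [[a2, b3, a4, b4, a5, b5], [a2, a3, b3, a4, a5, b5], [a2, a3, b3, a4, c4, a5],
      [a2, a3, a4, c4, a5, c5], [b1, a2, a3, a4, a5, c5], [a1, b1, a2, a3, a4, a5],
      [a1, b1, c1, a2, a3, a4], [a1, b1, c1, a2, b2, a3], [a1, b1, c1, a2, b2, c2]]
     [Perm a1 c1 b1 a2 c2 b2 c3 b3 a3 c4 b4 a4 c5 b5 a5,
      Perm a1 c1 b1 b2 a2 c2 a3 c3 b3 a4 c4 b4 a5 c5 b5,
      Perm a1 c1 b1 c2 b2 a2 b3 a3 c3 b4 a4 c4 b5 a5 c5],
    Model 11
     [[b2, b3, c3, a4, b4, b5], [b2, b3, a4, b4, a5, b5], [a2, b3, a4, b4, a5, b5],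
      [a2, a3, b3, a4, a5, b5], [a1, a2, a3, a4, a5, b5], [a1, b1, a2, a3, a4, a5],
      [a1, b1, c1, a2, a3, a4], [a1, b1, c1, a2, b2, a3], [a1, b1, c1, a2, b2, c2]]
     [Perm a1 c1 b1 a2 c2 b2 c3 b3 a3 c4 b4 a4 c5 b5 a5,
      Perm a1 c1 b1 b2 a2 c2 a3 c3 b3 a4 c4 b4 a5 c5 b5,
      Perm a1 c1 b1 c2 b2 a2 b3 a3 c3 b4 a4 c4 b5 a5 c5],
    Model 12
     [[b2, b3, c3, a4, b4, a5], [b2, b3, a4, b4, a5, c5], [a2, b3, a4, b4, a5, c5],
      [a2, a3, b3, a4, a5, c5], [b1, a2, a3, a4, a5, c5], [a1, b1, a2, a3, a4, a5],
      [a1, b1, c1, a2, a3, a4], [a1, b1, c1, a2, b2, a3], [a1, b1, c1, a2, b2, c2]]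
     [Perm a1 c1 b1 a2 c2 b2 c3 b3 a3 c4 b4 a4 c5 b5 a5,
      Perm a1 c1 b1 b2 a2 c2 a3 c3 b3 a4 c4 b4 a5 c5 b5,
      Perm a1 c1 b1 c2 b2 a2 b3 a3 c3 b4 a4 c4 b5 a5 c5]]"

text \<open>Four pairs of vertices happen to suffice. The bounds are \<open>10 + 1\<close> and \<open>27 + 1\<close>.\<close>

definition leaf_family :: "fcode list \<Rightarrow> bool" where
  "leaf_family cs =
    (if sparse_pair a2 b3 cs 11 empty_code then True else if sparse_pair a4 b4 cs 11 empty_code then True
     else if sparse_pair a3 c5 cs 11 empty_code then True else if sparse_pair a3 b5 cs 11 empty_code then True
     else if some_model cs models then True else is_zero (drop_to 28 (count_edges cs 0)))"

definition leafA :: "fcode list \<Rightarrow> bool" where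
  "leafA path = (if dead_end rotA path then True else leaf_family (family rotA path))"

text \<open>Counters are matched against \<open>Suc\<close>, so numerals have to be expanded into
  successors.\<close>

lemmas unary_rules = numeral_eq_Suc pred_numeral_simps BitM.simps One_nat_def

lemmas search_rules = unary_rules mem.simps ins.simps del.simps orf.simps rotA.simps rotB.simps drop_unless.simps missing.simps
  is_zero.simps orb3_def touched.simps update.simps push.simps update_all.simps fits1.simps fits.simps descend.simps
  insert_new.simps insert_each.simps remove_vertex.simps remove_each.simps search.simps append.simps
  vertex.distinct simp_thms if_True if_False

lemmas enc_rules = enc_def empty_code_def foldr.simps o_apply id_apply

lemmas leaf_rules = leafA_def dead_end.simps isolated_from.simps eq5.simps common.simps suc_if.simps family.simps
  leaf_family_def sparse_pair.simps count_edges.simps count_adjacent.simps drop_to.simps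
  some_model.simps models_def encs.simps enc_rules some_perm.simps maps_into.simps listed.simps eqf.simps map_code.simps put.simps

section \<open>The meaning of the codes\<close>

lemma UNIV_vertex: "UNIV = {a1, b1, c1, a2, b2, c2, a3, b3, c3, a4, b4, c4, a5, b5, c5}"
proof
  show "UNIV \<subseteq> {a1, b1, c1, a2, b2, c2, a3, b3, c3, a4, b4, c4, a5, b5, c5}"
  proof
    fix v :: vertex
    show "v \<in> {a1, b1, c1, a2, b2, c2, a3, b3, c3, a4, b4, c4, a5, b5, c5}" by (cases v) simp_all
  qed
qed simp

lemma finite_vertex: "finite (UNIV :: vertex set)"
  by (simp add: UNIV_vertex)

lemma card_compl_vertex: "card A + card (- A) = 15" for A :: "vertex set"
proof -
  have "finite A" "finite (- A)" using finite_subset[OF subset_UNIV finite_vertex] by blast+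
  then have "card A + card (- A) = card (A \<union> - A)" by (intro card_Un_disjoint[symmetric]) simp_all
  also have "\<dots> = 15" by (simp add: UNIV_vertex)
  finally show ?thesis .
qed

definition sem :: "fcode \<Rightarrow> vertex set" where
  "sem c = {v. mem v c}"

lemma mem_sem: "v \<in> sem c \<longleftrightarrow> mem v c"
  by (simp add: sem_def)

lemma sem_ins: "sem (ins v c) = insert v (sem c)"
proof -
  have "mem w (ins v c) \<longleftrightarrow> w = v \<or> mem w c" for w
    by (cases c; cases v; cases w; simp)
  then show ?thesis by (auto simp: sem_def)
qed

lemma sem_del: "sem (del v c) = sem c - {v}"
proof -
  have "mem w (del v c) \<longleftrightarrow> w \<noteq> v \<and> mem w c" for w
    by (cases c; cases v; cases w; simp)
  then show ?thesis by (auto simp: sem_def)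
qed

lemma sem_orf: "sem (orf c d) = sem c \<union> sem d"
proof -
  have "mem w (orf c d) \<longleftrightarrow> mem w c \<or> mem w d" for w
    by (cases c; cases d; cases w; simp)
  then show ?thesis by (auto simp: sem_def)
qed

lemma sem_empty: "sem empty_code = {}"
proof -
  have "\<not> mem w empty_code" for w by (cases w) (simp_all add: empty_code_def)
  then show ?thesis by (auto simp: sem_def)
qed

lemma sem_enc: "sem (enc vs) = set vs"
  unfolding enc_def by (induction vs) (simp_all add: sem_empty sem_ins)

lemma sem_inject: "sem c = sem d \<longleftrightarrow> c = d"
proof
  assume "sem c = sem d"
  then have "mem v c = mem v d" for v by (auto simp: sem_def)
  from this[of a1] this[of b1] this[of c1] this[of a2] this[of b2] this[of c2] this[of a3] this[of b3] this[of c3]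
    this[of a4] this[of b4] this[of c4] this[of a5] this[of b5] this[of c5]
  show "c = d" by (cases c; cases d) simp
qed simp

lemma eqf_iff: "eqf c d \<longleftrightarrow> c = d"
  by (cases c; cases d) simp

lemma phi_cubed: "\<phi> (\<phi> (\<phi> v)) = v"
  by (cases v) simp_all

lemma phi_neq: "\<phi> v \<noteq> v"
  by (cases v) simp_all

text \<open>The model of a symmetry with fixed vertices, of which there are exactly three.\<close>

definition \<psi> :: "vertex \<Rightarrow> vertex" where
  "\<psi> v = (if v \<in> {a1, b1, c1} then v else \<phi> v)"

lemma psi_cubed: "\<psi> (\<psi> (\<psi> v)) = v"
  by (cases v) (simp_all add: \<psi>_def)

lemma image_eqI_cubed:
  fixes f :: "vertex \<Rightarrow> vertex"
  assumes "\<And>v. f (f (f v)) = v" "\<And>v. f v \<in> B \<longleftrightarrow> v \<in> A"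
  shows "B = f ` A"
proof
  show "f ` A \<subseteq> B" using assms(2) by auto
  show "B \<subseteq> f ` A"
  proof
    fix w assume "w \<in> B"
    then have "f (f w) \<in> A" using assms by metis
    then show "w \<in> f ` A" using assms(1) by (metis imageI)
  qed
qed

lemma sem_rotA: "sem (rotA c) = \<phi> ` sem c"
proof (rule image_eqI_cubed[OF phi_cubed])
  show "\<phi> v \<in> sem (rotA c) \<longleftrightarrow> v \<in> sem c" for v
    unfolding mem_sem by (cases c; cases v) simp_all
qed

lemma sem_rotB: "sem (rotB c) = \<psi> ` sem c"
proof (rule image_eqI_cubed[OF psi_cubed])
  show "\<psi> v \<in> sem (rotB c) \<longleftrightarrow> v \<in> sem c" for v
    unfolding mem_sem by (cases c; cases v) (simp_all add: \<psi>_def)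
qed

definition indic :: "bool \<Rightarrow> nat" where
  "indic b = (if b then 1 else 0)"

lemma card_Collect_vertex:
  "card {v. P v} = indic (P a1) + (indic (P b1) + (indic (P c1) + (indic (P a2) + (indic (P b2) + (indic (P c2)
    + (indic (P a3) + (indic (P b3) + (indic (P c3) + (indic (P a4) + (indic (P b4) + (indic (P c4)
    + (indic (P a5) + (indic (P b5) + indic (P c5))))))))))))))"
proof -
  have "card {v. P v} = (\<Sum>v\<in>UNIV. indic (P v))"
    unfolding indic_def using finite_vertex by (simp add: sum.If_cases)
  then show ?thesis by (simp add: UNIV_vertex)
qed

lemma missing_eq: "missing c k = k - card (- sem c)"
proof -
  have eq: "drop_unless b k = k - indic (\<not> b)" for b k
    by (cases b; cases k) (simp_all add: indic_def)
  have *: "- sem c = {v. \<not> mem v c}" by (auto simp: sem_def)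
  show ?thesis unfolding * card_Collect_vertex
    by (cases c) (simp only: missing.simps eq mem.simps diff_diff_left ac_simps)
qed

lemma common_eq: "common c d = card (sem c \<inter> sem d)"
proof -
  have eq: "suc_if a b k = indic (a \<and> b) + k" for a b k
    by (cases a; cases b) (simp_all add: indic_def)
  have *: "sem c \<inter> sem d = {v. mem v c \<and> mem v d}" by (auto simp: sem_def)
  show ?thesis unfolding * card_Collect_vertex
    by (cases c; cases d) (simp only: common.simps eq mem.simps add_0_right)
qed

lemma is_zero_iff: "is_zero n \<longleftrightarrow> n = 0"
  by (cases n) simp_all

lemma eq5_iff: "eq5 n \<longleftrightarrow> n = 5"
  by (cases n rule: eq5.cases) (auto simp: is_zero_iff)

section \<open>Relabelling\<close>

text \<open>Exchanges the orbits of \<open>x\<close> and \<open>y\<close> compatibly with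
  \<open>f\<close>, taking \<open>y\<close> to \<open>x\<close>. If the orbits coincide, the first
  three clauses take precedence and rotate this orbit alone.\<close>

definition relab :: "('a \<Rightarrow> 'a) \<Rightarrow> 'a \<Rightarrow> 'a \<Rightarrow> 'a \<Rightarrow> 'a" where
  "relab f x y v = (if v = y then x else if v = f y then f x else if v = f (f y) then f (f x)
     else if v = x then y else if v = f x then f y else if v = f (f x) then f (f y) else v)"

lemma relab:
  fixes f :: "vertex \<Rightarrow> vertex"
  assumes c: "\<And>v. f (f (f v)) = v" and n: "f x \<noteq> x" "f y \<noteq> y"
  shows "relab f x y y = x" "f (relab f x y v) = relab f x y (f v)" "bij (relab f x y)"
    "v \<notin> {x, f x, f (f x), y, f y, f (f y)} \<Longrightarrow> relab f x y v = v"
proof -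
  have inj: "f u = f w \<longleftrightarrow> u = w" for u w using c by metis
  have sh: "f u = w \<longleftrightarrow> u = f (f w)" for u w using c by metis
  have n': "f (f x) \<noteq> x" "f (f x) \<noteq> f x" "f (f y) \<noteq> y" "f (f y) \<noteq> f y" using n c by metis+
  show "relab f x y y = x" by (simp add: relab_def)
  show "f (relab f x y v) = relab f x y (f v)"
    unfolding relab_def by (simp add: inj sh[of v x] sh[of v y] n n' c)
  have "\<exists>v. w = relab f x y v" for w
  proof -
    consider "w \<in> {x, f x, f (f x)}" | "w \<in> {y, f y, f (f y)}" "w \<notin> {x, f x, f (f x)}"
      | "w \<notin> {x, f x, f (f x), y, f y, f (f y)}" by blast
    then show ?thesis
    proof cases
      case 1
      moreover have "x = relab f x y y" "f x = relab f x y (f y)" "f (f x) = relab f x y (f (f y))"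
        using n n' by (simp_all add: relab_def)
      ultimately show ?thesis by blast
    next
      case 2
      have d: "x \<noteq> y" "x \<noteq> f y" "x \<noteq> f (f y)" using 2 c by auto
      have d': "f x \<noteq> y" "f x \<noteq> f y" "f x \<noteq> f (f y)" "f (f x) \<noteq> y" "f (f x) \<noteq> f y" "f (f x) \<noteq> f (f y)"
        using d inj sh by metis+
      have "y = relab f x y x" "f y = relab f x y (f x)" "f (f y) = relab f x y (f (f x))"
        using n n' d d' by (simp_all add: relab_def)
      then show ?thesis using 2 by blast
    next
      case 3
      then have "w = relab f x y w" by (simp add: relab_def)
      then show ?thesis by blast
    qed
  qed
  then have "surj (relab f x y)" by (auto simp: surj_def)
  then show "bij (relab f x y)" using finite_UNIV_surj_inj[OF finite_vertex] by (simp add: bij_def)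
  show "v \<notin> {x, f x, f (f x), y, f y, f (f y)} \<Longrightarrow> relab f x y v = v" by (simp add: relab_def)
qed

section \<open>Permutations of the labels that normalise the group generated by the symmetry\<close>

locale labelled =
  fixes f :: "vertex \<Rightarrow> vertex"
  assumes cubed: "f (f (f v)) = v" and nontrivial: "\<exists>v. f v \<noteq> v"
begin

abbreviation rotational :: "vertex set set \<Rightarrow> bool" where
  "rotational G \<equiv> rotation_family UNIV G f"

text \<open>The second alternative conjugates \<open>f\<close> to its inverse, which has the same
  orbits of facets. The reflection used in the free case is of this kind.\<close>

definition normalises :: "(vertex \<Rightarrow> vertex) \<Rightarrow> bool" where
  "normalises \<pi> \<longleftrightarrow> bij \<pi> \<and> ((\<forall>v. f (\<pi> v) = \<pi> (f v)) \<or> (\<forall>v. f (\<pi> v) = \<pi> (f (f v))))"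

lemma rotationalI:
  assumes "tight UNIV G" "\<And>\<sigma>. \<sigma> \<in> G \<Longrightarrow> f ` \<sigma> \<in> G"
  shows "rotational G"
proof -
  interpret symmetric_family UNIV G f
    by unfold_locales (use assms cubed in auto)
  show ?thesis by (rule rotation_family) (use nontrivial in simp)
qed

lemma rotationalD:
  assumes "rotational G"
  shows "tight UNIV G" "\<sigma> \<in> G \<Longrightarrow> f ` \<sigma> \<in> G"
proof -
  interpret rotation_family UNIV G f by (rule assms)
  show "tight UNIV G" by (rule tight)
  show "\<sigma> \<in> G \<Longrightarrow> f ` \<sigma> \<in> G" by (rule f_F)
qed

lemma image_cases:
  assumes "normalises \<pi>"
  shows "(\<forall>\<sigma>. f ` \<pi> ` \<sigma> = \<pi> ` f ` \<sigma>) \<or> (\<forall>\<sigma>. f ` \<pi> ` \<sigma> = \<pi> ` f ` f ` \<sigma>)"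
  using assms unfolding normalises_def by (auto simp: image_image)

lemma cubed_image: "f ` f ` f ` \<sigma> = \<sigma>"
  by (simp add: image_image cubed)

lemma rotational_image:
  assumes G: "rotational G" and \<pi>: "normalises \<pi>"
  shows "rotational ((`) \<pi> ` G)"
proof (rule rotationalI)
  show "tight UNIV ((`) \<pi> ` G)"
    by (rule tight_image[OF rotationalD(1)[OF G]]) (use \<pi> in \<open>simp add: normalises_def\<close>)
  show "f ` \<sigma> \<in> (`) \<pi> ` G" if "\<sigma> \<in> (`) \<pi> ` G" for \<sigma>
  proof -
    obtain \<rho> where r: "\<rho> \<in> G" "\<sigma> = \<pi> ` \<rho>" using \<open>\<sigma> \<in> (`) \<pi> ` G\<close> by (elim imageE)
    have "f ` \<rho> \<in> G" "f ` f ` \<rho> \<in> G" using rotationalD(2)[OF G] r(1) by simp_all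
    moreover have "f ` \<sigma> = \<pi> ` f ` \<rho> \<or> f ` \<sigma> = \<pi> ` f ` f ` \<rho>" using image_cases[OF \<pi>] unfolding r(2) by metis
    ultimately show ?thesis by (metis imageI)
  qed
qed

lemma orb_image:
  assumes "normalises \<pi>"
  shows "orbit f (\<pi> ` \<sigma>) = (`) \<pi> ` orbit f \<sigma>"
proof -
  show ?thesis unfolding orbit_def
    using image_cases[OF assms]
  proof
    assume a: "\<forall>\<sigma>. f ` \<pi> ` \<sigma> = \<pi> ` f ` f ` \<sigma>"
    then have b: "f ` f ` \<pi> ` \<sigma> = \<pi> ` f ` \<sigma>" by (simp only: cubed_image)
    show "{\<pi> ` \<sigma>, f ` \<pi> ` \<sigma>, f ` f ` \<pi> ` \<sigma>} = (`) \<pi> ` {\<sigma>, f ` \<sigma>, f ` f ` \<sigma>}"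
      unfolding b by (simp add: a insert_commute)
  qed simp
qed

lemma inj_image_normalises: "normalises \<pi> \<Longrightarrow> \<pi> ` \<sigma> = \<pi> ` \<rho> \<longleftrightarrow> \<sigma> = \<rho>"
  by (simp add: normalises_def bij_def inj_image_eq_iff)

lemma fixed_image_iff:
  assumes "normalises \<pi>"
  shows "f ` \<pi> ` \<sigma> = \<pi> ` \<sigma> \<longleftrightarrow> f ` \<sigma> = \<sigma>"
proof -
  have "f ` f ` \<sigma> = \<sigma> \<longleftrightarrow> f ` \<sigma> = \<sigma>" using cubed_image by metis
  then show ?thesis
    using image_cases[OF assms] inj_image_normalises[OF assms] by metis
qed

lemma spread_image:
  assumes "normalises \<pi>"
  shows "spread f (map ((`) \<pi>) ws) = (`) \<pi> ` spread f ws"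
  unfolding spread_def by (simp add: image_UN image_image orb_image[OF assms])

lemma quotient_path_image:
  assumes \<pi>: "normalises \<pi>"
  shows "quotient_path G f ws \<Longrightarrow> quotient_path ((`) \<pi> ` G) f (map ((`) \<pi>) ws)"
proof (induction rule: quotient_path.induct)
  case (start z)
  have "quotient_path ((`) \<pi> ` G) f [\<pi> ` z]"
    by (rule quotient_path.start) (use start fixed_image_iff[OF \<pi>] in simp_all)
  then show ?case by simp
next
  case (step u ws w)
  have inj: "inj \<pi>" using \<pi> by (simp add: normalises_def bij_def)
  have "quotient_path ((`) \<pi> ` G) f (\<pi> ` w # \<pi> ` u # map ((`) \<pi>) ws)"
  proof (rule quotient_path.step)
    show "\<pi> ` w \<notin> spread f (\<pi> ` u # map ((`) \<pi>) ws)"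
    proof
      assume "\<pi> ` w \<in> spread f (\<pi> ` u # map ((`) \<pi>) ws)"
      then have "\<pi> ` w \<in> (`) \<pi> ` spread f (u # ws)" using spread_image[OF \<pi>, of "u # ws"] by simp
      then show False using step.hyps(3) inj_image_normalises[OF \<pi>] by (metis imageE)
    qed
    show "adjacent (\<pi> ` u) (\<pi> ` w)"
      using step.hyps(5) inj by (simp add: adjacent_def image_Int[symmetric] card_image inj_on_subset[OF inj])
  qed (use step fixed_image_iff[OF \<pi>] in simp_all)
  then show ?case by simp
qed

end

section \<open>Soundness of the search\<close>

definition hits :: "vertex \<Rightarrow> fcode list \<Rightarrow> nat" where
  "hits v gs = length (filter (mem v) gs)"

lemma hits_simps [simp]: "hits v [] = 0" "hits v (g # gs) = (if mem v g then Suc (hits v gs) else hits v gs)"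
  by (simp_all add: hits_def)

fun cover :: "vertex \<Rightarrow> fcode list \<Rightarrow> fcode \<Rightarrow> fcode" where
  "cover v [] U = U"
| "cover v (g # gs) U = cover v gs (if mem v g then orf U g else U)"

lemma sem_cover: "sem (cover v gs U) = sem U \<union> \<Union>{sem g | g. g \<in> set gs \<and> mem v g}"
  by (induction gs arbitrary: U) (auto simp: sem_orf)

lemma fits1_iff: "fits1 gs v p \<longleftrightarrow> hits v gs \<le> p"
  by (induction gs v p rule: fits1.induct) auto

lemma touched_eq:
  "hits v gs \<le> p \<Longrightarrow> touched gs v p U =
    (if missing (cover v gs U) (Suc (p - hits v gs)) = 0 then None else Some (Track v (p - hits v gs) (cover v gs U)))"
proof (induction gs arbitrary: p U)
  case Nil
  then show ?case by (simp add: is_zero_iff)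
next
  case (Cons g gs)
  then show ?case by (cases p) auto
qed

lemma update_eq:
  "hits v gs \<le> p \<Longrightarrow> update gs v p U =
    (if hits v gs = 0 then Some (Track v p U)
     else if missing (cover v gs U) (Suc (p - hits v gs)) = 0 then None
     else Some (Track v (p - hits v gs) (cover v gs U)))"
proof (induction gs arbitrary: p U)
  case Nil
  then show ?case by simp
next
  case (Cons g gs)
  then show ?case by (cases p) (auto simp: touched_eq)
qed

lemma insert_each_new: "insert_each k rot ys u el b av nw tr path \<Longrightarrow> insert_new k rot el b av nw tr path"
  by (induction ys) (auto split: if_splits)

lemma insert_each_old:
  "insert_each k rot ys u el b av nw tr path \<Longrightarrow> y \<in> set ys \<Longrightarrow> \<not> mem y u
    \<Longrightarrow> descend k (update_all (orb3 rot (ins y b)) tr []) y el (ins y b) av nw path"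
  by (induction ys) (auto split: if_splits)

lemma remove_eachD:
  "remove_each k rot xs y el u av nw tr path \<Longrightarrow> x \<in> set xs \<Longrightarrow> fits (orb3 rot (del x u)) tr
    \<Longrightarrow> insert_each k rot av u (y # remove_vertex x el) (del x u) av nw tr path"
  by (induction xs) (auto split: if_splits)

lemma remove_vertex_eq: "remove_vertex x xs = remove1 x xs"
  by (induction xs) auto

fun tracked :: "vertex set set \<Rightarrow> track \<Rightarrow> bool" where
  "tracked S (Track v p U) \<longleftrightarrow> card {\<sigma>\<in>S. v \<in> \<sigma>} + p = 10 \<and> sem U = \<Union>{\<sigma>\<in>S. v \<in> \<sigma>}"

locale search_setting = labelled +
  fixes rot :: "fcode \<Rightarrow> fcode"
  assumes sem_rot: "sem (rot c) = f ` sem c"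
begin

lemma sem_orb3: "sem ` set (orb3 rot w) = orbit f (sem w)" "map sem (orb3 rot w) = [sem w, f ` sem w, f ` f ` sem w]"
  by (simp_all add: orb3_def orbit_def sem_rot)

text \<open>In an actual family neither reason for pruning occurs: a star has only 10 facets, and
  any n > 0 of them cover n + 5 vertices.\<close>

lemma tracked_update:
  assumes G: "rotational G" and S: "S \<subseteq> G" and w: "orbit f (sem w) \<subseteq> G" "orbit f (sem w) \<inter> S = {}"
    "card (orbit f (sem w)) = 3" and t: "tracked S (Track v p U)"
  shows "hits v (orb3 rot w) \<le> p"
    "\<exists>t'. update (orb3 rot w) v p U = Some t' \<and> tracked (S \<union> orbit f (sem w)) t'"
proof -
  interpret rotation_family UNIV G f by (rule G)
  let ?gs = "orb3 rot w" and ?S = "S \<union> orbit f (sem w)"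
  let ?h = "hits v ?gs"
  have finS: "finite S" using S finite_F finite_subset by blast
  \<comment> \<open>The three codes denote distinct sets, so hits among them count new facets
    through \<open>v\<close>.\<close>
  have dist: "distinct (map sem ?gs)"
    by (rule card_distinct) (use w(3) sem_orb3(1)[of w] in \<open>simp add: orb3_def\<close>)
  have new: "{\<sigma>\<in>orbit f (sem w). v \<in> \<sigma>} = sem ` set (filter (mem v) ?gs)"
    unfolding sem_orb3(1)[symmetric] by (auto simp: mem_sem)
  have "card (sem ` set (filter (mem v) ?gs)) = ?h"
    using distinct_card[OF distinct_map_filter[OF dist, of "mem v"]] by (simp add: hits_def)
  then have cnew: "card {\<sigma>\<in>orbit f (sem w). v \<in> \<sigma>} = ?h" using new by simp
  have un: "{\<sigma>\<in>?S. v \<in> \<sigma>} = {\<sigma>\<in>S. v \<in> \<sigma>} \<union> {\<sigma>\<in>orbit f (sem w). v \<in> \<sigma>}" by blast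
  have fo: "finite (orbit f (sem w))" by (simp add: orbit_def)
  have "card {\<sigma>\<in>?S. v \<in> \<sigma>} = card {\<sigma>\<in>S. v \<in> \<sigma>} + card {\<sigma>\<in>orbit f (sem w). v \<in> \<sigma>}"
    unfolding un by (rule card_Un_disjoint) (use finS fo w(2) in auto)
  then have card: "card {\<sigma>\<in>?S. v \<in> \<sigma>} = card {\<sigma>\<in>S. v \<in> \<sigma>} + ?h" using cnew by simp
  have sub: "{\<sigma>\<in>?S. v \<in> \<sigma>} \<subseteq> star v" using S w(1) by blast
  have "card {\<sigma>\<in>?S. v \<in> \<sigma>} \<le> 10" using card_mono[OF _ sub] finite_F card_star[of v] by simp
  then show le: "?h \<le> p" using card t by simp
  have cov: "sem (cover v ?gs U) = \<Union>{\<sigma>\<in>?S. v \<in> \<sigma>}"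
  proof -
    have "\<Union>{sem g | g. g \<in> set ?gs \<and> mem v g} = \<Union>{\<sigma>\<in>orbit f (sem w). v \<in> \<sigma>}"
      unfolding new by auto
    then show ?thesis unfolding sem_cover un using t by auto
  qed
  show "\<exists>t'. update ?gs v p U = Some t' \<and> tracked ?S t'"
  proof (cases "?h = 0")
    case True
    then have "{\<sigma>\<in>orbit f (sem w). v \<in> \<sigma>} = {}" using cnew fo by simp
    then have "{\<sigma>\<in>?S. v \<in> \<sigma>} = {\<sigma>\<in>S. v \<in> \<sigma>}" unfolding un by blast
    then show ?thesis using t True update_eq[OF le] by simp
  next
    case False
    then have "{\<sigma>\<in>?S. v \<in> \<sigma>} \<noteq> {}" using card finS fo by (metis add_is_0 card.empty)
    then have "card {\<sigma>\<in>?S. v \<in> \<sigma>} + 5 \<le> card (sem (cover v ?gs U))"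
      unfolding cov using subset_cover[OF sub] by blast
    moreover have "card (sem (cover v ?gs U)) + card (- sem (cover v ?gs U)) = 15"
      by (rule card_compl_vertex)
    moreover have "card {\<sigma>\<in>S. v \<in> \<sigma>} + p = 10" using t by simp
    ultimately have "card (- sem (cover v ?gs U)) \<le> p - ?h" using card le by linarith
    then have "missing (cover v ?gs U) (Suc (p - ?h)) \<noteq> 0" by (simp add: missing_eq)
    then have "update ?gs v p U = Some (Track v (p - ?h) (cover v ?gs U))"
      using update_eq[OF le] False by simp
    moreover have "tracked ?S (Track v (p - ?h) (cover v ?gs U))" using card t le cov by simp
    ultimately show ?thesis by blast
  qed
qed

lemma tracked_update_all:
  assumes G: "rotational G" and S: "S \<subseteq> G" and w: "orbit f (sem w) \<subseteq> G" "orbit f (sem w) \<inter> S = {}"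
    "card (orbit f (sem w)) = 3"
  shows "\<forall>t\<in>set tr. tracked S t \<Longrightarrow> \<forall>t\<in>set acc. tracked (S \<union> orbit f (sem w)) t \<Longrightarrow>
    \<exists>tr'. update_all (orb3 rot w) tr acc = Some tr' \<and> (\<forall>t\<in>set tr'. tracked (S \<union> orbit f (sem w)) t)"
proof (induction tr arbitrary: acc)
  case Nil
  then show ?case by simp
next
  case (Cons t tr)
  obtain v p U where t: "t = Track v p U" by (cases t)
  then obtain t' where "update (orb3 rot w) v p U = Some t'" "tracked (S \<union> orbit f (sem w)) t'"
    using tracked_update(2)[OF G S w, of v p U] Cons.prems by auto
  then show ?case using t Cons.IH[of "t' # acc"] Cons.prems by simp
qed

lemma tracked_fits:
  assumes G: "rotational G" and S: "S \<subseteq> G" and w: "orbit f (sem w) \<subseteq> G" "orbit f (sem w) \<inter> S = {}"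
    "card (orbit f (sem w)) = 3" and b: "sem b \<subseteq> sem w"
  shows "\<forall>t\<in>set tr. tracked S t \<Longrightarrow> fits (orb3 rot b) tr"
proof (induction tr)
  case Nil
  then show ?case by simp
next
  case (Cons t tr)
  obtain v p U where t: "t = Track v p U" by (cases t)
  then have "hits v (orb3 rot w) \<le> p" using tracked_update(1)[OF G S w, of v p U] Cons.prems by auto
  moreover have "hits v (orb3 rot b) \<le> hits v (orb3 rot w)"
  proof -
    have "mem v b \<Longrightarrow> mem v w" "mem v (rot b) \<Longrightarrow> mem v (rot w)" "mem v (rot (rot b)) \<Longrightarrow> mem v (rot (rot w))"
      using b by (auto simp: mem_sem[symmetric] sem_rot)
    then show ?thesis by (simp add: orb3_def)
  qed
  ultimately show ?case using Cons t by (simp add: fits1_iff)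
qed

section \<open>The invariant of a search node and the exchange step\<close>

definition names :: "vertex list \<Rightarrow> vertex list list \<Rightarrow> bool" where
  "names av nw \<longleftrightarrow> f ` set av \<subseteq> set av \<and> set av \<union> set (concat nw) = UNIV \<and> set av \<inter> set (concat nw) = {}
     \<and> distinct (concat nw) \<and> (\<forall>vs\<in>set nw. \<exists>x. f x \<noteq> x \<and> vs = [x, f x, f (f x)])"

lemma names_step:
  assumes "names av ((x # xs) # nw)"
  shows "names (x # xs @ av) nw" "f x \<noteq> x" "x \<notin> set av" "xs = [f x, f (f x)]"
proof -
  show xs: "f x \<noteq> x" "xs = [f x, f (f x)]" using assms by (auto simp: names_def)
  show "x \<notin> set av" using assms by (auto simp: names_def)
  show "names (x # xs @ av) nw" using assms xs cubed unfolding names_def by auto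
qed

lemma names_moved:
  assumes "names av nw" "y \<notin> set av"
  shows "f y \<noteq> y" "nw \<noteq> []"
proof -
  have "y \<in> set (concat nw)" using assms by (auto simp: names_def)
  then show "nw \<noteq> []" by auto
  obtain vs where "vs \<in> set nw" "y \<in> set vs" using \<open>y \<in> set (concat nw)\<close> by auto
  then obtain x where "f x \<noteq> x" "y \<in> {x, f x, f (f x)}" using assms(1) by (fastforce simp: names_def)
  then show "f y \<noteq> y" using cubed by (metis insertE singletonD)
qed

text \<open>\<open>el\<close> lists the five vertices that \<open>u\<close> shares with its
  predecessor \<open>u'\<close>; this is the reason why \<open>y\<close> need not be exchanged
  next.\<close>

definition state_ok :: "vertex set set \<Rightarrow> vertex \<Rightarrow> vertex list \<Rightarrow> fcode \<Rightarrow> vertex list \<Rightarrow> vertex list list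
    \<Rightarrow> track list \<Rightarrow> fcode list \<Rightarrow> bool" where
  "state_ok G y el u av nw tr path \<longleftrightarrow> quotient_path G f (map sem path)
     \<and> (\<exists>u' rest. path = u # u' # rest \<and> set el \<subseteq> sem u') \<and> insert y (set el) = sem u \<and> distinct (y # el)
     \<and> names av nw \<and> \<Union>(sem ` set path) \<subseteq> set av \<and> (\<forall>t\<in>set tr. tracked (spread f (map sem path)) t)"

lemma quotient_pathD:
  assumes G: "rotational G" and q: "quotient_path G f (w # u # ws)"
  shows "spread f (u # ws) \<subseteq> G" "orbit f w \<subseteq> G" "orbit f w \<inter> spread f (u # ws) = {}" "card (orbit f w) = 3"
    "adjacent u w" "spread f (w # u # ws) = spread f (u # ws) \<union> orbit f w" "quotient_path G f (u # ws)" "w \<in> G" "u \<in> G"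
    "w \<notin> spread f (u # ws)"
proof -
  interpret rotation_family UNIV G f by (rule G)
  have s: "quotient_path G f (u # ws)" "w \<in> G" "w \<notin> spread f (u # ws)" "f ` w \<noteq> w" "adjacent u w"
    using q by (auto elim: quotient_path.cases)
  then show "quotient_path G f (u # ws)" "w \<in> G" "adjacent u w" "w \<notin> spread f (u # ws)" by blast+
  have F: "set (u # ws) \<subseteq> G" using quotient_path_F[OF s(1)] by blast
  then show "u \<in> G" by simp
  show "spread f (u # ws) \<subseteq> G" using spread_F[OF F] .
  show "orbit f w \<subseteq> G" using orb_F[OF s(2)] .
  show "orbit f w \<inter> spread f (u # ws) = {}"
    by (rule orb_disjoint[OF s(2) spread_F[OF F] spread_closed[OF F] s(3)])
  show "card (orbit f w) = 3" using orb_nonfixed(3)[OF s(2,4)] .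
  show "spread f (w # u # ws) = spread f (u # ws) \<union> orbit f w" unfolding spread_Cons[of w] by blast
qed

lemma advance:
  assumes G: "rotational G" and st: "state_ok G y el u av nw tr path"
    and q: "quotient_path G f (sem w # map sem path)" and w: "w = ins z (del x u)" and x: "x \<in> set el" and z: "z \<notin> sem u"
    and nm: "names av' nw'" "set av \<subseteq> set av'" "z \<in> set av'"
    and d: "descend k (update_all (orb3 rot w) tr []) z (y # remove_vertex x el) w av' nw' path"
  shows "\<exists>tr'. state_ok G z (y # remove_vertex x el) w av' nw' tr' (w # path)
    \<and> k (y # remove_vertex x el) z (y # remove_vertex x el) w av' nw' tr' (w # path)"
proof -
  obtain u' rest where p: "path = u # u' # rest" "set el \<subseteq> sem u'" using st by (auto simp: state_ok_def)
  note qd = quotient_pathD[OF G q[unfolded p(1) list.map]]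
  have tr: "\<forall>t\<in>set tr. tracked (spread f (map sem path)) t" using st by (simp add: state_ok_def)
  obtain tr' where tr': "update_all (orb3 rot w) tr [] = Some tr'"
    "\<forall>t\<in>set tr'. tracked (spread f (map sem path) \<union> orbit f (sem w)) t"
    using tracked_update_all[OF G qd(1-4), of tr "[]"] tr p(1) by auto
  have semw: "sem w = insert z (sem u - {x})" using w by (simp add: sem_ins sem_del)
  have el: "insert y (set el) = sem u" "distinct (y # el)" using st by (simp_all add: state_ok_def)
  have "set (y # remove_vertex x el) = sem u - {x}" using el x by (auto simp: remove_vertex_eq)
  moreover have "distinct (z # y # remove_vertex x el)"
    using el z by (auto simp: remove_vertex_eq dest: notin_set_remove1)
  moreover have "spread f (map sem (w # path)) = spread f (map sem path) \<union> orbit f (sem w)"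
    using qd(6) p(1) by simp
  moreover have "sem w \<subseteq> set av'" using semw st nm(2,3) p(1) by (auto simp: state_ok_def)
  moreover have "\<Union>(sem ` set path) \<subseteq> set av'" using st nm(2) by (auto simp: state_ok_def)
  ultimately have "state_ok G z (y # remove_vertex x el) w av' nw' tr' (w # path)"
    unfolding state_ok_def using q semw nm(1) tr'(2) p(1) by auto
  moreover have "k (y # remove_vertex x el) z (y # remove_vertex x el) w av' nw' tr' (w # path)"
    using d tr'(1) by simp
  ultimately show ?thesis by blast
qed

text \<open>The facets of the path use only names in \<open>av\<close>, so the permutation changes
  the family but neither the path nor the counters, which depend on the path alone.\<close>

lemma state_ok_image:
  assumes st: "state_ok G y el u av nw tr path" and \<pi>: "normalises \<pi>" and fix_av: "\<And>v. v \<in> set av \<Longrightarrow> \<pi> v = v"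
  shows "state_ok ((`) \<pi> ` G) y el u av nw tr path" "map ((`) \<pi>) (map sem path) = map sem path"
proof -
  have id: "\<pi> ` \<sigma> = \<sigma>" if "\<sigma> \<subseteq> set av" for \<sigma>
    using that fix_av by (force simp: image_iff)
  have "\<pi> ` sem c = sem c" if "c \<in> set path" for c
    by (rule id) (use st that in \<open>auto simp: state_ok_def\<close>)
  then show m: "map ((`) \<pi>) (map sem path) = map sem path" by simp
  have "quotient_path G f (map sem path)" using st by (simp add: state_ok_def)
  then have "quotient_path ((`) \<pi> ` G) f (map sem path)" using quotient_path_image[OF \<pi>] m by metis
  then show "state_ok ((`) \<pi> ` G) y el u av nw tr path" using st by (simp add: state_ok_def)
qed

lemma normalises_id: "normalises (\<lambda>v. v)"
  by (simp add: normalises_def bij_def inj_on_def surj_def)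

lemma normalises_relab: "f x \<noteq> x \<Longrightarrow> f y \<noteq> y \<Longrightarrow> normalises (relab f x y)"
  unfolding normalises_def using relab(2,3)[OF cubed, of x y] by blast

lemma names_closed: "names av nw \<Longrightarrow> v \<notin> set av \<Longrightarrow> f v \<notin> set av \<and> f (f v) \<notin> set av"
  unfolding names_def using cubed by (metis image_subset_iff)

text \<open>The family is relabelled so that the name chosen by the search becomes correct: by the
  identity if \<open>z\<close> has a name in use, otherwise by the permutation that moves
  \<open>z\<close> to the next fresh name \<open>a\<close> and keeps all names in use.\<close>

lemma step:
  assumes r: "remove_each k rot xs y el u av nw tr path" and G: "rotational G"
    and st: "state_ok G y el u av nw tr path" and q: "quotient_path G f (W # map sem path)"
    and x: "x \<in> set xs" "x \<in> set el" and z: "z \<notin> sem u" and W: "W = insert z (sem u - {x})"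
  shows "\<exists>\<pi> y' el' u' av' nw' tr'. normalises \<pi> \<and> state_ok ((`) \<pi> ` G) y' el' u' av' nw' tr' (u' # path)
    \<and> k el' y' el' u' av' nw' tr' (u' # path)"
proof -
  obtain u0 rest where p: "path = u # u0 # rest" using st by (auto simp: state_ok_def)
  have tr: "\<forall>t\<in>set tr. tracked (spread f (map sem path)) t" and nm: "names av nw"
    and uav: "sem u \<subseteq> set av" using st p by (auto simp: state_ok_def)
  let ?b = "del x u" and ?el = "y # remove_vertex x el"
  have semb: "sem ?b = sem u - {x}" by (simp add: sem_del)
  have Wz: "sem (ins z ?b) = W" using W by (simp add: sem_ins semb)
  note qd = quotient_pathD[OF G q[unfolded p list.map]]
  have "fits (orb3 rot ?b) tr"
    by (rule tracked_fits[OF G, of "spread f (map sem path)" "ins z ?b"])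
      (use qd(1-4) Wz tr semb W p in auto)
  then have ie: "insert_each k rot av u ?el ?b av nw tr path" using remove_eachD[OF r x(1)] by blast
  show ?thesis
  proof (cases "z \<in> set av")
    case True
    have "descend k (update_all (orb3 rot (ins z ?b)) tr []) z ?el (ins z ?b) av nw path"
      using insert_each_old[OF ie True] z by (simp add: mem_sem)
    then obtain tr' where "state_ok G z ?el (ins z ?b) av nw tr' (ins z ?b # path)"
      "k ?el z ?el (ins z ?b) av nw tr' (ins z ?b # path)"
      using advance[OF G st _ refl x(2) z nm subset_refl True] q Wz by metis
    moreover have "(`) (\<lambda>v. v) ` G = G" by simp
    ultimately show ?thesis using normalises_id by metis
  next
    case False
    note zm = names_moved[OF nm False]
    obtain vs nw' where "nw = vs # nw'" using zm(2) by (cases nw) auto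
    moreover obtain a as where "vs = a # as" using nm \<open>nw = vs # nw'\<close> by (auto simp: names_def)
    ultimately have nw: "nw = (a # as) # nw'" by simp
    note ns = names_step[OF nm[unfolded nw]]
    define \<pi> where "\<pi> = relab f a z"
    have \<pi>: "normalises \<pi>" unfolding \<pi>_def by (rule normalises_relab[OF ns(2) zm(1)])
    have fix_av: "\<pi> v = v" if "v \<in> set av" for v
      unfolding \<pi>_def
      by (rule relab(4)[OF cubed ns(2) zm(1)])
        (use names_closed[OF nm ns(3)] names_closed[OF nm False] ns(3) False that in auto)
    note im = state_ok_image[OF st \<pi> fix_av]
    have G': "rotational ((`) \<pi> ` G)" by (rule rotational_image[OF G \<pi>])
    have "\<pi> ` (sem u - {x}) = sem u - {x}" using fix_av uav by (force simp: image_iff)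
    moreover have "\<pi> z = a" unfolding \<pi>_def by (rule relab(1)[OF cubed ns(2) zm(1)])
    ultimately have "\<pi> ` W = sem (ins a ?b)" unfolding W by (simp add: sem_ins semb)
    then have "map ((`) \<pi>) (W # map sem path) = sem (ins a ?b) # map sem path"
      using im(2) by (simp only: list.map)
    then have q': "quotient_path ((`) \<pi> ` G) f (sem (ins a ?b) # map sem path)"
      using quotient_path_image[OF \<pi> q] by metis
    have a: "a \<notin> sem u" using ns(3) uav by blast
    have "descend k (update_all (orb3 rot (ins a ?b)) tr []) a ?el (ins a ?b) (a # as @ av) nw' path"
      using insert_each_new[OF ie] nw by simp
    then obtain tr' where "state_ok ((`) \<pi> ` G) a ?el (ins a ?b) (a # as @ av) nw' tr' (ins a ?b # path)"
      "k ?el a ?el (ins a ?b) (a # as @ av) nw' tr' (ins a ?b # path)"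
      using advance[OF G' im(1) q' refl x(2) a ns(1)] by auto
    then show ?thesis using \<pi> by metis
  qed
qed

text \<open>Removing \<open>y\<close> would leave the ridge \<open>el\<close>, which already lies in
  \<open>u\<close> and its predecessor; no third facet contains it.\<close>

lemma exchange:
  assumes G: "rotational G" and st: "state_ok G y el u av nw tr path" and q: "quotient_path G f (W # map sem path)"
  obtains x z where "x \<in> set el" "z \<notin> sem u" "W = insert z (sem u - {x})"
proof -
  interpret rotation_family UNIV G f by (rule G)
  obtain u0 rest where p: "path = u # u0 # rest" and el0: "set el \<subseteq> sem u0" using st by (auto simp: state_ok_def)
  have el: "insert y (set el) = sem u" "y \<notin> set el" using st by (simp_all add: state_ok_def)
  note qd = quotient_pathD[OF G q[unfolded p list.map]]
  note qd' = quotient_pathD[OF G qd(7)]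
  obtain x z where xz: "x \<in> sem u" "z \<notin> sem u" "x \<notin> W" "W = insert z (sem u - {x})"
    using adjacent_exchange[OF card_F_mem[OF qd(9)] card_F_mem[OF qd(8)] qd(5)] by metis
  have "x \<noteq> y"
  proof
    assume "x = y"
    then have "sem u - {x} = set el" using el by blast
    then have "set el \<subseteq> W" using xz by blast
    moreover have "card (set el) = 5"
      using card_F_mem[OF qd(9)] fin_mem[OF qd(9)] xz(1) \<open>sem u - {x} = set el\<close>[symmetric] by simp
    moreover have "set el \<subseteq> sem u" using el by blast
    moreover have "sem u \<noteq> sem u0" using adjacent_neq[OF card_F_mem[OF qd'(9)] qd'(5)] by metis
    ultimately have "W = sem u \<or> W = sem u0"
      using ridge_third[of "set el" "sem u" "sem u0" W] qd(8,9) qd'(9) el0 by blast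
    moreover have "sem u \<in> spread f (map sem path)" "sem u0 \<in> spread f (map sem path)"
      using p by (auto simp: spread_def orbit_def)
    ultimately show False using qd(10) p by auto
  qed
  then have "x \<in> set el" using xz(1) el(1) by blast
  then show ?thesis using that xz by blast
qed

text \<open>Each level may relabel the family anew, and the permutations are composed.\<close>

lemma search_sound:
  "search leaf rot n el y el u av nw tr path \<Longrightarrow> rotational G \<Longrightarrow> state_ok G y el u av nw tr path
    \<Longrightarrow> length path + n = 9 \<Longrightarrow> \<exists>\<pi> path'. normalises \<pi> \<and> quotient_path ((`) \<pi> ` G) f (map sem path')
      \<and> length path' = 9 \<and> leaf path'"
proof (induction n arbitrary: G y el u av nw tr path)
  case 0
  have "(`) (\<lambda>v. v) ` G = G" by simp
  then show ?case using 0 normalises_id unfolding state_ok_def by (metis add.right_neutral search.simps(1))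
next
  case (Suc n)
  interpret rotation_family UNIV G f by (rule Suc.prems)
  obtain u0 rest where p: "path = u # u0 # rest" using Suc.prems(3) by (auto simp: state_ok_def)
  have "quotient_path G f (map sem path)" using Suc.prems(3) by (simp add: state_ok_def)
  then obtain W where W: "quotient_path G f (W # map sem path)"
    using quotient_path_extend[of "sem u" "map sem (u0 # rest)"] Suc.prems(4) p by auto
  obtain x z where xz: "x \<in> set el" "z \<notin> sem u" "W = insert z (sem u - {x})"
    using exchange[OF Suc.prems(2,3) W] by metis
  have "remove_each (search leaf rot n) rot el y el u av nw tr path" using Suc.prems(1) by simp
  from step[OF this Suc.prems(2,3) W xz(1,1,2,3)]
  obtain \<pi> y' el' u' av' nw' tr' where \<pi>: "normalises \<pi>"
    and st: "state_ok ((`) \<pi> ` G) y' el' u' av' nw' tr' (u' # path)"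
    and s: "search leaf rot n el' y' el' u' av' nw' tr' (u' # path)" by blast
  have "length (u' # path) + n = 9" using Suc.prems(4) by simp
  from Suc.IH[OF s rotational_image[OF Suc.prems(2) \<pi>] st this]
  obtain \<pi>' path' where \<pi>': "normalises \<pi>'" "quotient_path ((`) \<pi>' ` (`) \<pi> ` G) f (map sem path')"
    "length path' = 9" "leaf path'" by blast
  have "normalises (\<pi>' \<circ> \<pi>)" using \<pi> \<pi>'(1) unfolding normalises_def by (auto simp: bij_comp cubed)
  moreover have "(`) \<pi>' ` (`) \<pi> ` G = (`) (\<pi>' \<circ> \<pi>) ` G" by (simp add: image_image image_comp)
  ultimately show ?case using \<pi>' by metis
qed

end

section \<open>Soundness of the leaves\<close>

lemma length_family: "path \<noteq> [] \<Longrightarrow> length (family rot path) + 2 = 3 * length path"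
  by (induction rot path rule: family.induct) (auto simp: orb3_def)

lemma sparse_pair_iff:
  "sparse_pair u v gs k U \<longleftrightarrow> k \<le> length (filter (\<lambda>g. mem u g \<and> mem v g) gs)
     + card (- (sem U \<union> \<Union>{sem g | g. g \<in> set gs \<and> mem u g \<and> mem v g}))"
proof (induction u v gs k U rule: sparse_pair.induct)
  case (1 u v k U)
  then show ?case by (simp add: is_zero_iff missing_eq)
next
  case (2 u v g gs U)
  then show ?case by simp
next
  case (3 u v g gs k U)
  have "{sem h | h. h \<in> set (g # gs) \<and> mem u h \<and> mem v h} =
    (if mem u g \<and> mem v g then {sem g} else {}) \<union> {sem h | h. h \<in> set gs \<and> mem u h \<and> mem v h}" by auto
  then show ?case using 3 by (simp add: sem_orf Un_assoc)
qed

lemma count_adjacent_eq: "count_adjacent c ds k = k + length (filter (\<lambda>d. adjacent (sem c) (sem d)) ds)"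
  by (induction c ds k rule: count_adjacent.induct) (simp_all add: eq5_iff common_eq adjacent_def)

lemma edges_insert:
  assumes "six_sets (insert \<sigma> S)"
  shows "edges (insert \<sigma> S) = edges S \<union> (\<lambda>\<rho>. {\<sigma>, \<rho>}) ` {\<rho>\<in>S. adjacent \<sigma> \<rho>}"
proof
  show "edges (insert \<sigma> S) \<subseteq> edges S \<union> (\<lambda>\<rho>. {\<sigma>, \<rho>}) ` {\<rho>\<in>S. adjacent \<sigma> \<rho>}"
  proof
    fix e assume "e \<in> edges (insert \<sigma> S)"
    then obtain \<alpha> \<beta> where e: "e = {\<alpha>, \<beta>}" "\<alpha> \<in> insert \<sigma> S" "\<beta> \<in> insert \<sigma> S" "adjacent \<alpha> \<beta>"
      unfolding edges_def by blast
    have ne: "\<alpha> \<noteq> \<beta>" using adjacent_neq six_setsD[OF assms e(2)] e(4) by metis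
    show "e \<in> edges S \<union> (\<lambda>\<rho>. {\<sigma>, \<rho>}) ` {\<rho>\<in>S. adjacent \<sigma> \<rho>}"
    proof (cases "\<alpha> = \<sigma>")
      case True
      then have "\<beta> \<in> {\<rho>\<in>S. adjacent \<sigma> \<rho>}" using e ne by simp
      then show ?thesis using True e(1) by simp
    next
      case a: False
      show ?thesis
      proof (cases "\<beta> = \<sigma>")
        case True
        then have "\<alpha> \<in> {\<rho>\<in>S. adjacent \<sigma> \<rho>}" using a e(2,4) True adjacent_sym[of \<alpha> \<sigma>] by blast
        moreover have "e = {\<sigma>, \<alpha>}" using True e(1) by (simp add: insert_commute)
        ultimately show ?thesis by simp
      next
        case False
        then have "e \<in> edges S" using a e edgesI by simp
        then show ?thesis by simp
      qed
    qed
  qed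
  show "edges S \<union> (\<lambda>\<rho>. {\<sigma>, \<rho>}) ` {\<rho>\<in>S. adjacent \<sigma> \<rho>} \<subseteq> edges (insert \<sigma> S)"
    using edges_mono[of S "insert \<sigma> S"] by (auto intro!: edgesI)
qed

lemma count_edges_eq:
  "distinct (map sem cs) \<Longrightarrow> six_sets (sem ` set cs) \<Longrightarrow> count_edges cs k = k + card (edges (sem ` set cs))"
proof (induction cs arbitrary: k)
  case Nil
  then show ?case by (simp add: edges_def)
next
  case (Cons c cs)
  let ?S = "sem ` set cs" and ?A = "{\<rho>\<in>sem ` set cs. adjacent (sem c) \<rho>}"
  have six: "six_sets (insert (sem c) ?S)" "six_sets ?S" using Cons.prems(2) by (simp_all add: six_sets_insert)
  have c: "sem c \<notin> ?S" using Cons.prems(1) by auto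
  have fin: "finite (edges ?S)" "finite ?A" by (simp_all add: finite_edges)
  have "inj_on (\<lambda>\<rho>. {sem c, \<rho>}) ?A" by (rule inj_onI) (metis doubleton_eq_iff)
  then have 1: "card ((\<lambda>\<rho>. {sem c, \<rho>}) ` ?A) = card ?A" by (rule card_image)
  have "edges ?S \<inter> (\<lambda>\<rho>. {sem c, \<rho>}) ` ?A = {}" using edges_subset[of _ ?S] c by blast
  then have 2: "card (edges (insert (sem c) ?S)) = card (edges ?S) + card ?A"
    unfolding edges_insert[OF six(1)] using fin 1 by (simp add: card_Un_disjoint)
  have "?A = set (filter (adjacent (sem c)) (map sem cs))" by auto
  then have "card ?A = length (filter (adjacent (sem c)) (map sem cs))"
    using Cons.prems(1) by (simp only: distinct_card distinct_filter distinct.simps list.map)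
  then have 3: "card ?A = length (filter (\<lambda>d. adjacent (sem c) (sem d)) cs)"
    by (simp add: filter_map o_def)
  have "count_edges (c # cs) k = k + card ?A + card (edges ?S)"
    using Cons.IH[OF _ six(2)] Cons.prems(1) 3 by (simp add: count_adjacent_eq)
  then show ?case using 2 by simp
qed

lemma drop_to_eq: "drop_to k n = k - n"
  by (induction k n rule: drop_to.induct) simp_all

lemma isolated_from_iff: "isolated_from c ds \<longleftrightarrow> (\<forall>d\<in>set ds. \<not> adjacent (sem c) (sem d))"
  by (induction c ds rule: isolated_from.induct) (auto simp: eq5_iff common_eq adjacent_def)

context search_setting
begin

lemma family_spread:
  assumes G: "rotational G"
  shows "quotient_path G f (map sem path) \<Longrightarrow> sem ` set (family rot path) = spread f (map sem path)"
proof (induction path rule: induct_list012)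
  case 1
  then show ?case by (simp add: spread_def)
next
  case (2 z)
  then have "f ` sem z = sem z" by (auto elim: quotient_path.cases)
  then show ?case by (simp add: spread_def orbit_def)
next
  case (3 w u ws)
  note qd = quotient_pathD[OF G 3(3)[unfolded list.map]]
  have "sem ` set (family rot (u # ws)) = spread f (map sem (u # ws))" using 3(2) qd(7) by simp
  then show ?case using sem_orb3(1)[of w] qd(6) by (simp add: image_Un Un_commute)
qed

text \<open>Nine entries yield 1 + 8 * 3 = 25 facets, so a leaf encodes the whole family, without
  repetition.\<close>

lemma complete_path:
  assumes G: "rotational G" and q: "quotient_path G f (map sem path)" and len: "length path = 9"
  shows "sem ` set (family rot path) = G" "distinct (map sem (family rot path))" "card G = 25"
proof -
  interpret rotation_family UNIV G f by (rule G)
  have F: "set (map sem path) \<subseteq> G" using quotient_path_F[OF q] by blast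
  have "card (spread f (map sem path)) = 25" using quotient_path_card[OF q] len by simp
  then have "spread f (map sem path) = G"
    using card_subset_eq[OF finite_F spread_F[OF F]] card_F by simp
  then show *: "sem ` set (family rot path) = G" using family_spread[OF G q] by simp
  show "card G = 25" by (rule card_F)
  have "path \<noteq> []" using len by auto
  then have "length (family rot path) + 2 = 27" using length_family[of path rot] len by simp
  then show "distinct (map sem (family rot path))"
    by (intro card_distinct) (simp add: * card_F)
qed

lemma not_dead_end:
  assumes G: "rotational G" and q: "quotient_path G f (map sem path)" and len: "length path = 9"
  shows "\<not> dead_end rot path"
proof
  assume d: "dead_end rot path"
  interpret rotation_family UNIV G f by (rule G)
  obtain w u v ws where p: "path = w # u # v # ws" using len by (auto simp: numeral_eq_Suc length_Suc_conv)
  note q1 = quotient_pathD[OF G q[unfolded p list.map]]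
  note q2 = quotient_pathD[OF G q1(7)]
  obtain \<rho> \<mu> where r: "\<rho> \<in> G" "\<mu> \<in> G" "adjacent (sem w) \<rho>" "adjacent (sem w) \<mu>" "\<rho> \<noteq> \<mu>"
    using two_neighbours[OF q1(8)] by metis
  have *: "\<rho> = sem u" if r: "\<rho> \<in> G" "adjacent (sem w) \<rho>" for \<rho>
  proof (rule ccontr)
    assume ne: "\<rho> \<noteq> sem u"
    have "\<rho> \<noteq> sem w" using adjacent_neq[OF card_F_mem[OF q1(8)] r(2)] by blast
    moreover have "\<rho> \<in> spread f (map sem path)"
      using r(1) complete_path(1)[OF G q len] family_spread[OF G q] by simp
    then have "\<rho> \<in> orbit f (sem w) \<union> orbit f (sem u) \<union> spread f (map sem (v # ws))"
      using q1(6) q2(6) p by auto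
    moreover have "spread f (map sem (v # ws)) = sem ` set (family rot (v # ws))"
      using family_spread[OF G, of "v # ws"] q2(7) by simp
    ultimately have "\<rho> \<in> sem ` set (rot w # rot (rot w) # rot u # rot (rot u) # family rot (v # ws))"
      using ne by (auto simp: orbit_def sem_rot)
    then show False using d r(2) unfolding p by (auto simp: isolated_from_iff)
  qed
  show False using *[OF r(1,3)] *[OF r(2,4)] r(5) by simp
qed

lemma not_sparse_pair:
  assumes G: "rotational G" and q: "quotient_path G f (map sem path)" and len: "length path = 9"
  shows "\<not> sparse_pair u v (family rot path) 11 empty_code"
proof
  let ?cs = "family rot path"
  assume "sparse_pair u v ?cs 11 empty_code"
  interpret rotation_family UNIV G f by (rule G)
  note cp = complete_path[OF G q len]
  let ?L = "filter (\<lambda>g. mem u g \<and> mem v g) ?cs" and ?W = "{\<sigma>\<in>star u. v \<in> \<sigma>}"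
  have W: "?W = sem ` set ?L" unfolding cp(1)[symmetric] by (auto simp: mem_sem)
  have "distinct (map sem ?L)" using cp(2) by (rule distinct_map_filter)
  then have cW: "card ?W = length ?L" unfolding W using distinct_card by fastforce
  have U: "\<Union>{sem g | g. g \<in> set ?cs \<and> mem u g \<and> mem v g} = \<Union>?W" unfolding W by auto
  have "11 \<le> length ?L + card (- \<Union>?W)"
    using \<open>sparse_pair u v ?cs 11 empty_code\<close> unfolding sparse_pair_iff U sem_empty by simp
  moreover have "?W \<noteq> {}" using Union_star[of u] by blast
  then have "card ?W + 5 \<le> card (\<Union>?W)" by (intro subset_cover[of _ u]) auto
  moreover have "card (\<Union>?W) + card (- \<Union>?W) = 15"
    by (rule card_compl_vertex)
  ultimately show False using cW by linarith
qed

lemma count_edges_path: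
  assumes G: "rotational G" and q: "quotient_path G f (map sem path)" and len: "length path = 9"
  shows "count_edges (family rot path) 0 = 27"
proof -
  interpret rotation_family UNIV G f by (rule G)
  note cp = complete_path[OF G q len]
  show ?thesis using count_edges_eq[OF cp(2)] cp(1) six_F card_edges by simp
qed

end

section \<open>Recognition of the models\<close>

fun apply_perm :: "perm \<Rightarrow> vertex \<Rightarrow> vertex" where
  "apply_perm (Perm v0 v1 v2 v3 v4 v5 v6 v7 v8 v9 v10 v11 v12 v13 v14) x =
    (case x of a1 \<Rightarrow> v0 | b1 \<Rightarrow> v1 | c1 \<Rightarrow> v2 | a2 \<Rightarrow> v3 | b2 \<Rightarrow> v4 | c2 \<Rightarrow> v5 | a3 \<Rightarrow> v6 | b3 \<Rightarrow> v7 | c3 \<Rightarrow> v8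
     | a4 \<Rightarrow> v9 | b4 \<Rightarrow> v10 | c4 \<Rightarrow> v11 | a5 \<Rightarrow> v12 | b5 \<Rightarrow> v13 | c5 \<Rightarrow> v14)"

fun perm_images :: "perm \<Rightarrow> vertex list" where
  "perm_images (Perm v0 v1 v2 v3 v4 v5 v6 v7 v8 v9 v10 v11 v12 v13 v14) =
    [v0, v1, v2, v3, v4, v5, v6, v7, v8, v9, v10, v11, v12, v13, v14]"

lemma ex_vertex: "(\<exists>v. P v) \<longleftrightarrow> P a1 \<or> P b1 \<or> P c1 \<or> P a2 \<or> P b2 \<or> P c2 \<or> P a3 \<or> P b3 \<or> P c3
  \<or> P a4 \<or> P b4 \<or> P c4 \<or> P a5 \<or> P b5 \<or> P c5"
proof -
  have "(\<exists>v. P v) \<longleftrightarrow> (\<exists>v\<in>UNIV. P v)" by simp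
  then show ?thesis unfolding UNIV_vertex by simp
qed

lemma sem_map_code: "sem (map_code c p) = apply_perm p ` sem c"
proof -
  have put: "w \<in> sem (put b v d) \<longleftrightarrow> b \<and> w = v \<or> w \<in> sem d" for w b v d
    by (cases b) (simp_all add: sem_ins)
  have "w \<in> sem (map_code c p) \<longleftrightarrow> (\<exists>v. mem v c \<and> w = apply_perm p v)" for w
    unfolding ex_vertex by (cases c; cases p) (simp only: map_code.simps put sem_empty apply_perm.simps mem.simps vertex.case empty_iff simp_thms)
  then show ?thesis by (auto simp: sem_def)
qed

lemma bij_apply_perm: "distinct (perm_images p) \<Longrightarrow> bij (apply_perm p)"
proof -
  assume d: "distinct (perm_images p)"
  have "set (perm_images p) = range (apply_perm p)"
    by (cases p) (simp add: UNIV_vertex insert_commute)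
  moreover have "length (perm_images p) = 15" by (cases p) simp
  ultimately have "card (range (apply_perm p)) = 15" using distinct_card[OF d] by simp
  moreover have "card (UNIV :: vertex set) = 15" by (simp add: UNIV_vertex)
  ultimately have "surj (apply_perm p)" using card_subset_eq[OF finite_vertex, of "range (apply_perm p)"] by simp
  then show ?thesis using finite_UNIV_surj_inj[OF finite_vertex] by (simp add: bij_def)
qed

lemma N_facets_orbit: "N_facets i = insert z_facet (\<Union>(orbit \<phi> ` set (u_table ! (i - 1))))"
  by (simp add: N_facets_def orbit_def)

lemma family_encs:
  "vss \<noteq> [] \<Longrightarrow> sem ` set (family rotA (encs vss)) = insert (set (last vss)) (\<Union>(orbit \<phi> ` set ` set (butlast vss)))"
proof (induction vss rule: induct_list012)
  case (3 vs us vss)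
  then show ?case by (simp add: sem_enc orb3_def orbit_def sem_rotA insert_commute Un_commute image_Un)
qed (simp_all add: sem_enc)

text \<open>Ties the encoded models to the lists that define the complexes.\<close>

lemma models_ok:
  "\<forall>m\<in>set models. case m of Model i vss ps \<Rightarrow> i \<in> {1..12} \<and> (\<forall>p\<in>set ps. distinct (perm_images p))
     \<and> vss \<noteq> [] \<and> map set (rev (butlast vss)) = u_table ! (i - 1) \<and> set (last vss) = z_facet"
  by (simp add: models_def u_table_def z_facet_def)

lemma listed_iff: "listed c cs \<longleftrightarrow> c \<in> set cs"
  by (induction cs) (simp_all add: eqf_iff)

lemma maps_into_iff: "maps_into cs fs p \<longleftrightarrow> (\<forall>c\<in>set cs. map_code c p \<in> set fs)"
  by (induction cs) (simp_all add: listed_iff)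

lemma some_perm_iff: "some_perm cs fs ps \<longleftrightarrow> (\<exists>p\<in>set ps. maps_into cs fs p)"
  by (induction ps) simp_all

lemma some_modelD:
  "some_model cs ms \<Longrightarrow> \<exists>i vss ps. Model i vss ps \<in> set ms \<and> some_perm cs (family rotA (encs vss)) ps"
  by (induction cs ms rule: some_model.induct) (auto split: if_splits)

text \<open>An upper bound is enough: 25 distinct images inside \<open>N_facets i\<close> exhaust
  it.\<close>

lemma card_N_facets: "i \<in> {1..12} \<Longrightarrow> finite (N_facets i) \<and> card (N_facets i) \<le> 25"
proof -
  assume i: "i \<in> {1..12}"
  then have "i - 1 < 12" by auto
  moreover have "\<forall>us\<in>set u_table. length us = 8" "length u_table = 12" by (simp_all add: u_table_def)
  ultimately have len: "length (u_table ! (i - 1)) = 8" by (metis nth_mem)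
  have "card (orbit \<phi> u) \<le> 3" for u unfolding orbit_def by (simp add: card_insert_if)
  then have "card (\<Union>(orbit \<phi> ` set (u_table ! (i - 1)))) \<le> (\<Sum>u\<in>set (u_table ! (i - 1)). 3)"
    by (intro order_trans[OF card_UN_le] sum_mono) simp_all
  also have "\<dots> \<le> 24" using card_length[of "u_table ! (i - 1)"] len by simp
  finally have "card (N_facets i) \<le> 25" unfolding N_facets_orbit by (simp add: card_insert_if orbit_def)
  then show ?thesis unfolding N_facets_orbit by (simp add: orbit_def)
qed

global_interpretation free: search_setting \<phi> rotA
proof unfold_locales
  show "\<exists>v. \<phi> v \<noteq> v" using phi_neq by blast
qed (simp_all add: phi_cubed sem_rotA)

global_interpretation fixing: search_setting \<psi> rotB
proof unfold_locales
  show "\<exists>v. \<psi> v \<noteq> v" by (rule exI[of _ a2]) (simp add: \<psi>_def)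
qed (simp_all add: psi_cubed sem_rotB)

text \<open>A dead end, a sparse pair and more than 27 edges are impossible in an actual family.
  Hence a leaf that passes the test has been recognised as a model; the permutation maps the facets
  into it and, by cardinality, onto it.\<close>

lemma leaf_sound:
  assumes G: "free.rotational G" and q: "quotient_path G \<phi> (map sem path)" and len: "length path = 9"
    and leaf: "leafA path"
  shows "\<exists>i\<in>{1..12}. \<exists>\<pi>. bij \<pi> \<and> (`) \<pi> ` G = N_facets i"
proof -
  let ?cs = "family rotA path"
  have "some_model ?cs models"
    using leaf free.not_dead_end[OF G q len] free.not_sparse_pair[OF G q len] free.count_edges_path[OF G q len]
    by (simp add: leafA_def leaf_family_def drop_to_eq is_zero_iff split: if_splits)
  then obtain i vss ps where m: "Model i vss ps \<in> set models" "some_perm ?cs (family rotA (encs vss)) ps"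
    using some_modelD by blast
  then obtain p where p: "p \<in> set ps" "\<forall>c\<in>set ?cs. map_code c p \<in> set (family rotA (encs vss))"
    by (auto simp: some_perm_iff maps_into_iff)
  have ok: "i \<in> {1..12}" "distinct (perm_images p)" "vss \<noteq> []" "map set (rev (butlast vss)) = u_table ! (i - 1)"
    "set (last vss) = z_facet" using bspec[OF models_ok m(1)] p(1) by simp_all
  have bij: "bij (apply_perm p)" by (rule bij_apply_perm[OF ok(2)])
  have "set (u_table ! (i - 1)) = set ` set (butlast vss)" unfolding ok(4)[symmetric] by simp
  then have N: "sem ` set (family rotA (encs vss)) = N_facets i"
    unfolding family_encs[OF ok(3)] N_facets_orbit ok(5) by simp
  have "(`) (apply_perm p) ` G \<subseteq> N_facets i"
  proof
    fix \<sigma> assume "\<sigma> \<in> (`) (apply_perm p) ` G"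
    then obtain c where "c \<in> set ?cs" "\<sigma> = apply_perm p ` sem c"
      using free.complete_path(1)[OF G q len] by auto
    then have "map_code c p \<in> set (family rotA (encs vss))" "\<sigma> = sem (map_code c p)"
      using p(2) by (simp_all add: sem_map_code)
    then show "\<sigma> \<in> N_facets i" using N by blast
  qed
  moreover have "card ((`) (apply_perm p) ` G) = 25"
    using bij free.complete_path(3)[OF G q len] by (subst card_image) (auto simp: bij_def inj_on_def inj_image_eq_iff)
  ultimately have "(`) (apply_perm p) ` G = N_facets i"
    using card_N_facets[OF ok(1)] by (intro card_seteq) auto
  then show ?thesis using ok(1) bij by blast
qed

section \<open>Free symmetries and symmetries with fixed points\<close>

definition z0 :: fcode where
  "z0 = enc [a1, b1, c1, a2, b2, c2]"

definition u1 :: fcode where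
  "u1 = enc [a1, b1, c1, a2, b2, a3]"

text \<open>The state after the orbits of \<open>z0\<close> and \<open>u1\<close>. By symmetry one
  vertex per orbit suffices. For instance \<open>a1\<close> lies in \<open>z0\<close> and in all
  three images of \<open>u1\<close>, which leaves 10 - 4 = 6.\<close>

definition counters_free :: "track list" where
  "counters_free = [Track a1 6 (enc [a1, b1, c1, a2, b2, c2, a3, b3, c3]),
   Track a2 7 (enc [a1, b1, c1, a2, b2, c2, a3, c3]),
   Track a3 9 (enc [a1, b1, c1, a2, b2, a3]),
   Track a4 10 (enc []),
   Track a5 10 (enc [])]"

text \<open>Each of the fixed vertices \<open>a1\<close>, \<open>b1\<close>, \<open>c1\<close> is an
  orbit by itself and gets its own counter.\<close>

definition counters_fixing :: "track list" where
  "counters_fixing = [Track a1 6 (enc [a1, b1, c1, a2, b2, c2, a3, b3, c3]),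
   Track b1 6 (enc [a1, b1, c1, a2, b2, c2, a3, b3, c3]),
   Track c1 6 (enc [a1, b1, c1, a2, b2, c2, a3, b3, c3]),
   Track a2 7 (enc [a1, b1, c1, a2, b2, c2, a3, c3]),
   Track a3 9 (enc [a1, b1, c1, a2, b2, a3]),
   Track a4 10 (enc []),
   Track a5 10 (enc [])]"

text \<open>Two facets are to be completed to nine, hence depth 7. Only \<open>a1\<close> may be
  removed first here, and only \<open>a2\<close> in the companion; the other first exchanges reduce
  to these by relabelling.\<close>

lemma search_a1: "search leafA rotA 7 [a1] a3 [a1, b1, c1, a2, b2] u1
  [a1, b1, c1, a2, b2, c2, a3, b3, c3] [[a4, b4, c4], [a5, b5, c5]] counters_free [u1, z0]"
  \<comment> \<open>\<open>if_weak_cong\<close> leaves both branches of a conditional alone until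
    its condition is decided; otherwise discarded branches would be explored.\<close>
  by (simp only: counters_free_def u1_def z0_def search_rules leaf_rules cong: if_weak_cong)

lemma search_a2: "search leafA rotA 7 [a2] a3 [a1, b1, c1, a2, b2] u1
  [a1, b1, c1, a2, b2, c2, a3, b3, c3] [[a4, b4, c4], [a5, b5, c5]] counters_free [u1, z0]"
  by (simp only: counters_free_def u1_def z0_def search_rules leaf_rules cong: if_weak_cong)

text \<open>With a leaf predicate that is constantly false, this says that every branch is pruned
  before nine facets are reached.\<close>

lemma search_fixing: "search (\<lambda>path. False) rotB 7 [a1, b1, c1, a2, b2] a3 [a1, b1, c1, a2, b2] u1
  [a1, b1, c1, a2, b2, c2, a3, b3, c3] [[a4, b4, c4], [a5, b5, c5]] counters_fixing [u1, z0]"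
  by (simp only: counters_fixing_def u1_def z0_def search_rules enc_rules cong: if_weak_cong)

lemma sem_z0: "sem z0 = {a1, b1, c1, a2, b2, c2}"
  unfolding z0_def sem_enc by simp

lemma sem_u1: "sem u1 = {a1, b1, c1, a2, b2, a3}"
  unfolding u1_def sem_enc by simp

lemma trackedI:
  assumes "distinct L" "hits v L + p = 10" "cover v L empty_code = U"
  shows "tracked (sem ` set L) (Track v p U)"
proof -
  have eq: "{\<sigma>\<in>sem ` set L. v \<in> \<sigma>} = sem ` set (filter (mem v) L)" by (auto simp: mem_sem)
  have "card (sem ` set (filter (mem v) L)) = card (set (filter (mem v) L))"
    by (rule card_image) (simp add: inj_on_def sem_inject)
  also have "\<dots> = hits v L" using assms(1) by (simp only: distinct_card distinct_filter hits_def)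
  finally have "card {\<sigma>\<in>sem ` set L. v \<in> \<sigma>} = hits v L" unfolding eq .
  moreover have "sem U = \<Union>{\<sigma>\<in>sem ` set L. v \<in> \<sigma>}"
    unfolding assms(3)[symmetric] sem_cover sem_empty eq by auto
  ultimately show ?thesis using assms(2) by simp
qed

lemma counters_free: "\<forall>t\<in>set counters_free. tracked (sem ` set (family rotA [u1, z0])) t"
  unfolding counters_free_def list.set ball_simps simp_thms
  by (intro conjI trackedI) (simp_all add: u1_def z0_def orb3_def enc_def empty_code_def)

lemma counters_fixing: "\<forall>t\<in>set counters_fixing. tracked (sem ` set (family rotB [u1, z0])) t"
  unfolding counters_fixing_def list.set ball_simps simp_thms
  by (intro conjI trackedI) (simp_all add: u1_def z0_def orb3_def enc_def empty_code_def)

lemma names_free: "free.names [a1, b1, c1, a2, b2, c2, a3, b3, c3] [[a4, b4, c4], [a5, b5, c5]]"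
  unfolding free.names_def UNIV_vertex by auto

lemma names_fixing: "fixing.names [a1, b1, c1, a2, b2, c2, a3, b3, c3] [[a4, b4, c4], [a5, b5, c5]]"
  unfolding fixing.names_def UNIV_vertex \<psi>_def by auto

lemma state_free:
  assumes "free.rotational G" "quotient_path G \<phi> [sem u1, sem z0]"
  shows "free.state_ok G a3 [a1, b1, c1, a2, b2] u1 [a1, b1, c1, a2, b2, c2, a3, b3, c3]
    [[a4, b4, c4], [a5, b5, c5]] counters_free [u1, z0]"
proof -
  have "spread \<phi> (map sem [u1, z0]) = sem ` set (family rotA [u1, z0])"
    using free.family_spread[OF assms(1), of "[u1, z0]"] assms(2) by simp
  then have "\<forall>t\<in>set counters_free. tracked (spread \<phi> (map sem [u1, z0])) t" using counters_free by metis
  then show ?thesis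
    unfolding free.state_ok_def using assms(2) names_free sem_u1 sem_z0 by (auto simp: insert_commute)
qed

lemma state_fixing:
  assumes "fixing.rotational G" "quotient_path G \<psi> [sem u1, sem z0]"
  shows "fixing.state_ok G a3 [a1, b1, c1, a2, b2] u1 [a1, b1, c1, a2, b2, c2, a3, b3, c3]
    [[a4, b4, c4], [a5, b5, c5]] counters_fixing [u1, z0]"
proof -
  have "spread \<psi> (map sem [u1, z0]) = sem ` set (family rotB [u1, z0])"
    using fixing.family_spread[OF assms(1), of "[u1, z0]"] assms(2) by simp
  then have "\<forall>t\<in>set counters_fixing. tracked (spread \<psi> (map sem [u1, z0])) t" using counters_fixing by metis
  then show ?thesis
    unfolding fixing.state_ok_def using assms(2) names_fixing sem_u1 sem_z0 by (auto simp: insert_commute)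
qed

definition relabelling :: "vertex set set \<Rightarrow> vertex set set \<Rightarrow> bool" where
  "relabelling G G' \<longleftrightarrow> (\<exists>\<pi>. bij \<pi> \<and> G' = (`) \<pi> ` G)"

definition target :: "vertex set set \<Rightarrow> bool" where
  "target G \<longleftrightarrow> (\<exists>i\<in>{1..12}. \<exists>\<pi>. bij \<pi> \<and> (`) \<pi> ` G = N_facets i)"

lemma target_relabelling: "relabelling G G' \<Longrightarrow> target G' \<Longrightarrow> target G"
proof -
  assume "relabelling G G'" "target G'"
  then obtain \<pi> i \<pi>' where p: "bij \<pi>" "G' = (`) \<pi> ` G" "i \<in> {1..12}" "bij \<pi>'" "(`) \<pi>' ` G' = N_facets i"
    by (auto simp: relabelling_def target_def)
  have "(`) (\<pi>' \<circ> \<pi>) ` G = N_facets i" using p by (simp add: image_image image_comp)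
  moreover have "bij (\<pi>' \<circ> \<pi>)" using p by (simp add: bij_comp)
  ultimately show ?thesis unfolding target_def using p(3) by blast
qed

text \<open>Conjugation by this reflection inverts \<open>\<phi>\<close>, so it suffices to search the paths that first exchange \<open>a1\<close> or \<open>a2\<close>.\<close>

fun \<kappa> :: "vertex \<Rightarrow> vertex" where
  "\<kappa> a1 = a1" | "\<kappa> b1 = c1" | "\<kappa> c1 = b1" | "\<kappa> a2 = b2" | "\<kappa> b2 = a2" | "\<kappa> c2 = c2"
| "\<kappa> a3 = a3" | "\<kappa> b3 = c3" | "\<kappa> c3 = b3" | "\<kappa> a4 = a4" | "\<kappa> b4 = c4" | "\<kappa> c4 = b4"
| "\<kappa> a5 = a5" | "\<kappa> b5 = c5" | "\<kappa> c5 = b5"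

lemma normalises_kappa: "free.normalises \<kappa>"
proof -
  have "\<kappa> (\<kappa> v) = v" for v by (cases v) simp_all
  then have "bij \<kappa>" by (rule involuntory_imp_bij)
  moreover have "\<phi> (\<kappa> v) = \<kappa> (\<phi> (\<phi> v))" for v by (cases v) simp_all
  ultimately show ?thesis by (simp add: free.normalises_def)
qed

text \<open>The evaluated searches restrict the first removal, whereas \<open>search_sound\<close>
  expects the full list \<open>el\<close>. So the first exchange is taken separately, and soundness
  is applied to the remaining six.\<close>

lemma free_search:
  assumes G: "free.rotational G" and q: "quotient_path G \<phi> [W, sem u1, sem z0]"
    and W: "W = insert z (sem u1 - {x})" "z \<notin> sem u1" "x \<in> {a1, a2}"
  shows "target G"
proof -
  have q2: "quotient_path G \<phi> [sem u1, sem z0]" using q by (auto elim: quotient_path.cases)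
  have seven: "7 = Suc 6" by simp
  have r: "remove_each (search leafA rotA 6) rotA [x] a3 [a1, b1, c1, a2, b2] u1
    [a1, b1, c1, a2, b2, c2, a3, b3, c3] [[a4, b4, c4], [a5, b5, c5]] counters_free [u1, z0]"
    using W(3) search_a1[unfolded seven search.simps(2)] search_a2[unfolded seven search.simps(2)]
    by (elim insertE emptyE) (simp_all only:)
  have x: "x \<in> set [x]" "x \<in> set [a1, b1, c1, a2, b2]" using W(3) by auto
  have q': "quotient_path G \<phi> (W # map sem [u1, z0])" using q by simp
  from free.step[OF r G state_free[OF G q2] q' x W(2,1)]
  obtain \<pi> y' el' u' av' nw' tr' where \<pi>: "free.normalises \<pi>"
    and st: "free.state_ok ((`) \<pi> ` G) y' el' u' av' nw' tr' (u' # [u1, z0])"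
    and s: "search leafA rotA 6 el' y' el' u' av' nw' tr' (u' # [u1, z0])" by blast
  have "length (u' # [u1, z0]) + 6 = 9" by simp
  from free.search_sound[OF s free.rotational_image[OF G \<pi>] st this]
  obtain \<pi>' path' where p: "free.normalises \<pi>'" "quotient_path ((`) \<pi>' ` (`) \<pi> ` G) \<phi> (map sem path')"
    "length path' = 9" "leafA path'" by blast
  have "target ((`) \<pi>' ` (`) \<pi> ` G)"
    unfolding target_def
    by (rule leaf_sound[OF free.rotational_image[OF free.rotational_image[OF G \<pi>] p(1)] p(2-4)])
  moreover have "relabelling G ((`) \<pi> ` G)" "relabelling ((`) \<pi> ` G) ((`) \<pi>' ` (`) \<pi> ` G)"
    using \<pi> p(1) by (auto simp: relabelling_def free.normalises_def)
  ultimately show ?thesis using target_relabelling by blast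
qed

lemma free_second:
  assumes G: "free.rotational G" and q: "quotient_path G \<phi> [sem u1, sem z0]"
  shows "target G"
proof -
  interpret rotation_family UNIV G \<phi> by (rule G)
  obtain W where W: "quotient_path G \<phi> (W # map sem [u1, z0])"
    using quotient_path_extend[of "sem u1" "[sem z0]"] q by auto
  obtain x z where xz: "x \<in> set [a1, b1, c1, a2, b2]" "z \<notin> sem u1" "W = insert z (sem u1 - {x})"
    using free.exchange[OF G state_free[OF G q] W] by metis
  have *: "target G" if \<pi>: "free.normalises \<pi>" "\<pi> ` sem z0 = sem z0" "\<pi> ` sem u1 = sem u1" "\<pi> x \<in> {a1, a2}" for \<pi>
  proof -
    have inj: "inj \<pi>" using \<pi>(1) by (simp add: free.normalises_def bij_def)
    have "quotient_path ((`) \<pi> ` G) \<phi> [\<pi> ` W, sem u1, sem z0]"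
      using free.quotient_path_image[OF \<pi>(1) W] \<pi>(2,3) by simp
    moreover have "\<pi> ` W = insert (\<pi> z) (sem u1 - {\<pi> x})"
      unfolding xz(3) using \<pi>(3) inj by (simp add: image_set_diff)
    moreover have "\<pi> z \<notin> sem u1" using xz(2) \<pi>(3) inj by (metis inj_image_mem_iff)
    ultimately have "target ((`) \<pi> ` G)"
      using free_search[OF free.rotational_image[OF G \<pi>(1)]] \<pi>(4) by blast
    moreover have "relabelling G ((`) \<pi> ` G)" using \<pi>(1) by (auto simp: relabelling_def free.normalises_def)
    ultimately show ?thesis using target_relabelling by blast
  qed
  consider "x = a2" | "x \<in> {a1, b1, c1}" | "x = b2" using xz(1) by auto
  then show ?thesis
  proof cases
    case 1
    show ?thesis by (rule *[OF free.normalises_id]) (simp_all add: 1)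
  next
    case 2
    \<comment> \<open>Only the first orbit is rotated, and \<open>z0\<close> and \<open>u1\<close>
      both contain all of it.\<close>
    have "free.normalises (relab \<phi> a1 x)" by (rule free.normalises_relab) (simp_all add: phi_neq)
    moreover have "relab \<phi> a1 x ` sem z0 = sem z0" "relab \<phi> a1 x ` sem u1 = sem u1" "relab \<phi> a1 x x = a1"
      using 2 unfolding sem_z0 sem_u1 by (elim insertE emptyE; simp add: relab_def insert_commute)+
    ultimately show ?thesis using * by blast
  next
    case 3
    show ?thesis by (rule *[OF normalises_kappa]) (auto simp: 3 sem_z0 sem_u1)
  qed
qed

section \<open>Bringing the first two facets into standard position\<close>

locale start_setting = search_setting +
  assumes fixed_only: "f v = v \<Longrightarrow> v \<in> {a1, b1, c1}"
    and orbit1: "f ` {a1, b1, c1} = {a1, b1, c1}" and orbit2: "f a2 = b2" "f b2 = c2" "f c2 = a2"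
begin

lemma moved: "v \<notin> {a1, b1, c1} \<Longrightarrow> f v \<noteq> v"
  using fixed_only by blast

lemma z0_fixed: "f ` sem z0 = sem z0"
proof -
  have "sem z0 = {a1, b1, c1} \<union> {a2, b2, c2}" by (simp add: sem_z0 insert_commute)
  then show ?thesis using orbit1 by (simp add: image_Un orbit2 insert_commute)
qed

lemma z0_closed: "f v \<in> sem z0 \<longleftrightarrow> v \<in> sem z0"
  using z0_fixed cubed by (metis imageI)

text \<open>A vertex of \<open>z\<close> outside the first triple is moved to \<open>a2\<close>;
  invariance then supplies \<open>b2\<close> and \<open>c2\<close>, while the first triple stays in
  place.\<close>

lemma start_facet:
  assumes G: "rotational G" and z: "z \<in> G" "f ` z = z" "{a1, b1, c1} \<subseteq> z"
  shows "\<exists>\<pi>. normalises \<pi> \<and> sem z0 \<in> (`) \<pi> ` G"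
proof -
  interpret rotation_family UNIV G f by (rule G)
  have c: "card z = 6" "finite z" using card_F_mem[OF z(1)] fin_mem[OF z(1)] by blast+
  have "\<not> z \<subseteq> {a1, b1, c1}"
  proof
    assume "z \<subseteq> {a1, b1, c1}"
    then have "card z \<le> card {a1, b1, c1}" by (intro card_mono) auto
    then show False using c by simp
  qed
  then obtain y where y: "y \<in> z" "y \<notin> {a1, b1, c1}" by blast
  let ?q = "relab f a2 y" let ?w = "?q ` z"
  have n: "normalises ?q" by (rule normalises_relab) (use moved y in simp_all)
  have w: "f ` ?w = ?w" using z(2) fixed_image_iff[OF n] by simp
  have "?q y = a2" by (simp add: relab_def)
  then have a2: "a2 \<in> ?w" using y(1) by (metis imageI)
  then have "f a2 \<in> ?w" using w by blast
  then have "f (f a2) \<in> ?w" using w by blast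
  have "?q v = v" if "v \<in> {a1, b1, c1}" for v
  proof (rule relab(4)[OF cubed])
    have "f v \<in> {a1, b1, c1}" if "v \<in> {a1, b1, c1}" for v using orbit1 that by blast
    then show "v \<notin> {a2, f a2, f (f a2), y, f y, f (f y)}"
      using that y(2) cubed[of y] orbit2 by (metis insert_iff singleton_iff vertex.distinct)
  qed (use moved y in simp_all)
  then have "v \<in> ?w" if "v \<in> {a1, b1, c1}" for v
    using z(3) that rev_image_eqI[of v z v ?q] by (metis subsetD)
  then have "sem z0 \<subseteq> ?w"
    using a2 \<open>f a2 \<in> ?w\<close> \<open>f (f a2) \<in> ?w\<close> by (simp add: sem_z0 orbit2)
  moreover have "card (sem z0) = 6" by (simp add: sem_z0)
  moreover have "card ?w = 6" using c(1) n by (simp add: card_image normalises_def bij_def inj_on_subset[OF _ subset_UNIV])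
  ultimately have "sem z0 = ?w" using card_subset_eq[of ?w "sem z0"] c(2) by simp
  then show ?thesis using z(1) n by blast
qed

text \<open>Two relabellings: the first moves the removed vertex to \<open>c2\<close> and preserves
  \<open>z0\<close> as a set; the second moves the inserted vertex to \<open>a3\<close> and fixes
  \<open>z0\<close> pointwise. What remains is \<open>u1\<close>.\<close>

lemma start_path:
  assumes G: "rotational G" and W: "quotient_path G f [W, sem z0]"
    and xy: "W = insert y (sem z0 - {x})" "x \<in> sem z0" "y \<notin> sem z0" "f x \<noteq> x"
  shows "\<exists>\<pi>. normalises \<pi> \<and> quotient_path ((`) \<pi> ` G) f [sem u1, sem z0]"
proof -
  let ?p = "relab f c2 x" and ?q = "relab f a3 y"
  have c2: "c2 \<in> sem z0" and a3: "a3 \<notin> sem z0" by (simp_all add: sem_z0)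
  have moved_c2: "f c2 \<noteq> c2" and moved_a3: "f a3 \<noteq> a3" and moved_y: "f y \<noteq> y"
    using moved xy(3) by (auto simp: sem_z0)
  have n: "normalises ?p" "normalises ?q"
    using normalises_relab xy(4) moved_c2 moved_a3 moved_y by blast+
  have "?p v \<in> sem z0" if "v \<in> sem z0" for v
    using that xy(2) c2 by (simp add: relab_def z0_closed)
  moreover have inj: "inj ?p" using n(1) by (simp add: normalises_def bij_def)
  then have "card (?p ` sem z0) = card (sem z0)" by (rule card_image[OF inj_on_subset[OF _ subset_UNIV]])
  moreover have "finite (sem z0)" by (simp add: sem_z0)
  ultimately have pz: "?p ` sem z0 = sem z0" by (intro card_subset_eq) blast+
  have px: "?p x = c2" by (simp add: relab_def)
  have "y \<notin> {c2, f c2, f (f c2), x, f x, f (f x)}" using xy(2,3) c2 z0_closed by blast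
  then have py: "?p y = y" by (rule relab(4)[OF cubed moved_c2 xy(4)])
  have "v \<notin> {a3, f a3, f (f a3), y, f y, f (f y)}" if "v \<in> sem z0" for v
    using xy(3) a3 that z0_closed by blast
  then have qv: "?q v = v" if "v \<in> sem z0" for v
    using that by (intro relab(4)[OF cubed moved_a3 moved_y])
  have qy: "?q y = a3" by (simp add: relab_def)
  have qz: "?q ` \<sigma> = \<sigma>" if "\<sigma> \<subseteq> sem z0" for \<sigma> using qv that by (force simp: image_iff)
  have "?p ` W = insert y (sem z0 - {c2})" unfolding xy(1) using pz px py inj by (simp add: image_set_diff)
  moreover have "?q ` insert y (sem z0 - {c2}) = sem u1"
  proof -
    have "?q ` (sem z0 - {c2}) = sem z0 - {c2}" by (rule qz) blast
    then show ?thesis using qy by (auto simp: sem_z0 sem_u1)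
  qed
  ultimately have "map ((`) ?q) (map ((`) ?p) [W, sem z0]) = [sem u1, sem z0]" using pz qz by simp
  then have "quotient_path ((`) ?q ` (`) ?p ` G) f [sem u1, sem z0]"
    using quotient_path_image[OF n(2) quotient_path_image[OF n(1) W]] by simp
  moreover have "(`) ?q ` (`) ?p ` G = (`) (?q \<circ> ?p) ` G" by (simp add: image_image image_comp)
  moreover have "normalises (?q \<circ> ?p)" using n unfolding normalises_def by (auto simp: bij_comp cubed)
  ultimately show ?thesis by metis
qed

text \<open>If \<open>x\<close> were fixed, the ridge \<open>sem z0 - {x}\<close> would be invariant
  and lie in three facets: \<open>sem z0\<close>, \<open>W\<close> and the image of \<open>W\<close>
  under \<open>f\<close>.\<close>

lemma start_exchange:
  assumes G: "rotational G" and z: "sem z0 \<in> G"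
  obtains x y W where "quotient_path G f [W, sem z0]" "W = insert y (sem z0 - {x})" "x \<in> sem z0" "y \<notin> sem z0" "f x \<noteq> x"
proof -
  interpret rotation_family UNIV G f by (rule G)
  obtain W where W: "quotient_path G f [W, sem z0]"
    using quotient_path_extend[of "sem z0" "[]"] quotient_path.start[OF z z0_fixed] by auto
  note qd = quotient_pathD[OF G W]
  obtain x y where xy: "x \<in> sem z0" "y \<notin> sem z0" "W = insert y (sem z0 - {x})"
    using adjacent_exchange[OF card_F_mem[OF qd(9)] card_F_mem[OF qd(8)] qd(5)] by metis
  have "f x \<noteq> x"
  proof
    assume x: "f x = x"
    let ?\<tau> = "sem z0 - {x}"
    have "card ?\<tau> = 5" using xy(1) card_F_mem[OF z] fin_mem[OF z] by simp
    moreover have "inj f" by (rule injI) (metis cubed)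
    then have "f ` ?\<tau> = ?\<tau>" using z0_fixed x by (simp add: image_set_diff)
    then have "?\<tau> \<subseteq> f ` W" using xy(3) by blast
    ultimately have "f ` W = sem z0 \<or> f ` W = W"
      using ridge_third[of ?\<tau> "sem z0" W "f ` W"] z qd(8) f_F[OF qd(8)] xy by blast
    moreover have "f ` W \<noteq> sem z0" using inj_image[OF qd(8) z] z0_fixed xy by blast
    moreover have "f ` W \<noteq> W" using W by (auto elim: quotient_path.cases)
    ultimately show False by blast
  qed
  then show ?thesis using that W xy by blast
qed

end

global_interpretation free: start_setting \<phi> rotA
proof unfold_locales
  show "\<phi> ` {a1, b1, c1} = {a1, b1, c1}" by auto
qed (simp_all add: phi_neq)

global_interpretation fixing: start_setting \<psi> rotB
proof unfold_locales
  show "\<psi> v = v \<Longrightarrow> v \<in> {a1, b1, c1}" for v using phi_neq by (auto simp: \<psi>_def split: if_splits)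
qed (simp_all add: \<psi>_def)

lemma relabelling_normalises:
  "free.normalises \<pi> \<Longrightarrow> relabelling G ((`) \<pi> ` G)"
  by (auto simp: relabelling_def free.normalises_def)

lemma free_case:
  assumes "tight UNIV G" "\<And>\<sigma>. \<sigma> \<in> G \<Longrightarrow> \<phi> ` \<sigma> \<in> G"
  shows "target G"
proof -
  have G: "free.rotational G" by (rule free.rotationalI[OF assms])
  interpret rotation_family UNIV G \<phi> by (rule G)
  obtain z where z: "z \<in> G" "\<phi> ` z = z" using exists_fixed by blast
  obtain x where x: "x \<in> z" using card_F_mem[OF z(1)] by fastforce
  define \<pi>1 where "\<pi>1 = relab \<phi> a1 x"
  have n1: "free.normalises \<pi>1" unfolding \<pi>1_def by (rule free.normalises_relab) (simp_all add: phi_neq)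
  have z1: "\<pi>1 ` z \<in> (`) \<pi>1 ` G" "\<phi> ` \<pi>1 ` z = \<pi>1 ` z" using z free.fixed_image_iff[OF n1] by auto
  have "\<pi>1 x = a1" by (simp add: \<pi>1_def relab_def)
  then have "a1 \<in> \<pi>1 ` z" using x by (metis imageI)
  moreover from this have "\<phi> a1 \<in> \<pi>1 ` z" using z1(2) by blast
  moreover from this have "\<phi> (\<phi> a1) \<in> \<pi>1 ` z" using z1(2) by blast
  ultimately have sub: "{a1, b1, c1} \<subseteq> \<pi>1 ` z" by simp
  have G1: "free.rotational ((`) \<pi>1 ` G)" by (rule free.rotational_image[OF G n1])
  obtain \<pi>2 where n2: "free.normalises \<pi>2" "sem z0 \<in> (`) \<pi>2 ` (`) \<pi>1 ` G"
    using free.start_facet[OF G1 z1 sub] by blast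
  have G2: "free.rotational ((`) \<pi>2 ` (`) \<pi>1 ` G)" by (rule free.rotational_image[OF G1 n2(1)])
  obtain \<pi>3 where n3: "free.normalises \<pi>3"
    "quotient_path ((`) \<pi>3 ` (`) \<pi>2 ` (`) \<pi>1 ` G) \<phi> [sem u1, sem z0]"
    using free.start_exchange[OF G2 n2(2)] free.start_path[OF G2] by metis
  have "target ((`) \<pi>3 ` (`) \<pi>2 ` (`) \<pi>1 ` G)" by (rule free_second[OF free.rotational_image[OF G2 n3(1)] n3(2)])
  then show ?thesis using n1 n2(1) n3(1) relabelling_normalises target_relabelling by blast
qed

lemma fixing_case:
  assumes "tight UNIV G" "\<And>\<sigma>. \<sigma> \<in> G \<Longrightarrow> \<psi> ` \<sigma> \<in> G"
  shows False
proof -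
  have G: "fixing.rotational G" by (rule fixing.rotationalI[OF assms])
  interpret rotation_family UNIV G \<psi> by (rule G)
  have fx: "fixed = {a1, b1, c1}" by (auto simp: fixed_def \<psi>_def phi_neq)
  obtain z where z: "z \<in> G" "\<psi> ` z = z" "{a1, b1, c1} \<subseteq> z"
    using fixed_points(2)[unfolded fx] fixing.nontrivial by blast
  obtain \<pi>1 where n1: "fixing.normalises \<pi>1" "sem z0 \<in> (`) \<pi>1 ` G"
    using fixing.start_facet[OF G z] by blast
  have G1: "fixing.rotational ((`) \<pi>1 ` G)" by (rule fixing.rotational_image[OF G n1(1)])
  obtain \<pi>2 where n2: "fixing.normalises \<pi>2" "quotient_path ((`) \<pi>2 ` (`) \<pi>1 ` G) \<psi> [sem u1, sem z0]"
    using fixing.start_exchange[OF G1 n1(2)] fixing.start_path[OF G1] by metis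
  have G2: "fixing.rotational ((`) \<pi>2 ` (`) \<pi>1 ` G)" by (rule fixing.rotational_image[OF G1 n2(1)])
  from fixing.search_sound[OF search_fixing G2 state_fixing[OF G2 n2(2)]] show False by simp
qed

section \<open>Stacked balls\<close>

definition generated :: "'a set set \<Rightarrow> 'a set set" where
  "generated F = {\<alpha>. \<exists>\<sigma>\<in>F. \<alpha> \<subseteq> \<sigma>}"

text \<open>\<open>boundary_complex\<close> in terms of the family of facets; that
  \<open>\<beta>\<close> is a face follows from its lying in a facet.\<close>

definition ridge_complex :: "nat \<Rightarrow> 'a set set \<Rightarrow> 'a set set" where
  "ridge_complex d F = {\<alpha>. \<exists>\<beta>. card \<beta> = d \<and> card {\<sigma>\<in>F. \<beta> \<subseteq> \<sigma>} = 1 \<and> \<alpha> \<subseteq> \<beta>}"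

lemma facets_generated:
  assumes "\<forall>\<sigma>\<in>F. finite \<sigma> \<and> card \<sigma> = n"
  shows "facets (generated F) = F"
proof
  show "facets (generated F) \<subseteq> F"
  proof
    fix \<alpha> assume a: "\<alpha> \<in> facets (generated F)"
    then obtain \<sigma> where "\<sigma> \<in> F" "\<alpha> \<subseteq> \<sigma>" by (auto simp: facets_def generated_def)
    moreover from this have "\<sigma> = \<alpha>" using a by (auto simp: facets_def generated_def)
    ultimately show "\<alpha> \<in> F" by simp
  qed
  show "F \<subseteq> facets (generated F)"
  proof
    fix \<sigma> assume s: "\<sigma> \<in> F"
    have "\<beta> = \<sigma>" if b: "\<beta> \<in> generated F" "\<sigma> \<subseteq> \<beta>" for \<beta>
    proof -
      obtain \<rho> where r: "\<rho> \<in> F" "\<beta> \<subseteq> \<rho>" using b by (auto simp: generated_def)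
      then have "\<sigma> = \<rho>" using assms s b card_subset_eq[of \<rho> \<sigma>] by auto
      then show ?thesis using r b by auto
    qed
    moreover have "\<sigma> \<in> generated F" using s by (auto simp: generated_def)
    ultimately show "\<sigma> \<in> facets (generated F)" by (simp add: facets_def)
  qed
qed

lemma boundary_generated:
  assumes "\<forall>\<sigma>\<in>F. finite \<sigma> \<and> card \<sigma> = n"
  shows "boundary_complex d (generated F) = ridge_complex d F"
proof -
  have "\<beta> \<in> generated F" if "card {\<sigma>\<in>F. \<beta> \<subseteq> \<sigma>} = 1" for \<beta>
  proof -
    have "{\<sigma>\<in>F. \<beta> \<subseteq> \<sigma>} \<noteq> {}" using that by (metis card.empty zero_neq_one)
    then show ?thesis by (auto simp: generated_def)
  qed
  then show ?thesis
    unfolding boundary_complex_def ridge_complex_def facets_generated[OF assms] by blast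
qed

text \<open>So the ball is recovered from the graph of its boundary.\<close>

lemma stacked_ball_facets:
  "stacked_ball 4 B \<Longrightarrow> \<exists>S. B = generated S \<and> stacked_family S \<and> (\<forall>\<sigma>\<in>S. finite \<sigma> \<and> card \<sigma> = 5)
    \<and> (\<forall>K. (\<forall>p\<in>K. \<forall>q\<in>K. {p, q} \<in> B) \<longrightarrow> K \<in> B) \<and> (\<forall>\<alpha>\<in>B. card \<alpha> \<le> 3 \<longrightarrow> \<alpha> \<in> ridge_complex 4 S)"
proof (induction rule: stacked_ball.induct)
  case (standard \<sigma>)
  have c: "card \<sigma> = 5" "finite \<sigma>" using standard by simp_all
  have low: "\<alpha> \<in> ridge_complex 4 {\<sigma>}" if a: "\<alpha> \<in> Pow \<sigma>" "card \<alpha> \<le> 3" for \<alpha>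
  proof -
    have "\<alpha> \<noteq> \<sigma>" using a c by auto
    then obtain s where s: "s \<in> \<sigma>" "s \<notin> \<alpha>" using a by blast
    have "card (\<sigma> - {s}) = 4" using s c by simp
    moreover have "{\<rho>\<in>{\<sigma>}. \<sigma> - {s} \<subseteq> \<rho>} = {\<sigma>}" by blast
    then have "card {\<rho>\<in>{\<sigma>}. \<sigma> - {s} \<subseteq> \<rho>} = 1" by (metis card_1_singleton_iff One_nat_def)
    ultimately show ?thesis unfolding ridge_complex_def using a s by blast
  qed
  have "Pow \<sigma> = generated {\<sigma>}" by (auto simp: generated_def)
  moreover have "\<forall>K. (\<forall>p\<in>K. \<forall>q\<in>K. {p, q} \<in> Pow \<sigma>) \<longrightarrow> K \<in> Pow \<sigma>" by blast
  moreover have "\<forall>\<rho>\<in>{\<sigma>}. finite \<rho> \<and> card \<rho> = 5" using c by simp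
  moreover have "\<forall>\<alpha>\<in>Pow \<sigma>. card \<alpha> \<le> 3 \<longrightarrow> \<alpha> \<in> ridge_complex 4 {\<sigma>}" using low by simp
  ultimately show ?case using stacked_family.single by (intro exI[of _ "{\<sigma>}"] conjI)
next
  case (paste B \<sigma> v)
  obtain S where S: "B = generated S" "stacked_family S" "\<forall>\<sigma>\<in>S. finite \<sigma> \<and> card \<sigma> = 5"
    "\<forall>K. (\<forall>p\<in>K. \<forall>q\<in>K. {p, q} \<in> B) \<longrightarrow> K \<in> B" "\<forall>\<alpha>\<in>B. card \<alpha> \<le> 3 \<longrightarrow> \<alpha> \<in> ridge_complex 4 S"
    using paste.IH by (elim exE conjE)
  have VB: "\<Union>S = vertex_set B" unfolding S(1) by (auto simp: generated_def vertex_set_def)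
  have v: "v \<notin> \<Union>S" using paste.hyps VB by simp
  have c\<sigma>: "card \<sigma> = 4" "finite \<sigma>" using paste.hyps(3) by (auto intro: card_ge_0_finite)
  have "\<sigma> \<in> ridge_complex 4 S" using paste.hyps(2) boundary_generated[OF S(3)] unfolding S(1) by simp
  then obtain \<beta> where b: "card \<beta> = 4" "card {\<rho>\<in>S. \<beta> \<subseteq> \<rho>} = 1" "\<sigma> \<subseteq> \<beta>" by (auto simp: ridge_complex_def)
  have "finite \<beta>" using b(1) by (auto intro: card_ge_0_finite)
  then have "\<sigma> = \<beta>" using card_subset_eq b c\<sigma> by metis
  then obtain \<tau> where t: "{\<rho>\<in>S. \<sigma> \<subseteq> \<rho>} = {\<tau>}" using b(2) by (auto simp: card_1_singleton_iff)
  then have \<tau>: "\<tau> \<in> S" "\<sigma> \<subseteq> \<tau>" "\<forall>\<rho>\<in>S. \<sigma> \<subseteq> \<rho> \<longrightarrow> \<rho> = \<tau>" by blast+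
  have c\<tau>: "card \<tau> = 5" "finite \<tau>" using S(3) \<tau>(1) by auto
  have "card (\<tau> - \<sigma>) = 1" using \<tau>(2) c\<tau> c\<sigma> by (simp add: card_Diff_subset)
  then obtain x where x: "\<tau> - \<sigma> = {x}" by (auto simp: card_1_singleton_iff)
  have \<sigma>x: "\<sigma> = \<tau> - {x}" "x \<in> \<tau>" using x \<tau>(2) by blast+
  let ?n = "insert v \<sigma>" let ?S = "insert ?n S"
  have vs: "v \<notin> \<sigma>" using v \<tau> by blast
  have st: "stacked_family ?S"
    unfolding \<sigma>x(1) by (rule stacked_family.attach[OF S(2) \<tau>(1) \<sigma>x(2) v]) (use \<tau>(3) \<sigma>x(1) in blast)
  have card5: "\<forall>\<rho>\<in>?S. finite \<rho> \<and> card \<rho> = 5" using S(3) c\<sigma> vs by simp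
  have B': "B \<union> Pow (\<sigma> \<union> {v}) = generated ?S" unfolding S(1) by (auto simp: generated_def)
  have \<sigma>B: "\<sigma> \<in> B" unfolding S(1) generated_def using \<tau> by blast
  have down: "\<alpha> \<in> B" if "\<alpha> \<subseteq> \<beta>" "\<beta> \<in> B" for \<alpha> \<beta> using that unfolding S(1) by (auto simp: generated_def)
  have Bv: "\<alpha> \<in> B" if "\<alpha> \<in> B \<union> Pow (\<sigma> \<union> {v})" "v \<notin> \<alpha>" for \<alpha>
    using that down[OF _ \<sigma>B, of \<alpha>] by blast
  have vB: "\<alpha> \<subseteq> ?n" if "\<alpha> \<in> B \<union> Pow (\<sigma> \<union> {v})" "v \<in> \<alpha>" for \<alpha>
    using that v unfolding S(1) generated_def by blast
  \<comment> \<open>Edges at the new vertex lie in the new simplex, so a clique containing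
    \<open>v\<close> does too; any other clique belongs to the old ball.\<close>
  have clique: "K \<in> B \<union> Pow (\<sigma> \<union> {v})" if K: "\<forall>p\<in>K. \<forall>q\<in>K. {p, q} \<in> B \<union> Pow (\<sigma> \<union> {v})" for K
  proof (cases "v \<in> K")
    case True
    have "K \<subseteq> ?n"
    proof
      fix q assume "q \<in> K"
      then have "{v, q} \<subseteq> ?n" using vB[of "{v, q}"] K True by blast
      then show "q \<in> ?n" by blast
    qed
    then show ?thesis by blast
  next
    case False
    have "\<forall>p\<in>K. \<forall>q\<in>K. {p, q} \<in> B"
    proof (intro ballI)
      fix p q assume "p \<in> K" "q \<in> K"
      then show "{p, q} \<in> B" using Bv[of "{p, q}"] K False by blast
    qed
    then show ?thesis using S(4) by blast
  qed
  \<comment> \<open>The 4-subsets of the new simplex that contain \<open>v\<close> are free, because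
    no older facet contains \<open>v\<close>.\<close>
  have new_ridge: "\<alpha> \<in> ridge_complex 4 ?S" if a: "\<alpha> \<subseteq> insert v (\<sigma> - {s})" "s \<in> \<sigma>" for \<alpha> s
  proof -
    let ?\<beta> = "insert v (\<sigma> - {s})"
    have "card ?\<beta> = 4" using c\<sigma> vs a(2) by simp
    moreover have "{\<rho>\<in>?S. ?\<beta> \<subseteq> \<rho>} = {?n}" using v by blast
    then have "card {\<rho>\<in>?S. ?\<beta> \<subseteq> \<rho>} = 1" by (metis card_1_singleton_iff One_nat_def)
    ultimately show ?thesis unfolding ridge_complex_def using a(1) by blast
  qed
  \<comment> \<open>Inside the new simplex, at most three vertices omit some \<open>s\<close> of the
    4-set \<open>\<sigma>\<close> and so lie in such a ridge. Elsewhere an old free ridge does not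
    lie in the new simplex and stays free.\<close>
  have low: "\<alpha> \<in> ridge_complex 4 ?S" if a: "\<alpha> \<in> B \<union> Pow (\<sigma> \<union> {v})" "card \<alpha> \<le> 3" for \<alpha>
  proof (cases "\<alpha> \<subseteq> ?n")
    case True
    have fa: "finite (\<alpha> - {v})" using True c\<sigma> finite_subset[of "\<alpha> - {v}" \<sigma>] by auto
    have "card (\<alpha> - {v}) \<le> 3" using a(2) card_Diff1_le[of \<alpha> v] by linarith
    then have "\<alpha> - {v} \<noteq> \<sigma>" using c\<sigma> by auto
    then obtain s where "s \<in> \<sigma>" "s \<notin> \<alpha>" using True vs by blast
    then show ?thesis using new_ridge[of \<alpha> s] True by blast
  next
    case False
    then have "v \<notin> \<alpha>" using vB a by blast
    then have aB: "\<alpha> \<in> B" using Bv a by blast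
    then obtain \<beta> where b: "card \<beta> = 4" "card {\<rho>\<in>S. \<beta> \<subseteq> \<rho>} = 1" "\<alpha> \<subseteq> \<beta>"
      using S(5) a(2) unfolding ridge_complex_def by blast
    have "\<not> \<beta> \<subseteq> ?n" using b(3) False by blast
    then have "{\<rho>\<in>?S. \<beta> \<subseteq> \<rho>} = {\<rho>\<in>S. \<beta> \<subseteq> \<rho>}" by blast
    then have "card {\<rho>\<in>?S. \<beta> \<subseteq> \<rho>} = 1" using b(2) by simp
    then show ?thesis unfolding ridge_complex_def using b by blast
  qed
  have "\<forall>K. (\<forall>p\<in>K. \<forall>q\<in>K. {p, q} \<in> B \<union> Pow (\<sigma> \<union> {v})) \<longrightarrow> K \<in> B \<union> Pow (\<sigma> \<union> {v})"
    by (intro allI impI clique)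
  moreover have "\<forall>\<alpha>\<in>B \<union> Pow (\<sigma> \<union> {v}). card \<alpha> \<le> 3 \<longrightarrow> \<alpha> \<in> ridge_complex 4 ?S"
    by (intro ballI impI low)
  ultimately show ?case using B' st card5 by (intro exI[of _ ?S] conjI)
qed

section \<open>The tight family of a neighborly complex\<close>

text \<open>Neighborliness enters here: it puts all other vertices into the link. The ball has no
  edges beyond those of the link, so its facets can be read off from cliques there.\<close>

lemma link_structure:
  assumes M: "M \<in> neighborly_walkup_class 4" and x: "x \<in> vertex_set M"
  obtains S where "stacked_family S" "\<forall>\<sigma>\<in>S. finite \<sigma> \<and> card \<sigma> = 5" "\<Union>S = vertex_set M - {x}"
    "link x M = ridge_complex 4 S" "\<And>\<alpha> \<sigma>. \<sigma> \<in> S \<Longrightarrow> \<alpha> \<subseteq> \<sigma> \<Longrightarrow> card \<alpha> \<le> 3 \<Longrightarrow> \<alpha> \<in> link x M"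
    "\<And>K. \<forall>p\<in>K. \<forall>q\<in>K. {p, q} \<in> link x M \<Longrightarrow> \<exists>\<sigma>\<in>S. K \<subseteq> \<sigma>"
proof -
  have nb: "neighborly M" and ac: "abstract_complex M" and "stacked_sphere 3 (link x M)"
    using M x by (auto simp: neighborly_walkup_class_def walkup_class_def)
  then obtain B where B: "stacked_ball 4 B" "link x M = boundary_complex 4 B" by (auto simp: stacked_sphere_def)
  obtain S where S: "B = generated S" "stacked_family S" "\<forall>\<sigma>\<in>S. finite \<sigma> \<and> card \<sigma> = 5"
    "\<forall>K. (\<forall>p\<in>K. \<forall>q\<in>K. {p, q} \<in> B) \<longrightarrow> K \<in> B" "\<forall>\<alpha>\<in>B. card \<alpha> \<le> 3 \<longrightarrow> \<alpha> \<in> ridge_complex 4 S"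
    using stacked_ball_facets[OF B(1)] by (elim exE conjE)
  have l: "link x M = ridge_complex 4 S" using B(2) boundary_generated[OF S(3)] S(1) by simp
  have lB: "link x M \<subseteq> B"
  proof
    fix \<alpha> assume "\<alpha> \<in> link x M"
    then obtain \<beta> where b: "card {\<rho>\<in>S. \<beta> \<subseteq> \<rho>} = 1" "\<alpha> \<subseteq> \<beta>" unfolding l ridge_complex_def by blast
    have "{\<rho>\<in>S. \<beta> \<subseteq> \<rho>} \<noteq> {}" using b(1) by (metis card.empty zero_neq_one)
    then show "\<alpha> \<in> B" using b(2) unfolding S(1) generated_def by blast
  qed
  have low: "\<alpha> \<in> link x M" if "\<sigma> \<in> S" "\<alpha> \<subseteq> \<sigma>" "card \<alpha> \<le> 3" for \<alpha> \<sigma>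
    using that S(5) unfolding l S(1) generated_def by blast
  have U: "\<Union>S = vertex_set M - {x}"
  proof
    show "\<Union>S \<subseteq> vertex_set M - {x}"
    proof
      fix y assume "y \<in> \<Union>S"
      then obtain \<sigma> where "\<sigma> \<in> S" "y \<in> \<sigma>" by blast
      then have "{y} \<in> link x M" using low[of \<sigma> "{y}"] by simp
      then show "y \<in> vertex_set M - {x}" by (auto simp: link_def vertex_set_def)
    qed
    show "vertex_set M - {x} \<subseteq> \<Union>S"
    proof
      fix y assume y: "y \<in> vertex_set M - {x}"
      then have xy: "{x, y} \<in> M" using nb x by (auto simp: neighborly_def)
      then have "{y} \<in> M" using ac unfolding abstract_complex_def by blast
      then have "{y} \<in> link x M" using y xy by (auto simp: link_def insert_commute)
      then show "y \<in> \<Union>S" using lB unfolding S(1) generated_def by blast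
    qed
  qed
  have clique: "\<exists>\<sigma>\<in>S. K \<subseteq> \<sigma>" if "\<forall>p\<in>K. \<forall>q\<in>K. {p, q} \<in> link x M" for K
  proof -
    have "\<forall>p\<in>K. \<forall>q\<in>K. {p, q} \<in> B" using that lB by blast
    then have "K \<in> B" using S(4) by blast
    then show ?thesis unfolding S(1) generated_def by blast
  qed
  show ?thesis by (rule that[OF S(2,3) U l low clique])
qed

text \<open>A triple through \<open>x\<close> is a face exactly if its other two vertices span an
  edge of the link of \<open>x\<close>, so these are cliques in the link of each of their vertices.
  Since no vertex is singled out, the balls of different links fit together into one family.\<close>

definition six_cliques :: "'a set set \<Rightarrow> 'a set set" where
  "six_cliques M = {\<sigma>. \<sigma> \<subseteq> vertex_set M \<and> card \<sigma> = 6 \<and> (\<forall>\<tau>\<subseteq>\<sigma>. card \<tau> = 3 \<longrightarrow> \<tau> \<in> M)}"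

lemma star_six_cliques:
  assumes M: "M \<in> neighborly_walkup_class 4" and x: "x \<in> vertex_set M"
    and S: "stacked_family S" "\<forall>\<sigma>\<in>S. finite \<sigma> \<and> card \<sigma> = 5" "\<Union>S = vertex_set M - {x}"
    "\<And>\<alpha> \<sigma>. \<sigma> \<in> S \<Longrightarrow> \<alpha> \<subseteq> \<sigma> \<Longrightarrow> card \<alpha> \<le> 3 \<Longrightarrow> \<alpha> \<in> link x M"
    "\<And>K. \<forall>p\<in>K. \<forall>q\<in>K. {p, q} \<in> link x M \<Longrightarrow> \<exists>\<sigma>\<in>S. K \<subseteq> \<sigma>"
  shows "{\<sigma>\<in>six_cliques M. x \<in> \<sigma>} = insert x ` S"
proof
  have ac: "\<And>\<alpha> \<beta>. \<beta> \<in> M \<Longrightarrow> \<alpha> \<subseteq> \<beta> \<Longrightarrow> \<alpha> \<in> M"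
    using M by (auto simp: neighborly_walkup_class_def walkup_class_def abstract_complex_def)
  show "{\<sigma>\<in>six_cliques M. x \<in> \<sigma>} \<subseteq> insert x ` S"
  proof
    fix \<sigma> assume "\<sigma> \<in> {\<sigma>\<in>six_cliques M. x \<in> \<sigma>}"
    then have s: "card \<sigma> = 6" "\<And>\<tau>. \<tau> \<subseteq> \<sigma> \<Longrightarrow> card \<tau> = 3 \<Longrightarrow> \<tau> \<in> M" "x \<in> \<sigma>"
      by (auto simp: six_cliques_def)
    have fin: "finite \<sigma>" using s(1) by (rule card6_finite)
    let ?K = "\<sigma> - {x}"
    have cK: "card ?K = 5" using s fin by simp
    have "{p, q} \<in> link x M" if pq: "p \<in> ?K" "q \<in> ?K" for p q
    proof -
      \<comment> \<open>The clique condition includes \<open>p = q\<close>; there any other vertex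
        of the clique completes the triple.\<close>
      have "\<exists>r\<in>?K. r \<noteq> p \<and> q \<in> {p, r}"
      proof (cases "p = q")
        case True
        have "?K \<noteq> {p}"
        proof
          assume "?K = {p}"
          then have "card ?K = card {p}" by (rule arg_cong)
          then show False unfolding cK by simp
        qed
        then show ?thesis using pq True by blast
      next
        case False
        then show ?thesis using pq by (intro bexI[of _ q]) simp_all
      qed
      then obtain r where r: "r \<in> ?K" "r \<noteq> p" "q \<in> {p, r}" by blast
      have "p \<noteq> x" "r \<noteq> x" using pq r by blast+
      then have "card {x, p, r} = 3" using r(2) by (simp add: card_insert_if)
      then have "{x, p, r} \<in> M" using s pq r by (intro s(2)) auto
      then have "{p, q} \<in> M" "{p, q} \<union> {x} \<in> M" using ac[of "{x, p, r}"] r by auto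
      then show ?thesis using pq by (auto simp: link_def)
    qed
    then obtain \<rho> where r: "\<rho> \<in> S" "?K \<subseteq> \<rho>" using S(5)[of ?K] by blast
    then have "?K = \<rho>" using S(2) cK card_subset_eq[of \<rho> ?K] by auto
    then have "\<sigma> = insert x \<rho>" using s(3) by blast
    then show "\<sigma> \<in> insert x ` S" using r(1) by blast
  qed
  show "insert x ` S \<subseteq> {\<sigma>\<in>six_cliques M. x \<in> \<sigma>}"
  proof
    fix \<sigma> assume "\<sigma> \<in> insert x ` S"
    then obtain \<rho> where r: "\<rho> \<in> S" "\<sigma> = insert x \<rho>" by blast
    have sub: "\<rho> \<subseteq> vertex_set M - {x}" using r(1) S(3) by blast
    then have "card \<sigma> = 6" using S(2) r by (subst r(2)) (auto simp: card_insert_if)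
    moreover have "\<tau> \<in> M" if t: "\<tau> \<subseteq> \<sigma>" "card \<tau> = 3" for \<tau>
    proof -
      have "card (\<tau> - {x}) \<le> 3" using t(2) card_Diff1_le[of \<tau> x] by linarith
      then have "\<tau> - {x} \<in> link x M" using S(4)[OF r(1), of "\<tau> - {x}"] t r(2) by blast
      then have "(\<tau> - {x}) \<union> {x} \<in> M" by (simp add: link_def)
      then show ?thesis using ac by blast
    qed
    ultimately show "\<sigma> \<in> {\<sigma>\<in>six_cliques M. x \<in> \<sigma>}" using sub x r(2) by (auto simp: six_cliques_def)
  qed
qed

lemma tight_six_cliques:
  assumes M: "M \<in> neighborly_walkup_class 4" and card: "card (vertex_set M) = 15"
  shows "tight (vertex_set M) (six_cliques M)"
proof -
  have "stacked_family {\<sigma>\<in>six_cliques M. x \<in> \<sigma>} \<and> \<Union>{\<sigma>\<in>six_cliques M. x \<in> \<sigma>} = vertex_set M"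
    if x: "x \<in> vertex_set M" for x
  proof -
    obtain S where S: "stacked_family S" "\<forall>\<sigma>\<in>S. finite \<sigma> \<and> card \<sigma> = 5" "\<Union>S = vertex_set M - {x}"
      "link x M = ridge_complex 4 S"
      "\<And>\<alpha> \<sigma>. \<sigma> \<in> S \<Longrightarrow> \<alpha> \<subseteq> \<sigma> \<Longrightarrow> card \<alpha> \<le> 3 \<Longrightarrow> \<alpha> \<in> link x M"
      "\<And>K. \<forall>p\<in>K. \<forall>q\<in>K. {p, q} \<in> link x M \<Longrightarrow> \<exists>\<sigma>\<in>S. K \<subseteq> \<sigma>"
      by (fact link_structure[OF M x])
    have eq: "{\<sigma>\<in>six_cliques M. x \<in> \<sigma>} = insert x ` S" by (rule star_six_cliques[OF M x S(1-3,5,6)])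
    have "S \<noteq> {}" using stacked_family_finite[OF S(1)] by blast
    then have "\<Union>(insert x ` S) = vertex_set M" using S(3) x by auto
    moreover have "stacked_family (insert x ` S)" by (rule stacked_family_insert[OF S(1)]) (simp add: S(3))
    ultimately show ?thesis using eq by simp
  qed
  then show ?thesis using card by (auto simp: tight_def six_cliques_def)
qed

text \<open>Both sides are compared at a vertex \<open>x\<close> of the face: removing
  \<open>x\<close> turns them into the link and the boundary of its ball, and the numbers of facets
  over a ridge agree. The empty face has no such vertex and is treated separately.\<close>

lemma complex_eq_ridges:
  assumes M: "M \<in> neighborly_walkup_class 4" and ne: "vertex_set M \<noteq> {}"
  shows "M = ridge_complex 5 (six_cliques M)"
proof -
  have ac: "\<And>\<alpha> \<beta>. \<beta> \<in> M \<Longrightarrow> \<alpha> \<subseteq> \<beta> \<Longrightarrow> \<alpha> \<in> M"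
    using M by (auto simp: neighborly_walkup_class_def walkup_class_def abstract_complex_def)
  let ?R = "ridge_complex 5 (six_cliques M)"
  have local: "\<alpha> \<in> M \<longleftrightarrow> \<alpha> \<in> ?R" if x: "x \<in> \<alpha>" for \<alpha> x
  proof (cases "x \<in> vertex_set M")
    case False
    then have "\<alpha> \<notin> M" using x by (auto simp: vertex_set_def)
    moreover have "\<alpha> \<notin> ?R"
    proof
      assume "\<alpha> \<in> ?R"
      then obtain \<beta> where b: "card {\<sigma>\<in>six_cliques M. \<beta> \<subseteq> \<sigma>} = 1" "\<alpha> \<subseteq> \<beta>" by (auto simp: ridge_complex_def)
      have "{\<sigma>\<in>six_cliques M. \<beta> \<subseteq> \<sigma>} \<noteq> {}" using b(1) by (metis card.empty zero_neq_one)
      then show False using b(2) x False by (auto simp: six_cliques_def)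
    qed
    ultimately show ?thesis by blast
  next
    case True
    obtain S where S: "stacked_family S" "\<forall>\<sigma>\<in>S. finite \<sigma> \<and> card \<sigma> = 5" "\<Union>S = vertex_set M - {x}"
      "link x M = ridge_complex 4 S"
      "\<And>\<alpha> \<sigma>. \<sigma> \<in> S \<Longrightarrow> \<alpha> \<subseteq> \<sigma> \<Longrightarrow> card \<alpha> \<le> 3 \<Longrightarrow> \<alpha> \<in> link x M"
      "\<And>K. \<forall>p\<in>K. \<forall>q\<in>K. {p, q} \<in> link x M \<Longrightarrow> \<exists>\<sigma>\<in>S. K \<subseteq> \<sigma>"
      by (fact link_structure[OF M True])
    have eq: "{\<sigma>\<in>six_cliques M. x \<in> \<sigma>} = insert x ` S" by (rule star_six_cliques[OF M True S(1-3,5,6)])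
    have xS: "x \<notin> \<sigma>" if "\<sigma> \<in> S" for \<sigma> using that S(3) by blast
    have cnt: "card {\<sigma>\<in>six_cliques M. insert x \<beta> \<subseteq> \<sigma>} = card {\<sigma>\<in>S. \<beta> \<subseteq> \<sigma>}" if "x \<notin> \<beta>" for \<beta>
    proof -
      have "{\<sigma>\<in>six_cliques M. insert x \<beta> \<subseteq> \<sigma>} = {\<sigma>\<in>{\<sigma>\<in>six_cliques M. x \<in> \<sigma>}. \<beta> \<subseteq> \<sigma>}" by blast
      also have "\<dots> = insert x ` {\<sigma>\<in>S. \<beta> \<subseteq> \<sigma>}" unfolding eq using \<open>x \<notin> \<beta>\<close> by blast
      moreover have "inj_on (insert x) {\<sigma>\<in>S. \<beta> \<subseteq> \<sigma>}"
        by (rule inj_onI) (metis (no_types, lifting) insert_ident mem_Collect_eq xS)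
      ultimately show ?thesis by (simp add: card_image)
    qed
    have "\<alpha> \<in> M \<longleftrightarrow> \<alpha> - {x} \<in> link x M"
      using x ac[of \<alpha> "\<alpha> - {x}"] by (auto simp: link_def insert_absorb)
    also have "\<dots> \<longleftrightarrow> \<alpha> \<in> ?R"
    proof
      assume "\<alpha> - {x} \<in> link x M"
      then obtain \<beta> where b: "card \<beta> = 4" "card {\<sigma>\<in>S. \<beta> \<subseteq> \<sigma>} = 1" "\<alpha> - {x} \<subseteq> \<beta>"
        unfolding S(4) ridge_complex_def by blast
      have "{\<sigma>\<in>S. \<beta> \<subseteq> \<sigma>} \<noteq> {}" using b(2) by (metis card.empty zero_neq_one)
      then have xb: "x \<notin> \<beta>" using xS by blast
      have "finite \<beta>" using b(1) by (auto intro: card_ge_0_finite)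
      then have "card (insert x \<beta>) = 5" using xb b(1) by simp
      moreover have "card {\<sigma>\<in>six_cliques M. insert x \<beta> \<subseteq> \<sigma>} = 1" using cnt[OF xb] b(2) by simp
      moreover have "\<alpha> \<subseteq> insert x \<beta>" using b(3) by blast
      ultimately show "\<alpha> \<in> ?R" unfolding ridge_complex_def by blast
    next
      assume "\<alpha> \<in> ?R"
      then obtain \<beta> where b: "card \<beta> = 5" "card {\<sigma>\<in>six_cliques M. \<beta> \<subseteq> \<sigma>} = 1" "\<alpha> \<subseteq> \<beta>"
        unfolding ridge_complex_def by blast
      have xb: "x \<in> \<beta>" using b(3) x by blast
      have "finite \<beta>" using b(1) by (auto intro: card_ge_0_finite)
      then have "card (\<beta> - {x}) = 4" using xb b(1) by simp
      moreover have "card {\<sigma>\<in>S. \<beta> - {x} \<subseteq> \<sigma>} = 1" using cnt[of "\<beta> - {x}"] b(2) xb by (simp add: insert_absorb)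
      moreover have "\<alpha> - {x} \<subseteq> \<beta> - {x}" using b(3) by blast
      ultimately show "\<alpha> - {x} \<in> link x M" unfolding S(4) ridge_complex_def by blast
    qed
    finally show ?thesis .
  qed
  have "{} \<in> M \<longleftrightarrow> {} \<in> ?R"
  proof -
    obtain \<alpha> x where a: "\<alpha> \<in> M" "x \<in> \<alpha>" using ne by (auto simp: vertex_set_def)
    then have "{} \<in> M" using ac by blast
    moreover have "\<alpha> \<in> ?R" using local a by blast
    then have "{} \<in> ?R" by (auto simp: ridge_complex_def)
    ultimately show ?thesis by blast
  qed
  then have "\<alpha> \<in> M \<longleftrightarrow> \<alpha> \<in> ?R" for \<alpha> using local[of _ \<alpha>] by (cases "\<alpha> = {}") auto
  then show ?thesis by blast
qed

lemma six_cliques_automorphism: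
  assumes "simplicial_iso f M M" "\<sigma> \<in> six_cliques M"
  shows "f ` \<sigma> \<in> six_cliques M"
proof -
  let ?V = "vertex_set M"
  have f: "inj_on f ?V" "f ` ?V = ?V" "\<And>\<alpha>. \<alpha> \<subseteq> ?V \<Longrightarrow> \<alpha> \<in> M \<longleftrightarrow> f ` \<alpha> \<in> M"
    using assms(1) by (auto simp: simplicial_iso_def bij_betw_def)
  have s: "\<sigma> \<subseteq> ?V" "card \<sigma> = 6" "\<And>\<tau>. \<tau> \<subseteq> \<sigma> \<Longrightarrow> card \<tau> = 3 \<Longrightarrow> \<tau> \<in> M"
    using assms(2) by (auto simp: six_cliques_def)
  have inj: "inj_on f \<sigma>" by (rule inj_on_subset[OF f(1) s(1)])
  have "f ` \<sigma> \<subseteq> ?V" using s(1) f(2) by blast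
  moreover have "card (f ` \<sigma>) = 6" using inj s(2) by (simp add: card_image)
  moreover have "\<tau> \<in> M" if t: "\<tau> \<subseteq> f ` \<sigma>" "card \<tau> = 3" for \<tau>
  proof -
    obtain \<rho> where r: "\<rho> \<subseteq> \<sigma>" "\<tau> = f ` \<rho>" using t(1) by (auto simp: subset_image_iff)
    have "card \<rho> = 3" using r t(2) card_image[OF inj_on_subset[OF inj r(1)]] by simp
    then have "\<rho> \<in> M" using s(3) r(1) by blast
    then show ?thesis using f(3)[of \<rho>] r s(1) by blast
  qed
  ultimately show ?thesis by (simp add: six_cliques_def)
qed

section \<open>Labelling and conclusion\<close>

lemma orbit_representatives:
  "finite X \<Longrightarrow> (\<And>v. v \<in> X \<Longrightarrow> f v \<in> X \<and> f (f (f v)) = v \<and> f v \<noteq> v) \<Longrightarrow> card X = 3 * n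
    \<Longrightarrow> \<exists>rs. length rs = n \<and> set (concat (map (\<lambda>x. [x, f x, f (f x)]) rs)) = X"
proof (induction n arbitrary: X)
  case 0
  then show ?case by simp
next
  case (Suc n)
  then obtain x where x: "x \<in> X" by fastforce
  let ?O = "{x, f x, f (f x)}"
  have O: "?O \<subseteq> X" using Suc.prems(2) x by blast
  have "f x \<noteq> x" "f (f x) \<noteq> f x" "f (f x) \<noteq> x" using Suc.prems(2) x by metis+
  then have "card ?O = 3" by (metis card_3_iff)
  then have "card (X - ?O) = 3 * n" using Suc.prems(1,3) O by (simp add: card_Diff_subset)
  moreover have "f v \<in> X - ?O \<and> f (f (f v)) = v \<and> f v \<noteq> v" if "v \<in> X - ?O" for v
  proof -
    have v: "v \<in> X" "v \<noteq> x" "v \<noteq> f x" "v \<noteq> f (f x)" using that by blast+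
    have c: "f (f (f v)) = v" "f (f (f x)) = x" using Suc.prems(2) v x by blast+
    have "f v \<noteq> x" "f v \<noteq> f x" "f v \<noteq> f (f x)"
    proof -
      show "f v \<noteq> x" using c(1) v(4) by auto
      show "f v \<noteq> f x" using c v(2) by metis
      show "f v \<noteq> f (f x)"
      proof
        assume "f v = f (f x)"
        then have "f (f (f v)) = f (f (f (f x)))" by simp
        then show False using c v(3) by simp
      qed
    qed
    moreover have "f v \<in> X" "f v \<noteq> v" using Suc.prems(2)[OF v(1)] by blast+
    ultimately show ?thesis using c(1) by simp
  qed
  ultimately obtain rs where rs: "length rs = n" "set (concat (map (\<lambda>x. [x, f x, f (f x)]) rs)) = X - ?O"
    using Suc.IH[OF finite_Diff[OF Suc.prems(1)]] by blast
  have "set (concat (map (\<lambda>x. [x, f x, f (f x)]) (x # rs)))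
    = ?O \<union> set (concat (map (\<lambda>x. [x, f x, f (f x)]) rs))" by auto
  also have "\<dots> = ?O \<union> (X - ?O)" by (simp only: rs(2))
  also have "\<dots> = X" using O by blast
  finally show ?case using rs(1) by (intro exI[of _ "x # rs"]) simp
qed

definition label :: "'a list \<Rightarrow> vertex \<Rightarrow> 'a" where
  "label L v = L ! (case v of a1 \<Rightarrow> 0 | b1 \<Rightarrow> 1 | c1 \<Rightarrow> 2 | a2 \<Rightarrow> 3 | b2 \<Rightarrow> 4 | c2 \<Rightarrow> 5 | a3 \<Rightarrow> 6 | b3 \<Rightarrow> 7 | c3 \<Rightarrow> 8
     | a4 \<Rightarrow> 9 | b4 \<Rightarrow> 10 | c4 \<Rightarrow> 11 | a5 \<Rightarrow> 12 | b5 \<Rightarrow> 13 | c5 \<Rightarrow> 14)"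

lemma label_bij:
  assumes "length L = 15" "set L = V" "card V = 15"
  shows "bij_betw (label L) UNIV V"
proof -
  obtain x0 x1 x2 x3 x4 x5 x6 x7 x8 x9 x10 x11 x12 x13 x14
    where L: "L = [x0, x1, x2, x3, x4, x5, x6, x7, x8, x9, x10, x11, x12, x13, x14]"
    using assms(1) by (auto simp: numeral_eq_Suc length_Suc_conv)
  have "range (label L) = V" unfolding UNIV_vertex assms(2)[symmetric] L by (simp add: label_def)
  moreover from this have "inj (label L)"
    using eq_card_imp_inj_on[OF finite_vertex, of "label L"] assms(3) by (simp add: UNIV_vertex)
  ultimately show ?thesis by (simp add: bij_betw_def)
qed

context symmetric_family
begin

text \<open>Without fixed vertices 15 = 3 * 5; otherwise 15 = 3 + 3 * 4, and the names
  \<open>a1\<close>, \<open>b1\<close>, \<open>c1\<close> go to the fixed vertices.\<close>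

lemma labelling:
  assumes "\<exists>v\<in>V. f v \<noteq> v"
  obtains e where "bij_betw e UNIV V" "(\<forall>v. e (\<phi> v) = f (e v)) \<or> (\<forall>v. e (\<psi> v) = f (e v))"
proof -
  let ?X = "V - fixed"
  have cl: "f v \<in> ?X \<and> f (f (f v)) = v \<and> f v \<noteq> v" if "v \<in> ?X" for v
  proof -
    have "v \<in> V" "f v \<noteq> v" using that by (auto simp: fixed_def)
    then show ?thesis using f_V f_cubed by (auto simp: fixed_def) metis
  qed
  have fX: "finite ?X" using finite_V by simp
  have fV: "finite fixed" "fixed \<subseteq> V" using finite_V by (auto simp: fixed_def)
  show ?thesis
  proof (cases "fixed = {}")
    case True
    then have "card ?X = 3 * 5" using card_V by simp
    from orbit_representatives[OF fX cl this]
    obtain rs where rs: "length rs = 5" "set (concat (map (\<lambda>x. [x, f x, f (f x)]) rs)) = V" using True by auto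
    then obtain r1 r2 r3 r4 r5 where r: "rs = [r1, r2, r3, r4, r5]"
      by (auto simp: numeral_eq_Suc length_Suc_conv)
    let ?L = "concat (map (\<lambda>x. [x, f x, f (f x)]) rs)"
    have "r1 \<in> V" "r2 \<in> V" "r3 \<in> V" "r4 \<in> V" "r5 \<in> V" using rs(2) unfolding r by auto
    then have "label ?L (\<phi> v) = f (label ?L v)" for v
      unfolding r by (cases v) (simp_all add: label_def f_cubed)
    moreover have "bij_betw (label ?L) UNIV V" by (rule label_bij[OF _ rs(2) card_V]) (simp add: r)
    ultimately show ?thesis using that by blast
  next
    case False
    have "card fixed = 3" by (rule fixed_points(1)[OF assms False])
    then obtain p q s where F: "fixed = {p, q, s}" by (auto simp: card_3_iff)
    have "card ?X = 3 * 4" using card_V fV \<open>card fixed = 3\<close> by (simp add: card_Diff_subset)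
    from orbit_representatives[OF fX cl this]
    obtain rs where rs: "length rs = 4" "set (concat (map (\<lambda>x. [x, f x, f (f x)]) rs)) = ?X" by blast
    then obtain r1 r2 r3 r4 where r: "rs = [r1, r2, r3, r4]"
      by (auto simp: numeral_eq_Suc length_Suc_conv)
    let ?L = "p # q # s # concat (map (\<lambda>x. [x, f x, f (f x)]) rs)"
    have L: "set ?L = V" using rs(2) F fV(2) by (simp only: list.set) blast
    have "r1 \<in> V" "r2 \<in> V" "r3 \<in> V" "r4 \<in> V" using rs(2) unfolding r by auto
    moreover have "f p = p" "f q = q" "f s = s" using F unfolding fixed_def by blast+
    ultimately have "label ?L (\<psi> v) = f (label ?L v)" for v
      unfolding r by (cases v) (simp_all add: label_def \<psi>_def f_cubed)
    moreover have "bij_betw (label ?L) UNIV V" by (rule label_bij[OF _ L card_V]) (simp add: r)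
    ultimately show ?thesis using that by blast
  qed
qed

lemma isomorphic_to_model:
  assumes "\<exists>v\<in>V. f v \<noteq> v"
  shows "\<exists>i\<in>{1..12}. \<exists>g. bij_betw g V UNIV \<and> (`) g ` F = N_facets i"
proof -
  obtain e where e: "bij_betw e UNIV V" "(\<forall>v. e (\<phi> v) = f (e v)) \<or> (\<forall>v. e (\<psi> v) = f (e v))"
    using labelling[OF assms] by metis
  let ?e' = "inv_into UNIV e"
  have b: "bij_betw ?e' V UNIV" by (rule bij_betw_inv_into[OF e(1)])
  have inj: "inj e" and im: "range e = V" using e(1) by (auto simp: bij_betw_def)
  let ?G = "(`) ?e' ` F"
  have t: "tight UNIV ?G" by (rule tight_image[OF tight b])
  have inv: "h ` \<sigma> \<in> ?G" if h: "\<And>v. e (h v) = f (e v)" and \<sigma>: "\<sigma> \<in> ?G" for h \<sigma>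
  proof -
    obtain \<rho> where r: "\<rho> \<in> F" "\<sigma> = ?e' ` \<rho>" using \<sigma> by blast
    have "h (?e' w) = ?e' (f w)" if "w \<in> \<rho>" for w
    proof -
      have "w \<in> range e" using F_V[OF r(1)] im that by blast
      then have "e (h (?e' w)) = f w" using h by (simp add: f_inv_into_f)
      then show ?thesis using inj by (metis inv_into_f_f UNIV_I)
    qed
    then have "h ` \<sigma> = ?e' ` f ` \<rho>" unfolding r(2) image_image by (intro image_cong refl) simp
    then show ?thesis using f_F[OF r(1)] by blast
  qed
  from e(2) have "\<forall>v. e (\<phi> v) = f (e v)"
  proof
    assume h: "\<forall>v. e (\<psi> v) = f (e v)"
    have False by (rule fixing_case[OF t]) (use inv[of \<psi>] h in blast)
    then show ?thesis ..
  qed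
  then have "target ?G" by (intro free_case[OF t]) (use inv[of \<phi>] in blast)
  then obtain i \<pi> where p: "i \<in> {1..12}" "bij \<pi>" "(`) \<pi> ` ?G = N_facets i" by (auto simp: target_def)
  have "bij_betw (\<pi> \<circ> ?e') V UNIV" by (rule bij_betw_trans[OF b p(2)])
  moreover have "(`) (\<pi> \<circ> ?e') ` F = N_facets i" using p(3) by (simp add: image_image image_comp)
  ultimately show ?thesis using p(1) by blast
qed

end

section \<open>Transport of boundaries, and a vertex map of order three from the group\<close>

lemma inj_on_subset_image_iff:
  assumes "inj_on g V" "A \<subseteq> V" "B \<subseteq> V"
  shows "g ` A \<subseteq> g ` B \<longleftrightarrow> A \<subseteq> B"
proof
  assume s: "g ` A \<subseteq> g ` B"
  show "A \<subseteq> B"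
  proof
    fix a assume a: "a \<in> A"
    then obtain b where "b \<in> B" "g a = g b" using s by blast
    then show "a \<in> B" using assms a by (metis inj_onD subsetD)
  qed
qed blast

lemma ridge_complex_image:
  assumes inj: "inj_on g V" and sub: "\<And>\<sigma>. \<sigma> \<in> F \<Longrightarrow> \<sigma> \<subseteq> V"
  shows "ridge_complex d ((`) g ` F) = (`) g ` ridge_complex d F"
proof -
  have cnt: "card {\<sigma>\<in>(`) g ` F. g ` \<beta> \<subseteq> \<sigma>} = card {\<sigma>\<in>F. \<beta> \<subseteq> \<sigma>}" if "\<beta> \<subseteq> V" for \<beta>
  proof -
    have "{\<sigma>\<in>(`) g ` F. g ` \<beta> \<subseteq> \<sigma>} = (`) g ` {\<sigma>\<in>F. \<beta> \<subseteq> \<sigma>}"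
      using inj_on_subset_image_iff[OF inj that sub] by blast
    moreover have "inj_on ((`) g) {\<sigma>\<in>F. \<beta> \<subseteq> \<sigma>}"
      by (rule inj_on_subset[OF inj_on_image_Pow[OF inj]]) (use sub in blast)
    ultimately show ?thesis by (simp add: card_image)
  qed
  have in_V: "\<beta> \<subseteq> V" if "card {\<sigma>\<in>F. \<beta> \<subseteq> \<sigma>} = 1" for \<beta>
  proof -
    have "{\<sigma>\<in>F. \<beta> \<subseteq> \<sigma>} \<noteq> {}" using that by (metis card.empty zero_neq_one)
    then show ?thesis using sub by blast
  qed
  have crd: "card (g ` \<beta>) = card \<beta>" if "\<beta> \<subseteq> V" for \<beta>
    by (rule card_image[OF inj_on_subset[OF inj that]])
  show ?thesis
  proof
    show "ridge_complex d ((`) g ` F) \<subseteq> (`) g ` ridge_complex d F"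
    proof
      fix \<alpha> assume "\<alpha> \<in> ridge_complex d ((`) g ` F)"
      then obtain \<beta> where b: "card \<beta> = d" "card {\<sigma>\<in>(`) g ` F. \<beta> \<subseteq> \<sigma>} = 1" "\<alpha> \<subseteq> \<beta>"
        by (auto simp: ridge_complex_def)
      have "{\<sigma>\<in>(`) g ` F. \<beta> \<subseteq> \<sigma>} \<noteq> {}" using b(2) by (metis card.empty zero_neq_one)
      then obtain \<sigma> where "\<sigma> \<in> F" "\<beta> \<subseteq> g ` \<sigma>" by blast
      then obtain \<beta>' where b': "\<beta>' \<subseteq> \<sigma>" "\<beta> = g ` \<beta>'" by (auto simp: subset_image_iff)
      then have V: "\<beta>' \<subseteq> V" using sub[OF \<open>\<sigma> \<in> F\<close>] by blast
      obtain \<alpha>' where a': "\<alpha>' \<subseteq> \<beta>'" "\<alpha> = g ` \<alpha>'" using b(3) b'(2) by (auto simp: subset_image_iff)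
      have "card \<beta>' = d" "card {\<sigma>\<in>F. \<beta>' \<subseteq> \<sigma>} = 1" using b(1,2) crd[OF V] cnt[OF V] b'(2) by simp_all
      then have "\<alpha>' \<in> ridge_complex d F" using a'(1) unfolding ridge_complex_def by blast
      then show "\<alpha> \<in> (`) g ` ridge_complex d F" using a'(2) by blast
    qed
    show "(`) g ` ridge_complex d F \<subseteq> ridge_complex d ((`) g ` F)"
    proof
      fix \<alpha> assume "\<alpha> \<in> (`) g ` ridge_complex d F"
      then obtain \<alpha>' \<beta> where b: "\<alpha> = g ` \<alpha>'" "card \<beta> = d" "card {\<sigma>\<in>F. \<beta> \<subseteq> \<sigma>} = 1" "\<alpha>' \<subseteq> \<beta>"
        unfolding ridge_complex_def by blast
      have V: "\<beta> \<subseteq> V" by (rule in_V[OF b(3)])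
      have "card (g ` \<beta>) = d" "card {\<sigma>\<in>(`) g ` F. g ` \<beta> \<subseteq> \<sigma>} = 1" using b(2,3) crd[OF V] cnt[OF V] by simp_all
      moreover have "\<alpha> \<subseteq> g ` \<beta>" using b(1,4) by blast
      ultimately show "\<alpha> \<in> ridge_complex d ((`) g ` F)" unfolding ridge_complex_def by blast
    qed
  qed
qed

text \<open>\<open>f\<close> corresponds to 1 in the integers modulo 3. Automorphisms are
  \<open>undefined\<close> off the vertices, so one that differs from the identity must move a
  vertex.\<close>

lemma automorphism_of_order_3:
  assumes H: "subgroup H (aut_group M)" and iso: "(aut_group M)\<lparr>carrier := H\<rparr> \<cong> integer_mod_group 3"
  obtains f where "simplicial_iso f M M" "\<And>v. v \<in> vertex_set M \<Longrightarrow> f v \<in> vertex_set M \<and> f (f (f v)) = v"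
    "\<exists>v\<in>vertex_set M. f v \<noteq> v"
proof -
  let ?A = "aut_group M" and ?V = "vertex_set M"
  interpret A: group ?A by (rule group_aut_group)
  interpret H: subgroup H ?A by (rule H)
  obtain h where h: "h \<in> iso (?A\<lparr>carrier := H\<rparr>) (integer_mod_group 3)" using iso by (auto simp: is_iso_def)
  have hm: "h (x \<otimes>\<^bsub>?A\<^esub> y) = (h x + h y) mod 3" if "x \<in> H" "y \<in> H" for x y
    using h that by (auto simp: iso_def hom_def)
  have bij: "bij_betw h H {0..<3}" using h by (simp add: iso_def carrier_integer_mod_group)
  then have inj: "inj_on h H" and im: "h ` H = {0..<3}" by (auto simp: bij_betw_def)
  let ?e = "\<one>\<^bsub>?A\<^esub>"
  have e: "?e \<in> H" by (rule H.one_closed)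
  have "h ?e \<in> {0..<3}" using im e by blast
  moreover have "h ?e = (h ?e + h ?e) mod 3" using hm[OF e e] e H.subset by simp
  ultimately have he: "h ?e = 0" by auto presburger
  have "1 \<in> h ` H" using im by simp
  then obtain f where f: "f \<in> H" "h f = 1" by auto
  have ff: "f \<otimes>\<^bsub>?A\<^esub> f \<in> H" "f \<otimes>\<^bsub>?A\<^esub> (f \<otimes>\<^bsub>?A\<^esub> f) \<in> H" using f(1) H.m_closed by blast+
  have "h (f \<otimes>\<^bsub>?A\<^esub> (f \<otimes>\<^bsub>?A\<^esub> f)) = 0" using hm[OF f(1) ff(1)] hm[OF f(1) f(1)] f(2) by simp
  then have cube: "f \<otimes>\<^bsub>?A\<^esub> (f \<otimes>\<^bsub>?A\<^esub> f) = ?e" using inj ff(2) e he by (metis inj_onD)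
  have fe: "f \<noteq> ?e" using f(2) he by auto
  have fA: "f \<in> Bij ?V" "simplicial_iso f M M"
    using f(1) H.subset by (auto simp: aut_group_def)
  have one: "?e = (\<lambda>x\<in>?V. x)" by (simp add: aut_group_def BijGroup_def)
  have mult: "f \<otimes>\<^bsub>?A\<^esub> g = compose ?V f g" if "g \<in> Bij ?V" for g
    using that fA(1) by (simp add: aut_group_def BijGroup_def)
  have fV: "f v \<in> ?V" if "v \<in> ?V" for v using fA(1) that by (auto simp: Bij_def bij_betw_def)
  have cb: "compose ?V f (compose ?V f f) = (\<lambda>x\<in>?V. x)"
    using cube mult[OF fA(1)] mult[OF compose_Bij[OF fA(1) fA(1)]] one by simp
  have cubed: "f (f (f v)) = v" if "v \<in> ?V" for v
    using fun_cong[OF cb, of v] that by (simp add: compose_def)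
  have "\<exists>v\<in>?V. f v \<noteq> v"
  proof (rule ccontr)
    assume "\<not> (\<exists>v\<in>?V. f v \<noteq> v)"
    then have "f = (\<lambda>x\<in>?V. x)" using fA(1) by (auto simp: Bij_def extensional_def restrict_def)
    then show False using fe one by simp
  qed
  then show ?thesis using that fA(2) fV cubed by blast
qed

theorem theorem3p3:
  fixes M :: "'a set set"
  assumes "M \<in> neighborly_walkup_class 4"
    and "card (vertex_set M) = 15"
    and "\<exists>H. subgroup H (aut_group M) \<and>
           (aut_group M)\<lparr>carrier := H\<rparr> \<cong> integer_mod_group 3"
  shows "\<exists>i\<in>{1..12::nat}. M \<cong>\<^sub>s boundary_complex 5 (N i)"
proof -
  let ?V = "vertex_set M" and ?F = "six_cliques M"
  obtain f where f: "simplicial_iso f M M" "\<And>v. v \<in> ?V \<Longrightarrow> f v \<in> ?V \<and> f (f (f v)) = v" "\<exists>v\<in>?V. f v \<noteq> v"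
    using assms(3) automorphism_of_order_3 by blast
  interpret symmetric_family ?V ?F f
    by unfold_locales (use tight_six_cliques[OF assms(1,2)] six_cliques_automorphism[OF f(1)] f(2) in auto)
  obtain i g where i: "i \<in> {1..12}" and g: "bij_betw g ?V UNIV" "(`) g ` ?F = N_facets i"
    using isomorphic_to_model[OF f(3)] by blast
  have inj: "inj_on g ?V" using g(1) by (simp add: bij_betw_def)
  have ne: "?V \<noteq> {}" using assms(2) by auto
  have M: "M = ridge_complex 5 ?F" by (rule complex_eq_ridges[OF assms(1) ne])
  \<comment> \<open>Inherited from the isomorphic family instead of being computed from the
    lists.\<close>
  have "\<forall>\<sigma>\<in>N_facets i. finite \<sigma> \<and> card \<sigma> = 6"
    using g(2)[symmetric] fin_mem card_F_mem F_V inj_on_subset[OF inj] by (auto simp: card_image)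
  then have "boundary_complex 5 (generated (N_facets i)) = ridge_complex 5 (N_facets i)"
    by (rule boundary_generated)
  moreover have "N i = generated (N_facets i)" by (simp add: N_def generated_def)
  ultimately have N: "boundary_complex 5 (N i) = (`) g ` M"
    using ridge_complex_image[OF inj F_V, of ?F 5] g(2) M by simp
  have sub: "\<alpha> \<subseteq> ?V" if "\<alpha> \<in> M" for \<alpha> using that by (auto simp: vertex_set_def)
  have "vertex_set ((`) g ` M) = g ` ?V" by (auto simp: vertex_set_def)
  then have "bij_betw g ?V (vertex_set (boundary_complex 5 (N i)))"
    unfolding N using inj by (simp add: bij_betw_def)
  moreover have "\<alpha> \<in> M \<longleftrightarrow> g ` \<alpha> \<in> boundary_complex 5 (N i)" if "\<alpha> \<subseteq> ?V" for \<alpha>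
  proof
    assume "g ` \<alpha> \<in> boundary_complex 5 (N i)"
    then obtain \<beta> where "\<beta> \<in> M" "g ` \<alpha> = g ` \<beta>" unfolding N by blast
    then show "\<alpha> \<in> M" using inj_on_image_eq_iff[OF inj that sub] by metis
  qed (auto simp: N)
  ultimately have "simplicial_iso g M (boundary_complex 5 (N i))" by (simp add: simplicial_iso_def)
  then show ?thesis using i by (auto simp: isomorphic_complexes_def)
qed

end
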